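(* Let $\alpha_1=1/2$, $\rho>\rho_c$, $n\ge1$, and let $k$ be the index with $E_k(V)=\epsilon_{(n,1,1),V}$. Then for $\lambda>0$, $$\lim_{V\to\infty}\big\langle\exp\{-\lambda N_k/V\}\big\rangle^C_V(\rho)=\frac{\displaystyle\sum_{m\ge1,\,m\neq n}b_{m,n}\frac{\eta_{m,n}^2}{\eta_{m,n}-\lambda}\Big\{\exp[-\lambda(\rho-\rho_c)]-\exp[-\eta_{m,n}(\rho-\rho_c)]\Big\}}{\displaystyle\sum_{m\ge1,\,m\neq n}b_{m,n}\eta_{m,n}\Big\{1-\exp[-\eta_{m,n}(\rho-\rho_c)]\Big\}}.$$
   Context: Fix exponents $\alpha_1\ge\alpha_2\ge\alpha_3>0$ with $\alpha_1+\alpha_2+\alpha_3=1$ and $\Lambda_V=\{x\in\mathbb{R}^3:0\le x_j\le V^{\alpha_j}\}$. The one-particle Hamiltonian $-\Delta/2$ on $L^2(\Lambda_V)$ with Dirichlet boundary conditions has eigenvalues $\epsilon_{\mathbf{n},V}=\frac{\pi^2}{2}\sum_jn_j^2V^{-2\alpha_j}$, $n_j\ge1$, ordered as $E_1(V)<E_2(V)\le\dots$; $N_k$ is the occupation number of the $k$-th eigenstate. Perfect Bose gas at inverse temperature $\beta>0$; canonical state at density $\rho=N/V$: $\langle\cdot\rangle^C_V(\rho)=Z_V(N)^{-1}\mathrm{Tr}(\cdot\,e^{-\beta T_V^{(N)}})$ on the symmetric $N$-particle space; the limit at fixed $\rho$ means $N$ particles in volume $V=N/\rho$, $N\to\infty$.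 Let $\epsilon_m=\pi^2m^2/2$, $\eta_{m,n}=\beta(\epsilon_m-\epsilon_n)$ and for $m\neq n$, $b_{m,n}=\eta_{m,n}^{-1}\prod_{m'\neq n,\,m'\neq m}(1-\eta_{m,n}/\eta_{m',n})^{-1}$. $F(\eta)=\frac{\sqrt2}{3\pi^2}\eta^{3/2}$, $\rho_c=\int_0^\infty(e^{\beta\eta}-1)^{-1}F(d\eta)$.
   Formalization: Since b_{m,n}η_{m,n} = (−1)^{m+n+1}m²/n², both series diverge in the ordinary sense; they are read as Abel sums, whose existence is proved. Values λ = η_{m,n}, where a term of the numerator is 0/0, are excluded. *)

theory Defs
  imports "HOL-Analysis.Analysis" "HOL-Library.Multiset"
begin

(* One-particle Dirichlet eigenvalue eps_{q,V} of -Delta/2 in the box with sides V^a1, V^a2, V^a3 *)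
definition eps_box :: "real \<Rightarrow> real \<Rightarrow> real \<Rightarrow> real \<Rightarrow> nat \<times> nat \<times> nat \<Rightarrow> real" where
  "eps_box a1 a2 a3 V q = (case q of (n1, n2, n3) \<Rightarrow>
      pi^2 / 2 * (real n1 ^ 2 * V powr (-2 * a1) + real n2 ^ 2 * V powr (-2 * a2)
                  + real n3 ^ 2 * V powr (-2 * a3)))"

definition modes :: "(nat \<times> nat \<times> nat) set" where
  "modes = {(a, b, c). 1 \<le> a \<and> 1 \<le> b \<and> 1 \<le> c}"

(* occupation-number basis of the symmetric N-particle space: multisets of modes of size N;
   count M q is the occupation number of the one-particle eigenstate q *)
definition nstates :: "nat \<Rightarrow> (nat \<times> nat \<times> nat) multiset set" where
  "nstates N = {M. size M = N \<and> set_mset M \<subseteq> modes}"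

(* eigenvalue of T_V^(N) on the basis vector M *)
definition energy :: "real \<Rightarrow> real \<Rightarrow> real \<Rightarrow> real \<Rightarrow> (nat \<times> nat \<times> nat) multiset \<Rightarrow> real" where
  "energy a1 a2 a3 V M = sum_mset (image_mset (eps_box a1 a2 a3 V) M)"

definition gibbs :: "real \<Rightarrow> real \<Rightarrow> real \<Rightarrow> real \<Rightarrow> real \<Rightarrow> (nat \<times> nat \<times> nat) multiset \<Rightarrow> real" where
  "gibbs \<beta> a1 a2 a3 V M = exp (- \<beta> * energy a1 a2 a3 V M)"

(* canonical partition function Z_V(N) = Tr exp(-beta T_V^(N)) *)
definition canon_Z :: "real \<Rightarrow> real \<Rightarrow> real \<Rightarrow> real \<Rightarrow> real \<Rightarrow> nat \<Rightarrow> real" where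
  "canon_Z \<beta> a1 a2 a3 V N = infsum (gibbs \<beta> a1 a2 a3 V) (nstates N)"

(* canonical expectation of an observable diagonal in the occupation-number basis *)
definition canon_state :: "real \<Rightarrow> real \<Rightarrow> real \<Rightarrow> real \<Rightarrow> real \<Rightarrow> nat
      \<Rightarrow> ((nat \<times> nat \<times> nat) multiset \<Rightarrow> real) \<Rightarrow> real" where
  "canon_state \<beta> a1 a2 a3 V N A =
     infsum (\<lambda>M. A M * gibbs \<beta> a1 a2 a3 V M) (nstates N) / canon_Z \<beta> a1 a2 a3 V N"

definition canon_at_density :: "real \<Rightarrow> real \<Rightarrow> real \<Rightarrow> real \<Rightarrow> real \<Rightarrow> nat
      \<Rightarrow> ((nat \<times> nat \<times> nat) multiset \<Rightarrow> real) \<Rightarrow> real" where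
  "canon_at_density \<beta> a1 a2 a3 \<rho> N A = canon_state \<beta> a1 a2 a3 (real N / \<rho>) N A"

definition eps1 :: "nat \<Rightarrow> real" where
  "eps1 m = pi^2 * real m ^ 2 / 2"

definition eta :: "real \<Rightarrow> nat \<Rightarrow> nat \<Rightarrow> real" where
  "eta \<beta> m n = \<beta> * (eps1 m - eps1 n)"

definition bcoef :: "real \<Rightarrow> nat \<Rightarrow> nat \<Rightarrow> real" where
  "bcoef \<beta> m n = inverse (eta \<beta> m n) *
     prodinf (\<lambda>m'. if m' = 0 \<or> m' = n \<or> m' = m then 1
                    else inverse (1 - eta \<beta> m n / eta \<beta> m' n))"

(* integrated density of states F(eta) = sqrt 2/(3 pi^2) eta^(3/2), extended by 0 for eta <= 0 *)
definition Fdos :: "real \<Rightarrow> real" where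
  "Fdos x = sqrt 2 / (3 * pi^2) * (max 0 x) powr (3/2)"

definition rho_c :: "real \<Rightarrow> real" where
  "rho_c \<beta> = set_lebesgue_integral (interval_measure Fdos) {0<..}
               (\<lambda>x. inverse (exp (\<beta> * x) - 1))"

(* Abel summation of a series sum_m a m (regular: agrees with the ordinary sum when it converges) *)
definition abel_sums :: "(nat \<Rightarrow> real) \<Rightarrow> real \<Rightarrow> bool" where
  "abel_sums a s \<longleftrightarrow> (\<forall>t\<in>{0<..<1}. summable (\<lambda>m. a m * t ^ m)) \<and>
      ((\<lambda>t. \<Sum>m. a m * t ^ m) \<longlongrightarrow> s) (at_left 1)"

end

theory Submission
  imports Defs "HOL-Probability.Distributions" "HOL-Real_Asymp.Real_Asymp"
begin

text \<open>
  Write \<open>\<kappa> = \<beta> \<pi>\<^sup>2 / 2\<close>. After subtracting the transverse ground state energy, which does not change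
  canonical expectations, the canonical weights are those of independent geometric occupation
  numbers conditioned on their sum; the soft mode \<open>(m,1,1)\<close> has parameter \<open>exp (- \<kappa> m\<^sup>2 / V)\<close>. Summing out
  the observed mode \<open>(n,1,1)\<close> turns the conditioning on \<open>N\<close> into the integral of
  \<open>y \<mapsto> exp (- \<mu> (\<rho> - y))\<close>, cut off at \<open>y = \<rho>\<close>, against the law of \<open>Y\<^sub>V\<close>, the density of all other particles, with
  \<open>\<mu> = \<lambda> + \<kappa> n\<^sup>2\<close> in the numerator and \<open>\<mu> = \<kappa> n\<^sup>2\<close> in the denominator. The geometric variable of the
  observed mode thus does the smoothing that a local limit theorem would need, and only the weak
  limit of \<open>Y\<^sub>V\<close> is required.

  Its Laplace transform is an explicit product. The modes with excited transverse part contribute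
  the constant \<open>\<rho>\<^sub>c\<close>, because their mean density converges to \<open>\<rho>\<^sub>c\<close> and none of them is macroscopically
  occupied (here the larger transverse exponent is below 1/2). The soft modes contribute a sum of
  independent exponential variables with rates \<open>\<kappa> m\<^sup>2\<close>, \<open>m \<noteq> n\<close>. One-sided polynomial approximation in
  \<open>exp (- y)\<close>, as in Karamata's Tauberian theorem, transfers the convergence to the cut off exponential.

  The density of the exponential sum is a limit of finite partial fraction expansions whose
  coefficients carry factors \<open>cutoff M m\<close> that tend to 1. Integrating these expansions gives
  the series of the theorem summed by the \<open>cutoff\<close> method, which assigns the values 0 and 1/2 to the
  divergent series of \<open>(-1)\<^sup>m m\<^sup>2\<close> and \<open>(-1)\<^sup>m\<close>, exactly as Abel summation does.
\<close>

subsection \<open>Partial fractions and hypoexponential densities\<close>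

text \<open>The obstacle is that the series of the theorem cannot be reached by integrating the
  density series term by term: \<open>bcoef \<beta> m n * eta \<beta> m n\<close> is
  \<open>m^2 / n^2\<close> up to sign, so the integrated terms do not tend to 0. The way around it
  is a bound on the finite densities that does not depend on \<open>M\<close>: convolution with a
  further exponential law never raises the supremum of a density, so all of them stay below
  \<open>4 * \<kappa>\<close>. Dominated convergence then applies to the integrals although the
  integrated series diverges. What it yields is a limit of finite sums weighted by
  \<open>cutoff M m\<close>. This agrees with Abel summation because each term is
  \<open>(-1)^m\<close> times a quadratic polynomial in \<open>m\<close> plus an absolutely summable
  remainder; for the polynomial, the finite identities behind the values 1/2 and 0 are the partial
  fraction expansion at \<open>s = 0\<close> and the vanishing of a hypoexponential density at
  0.\<close>

definition pf_coeff :: "('i \<Rightarrow> real) \<Rightarrow> 'i set \<Rightarrow> 'i \<Rightarrow> real" where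
  "pf_coeff a I i = (\<Prod>j\<in>I - {i}. a j / (a j - a i))"

text \<open>The density on \<open>y \<ge> 0\<close> of a sum of independent exponential variables
  with distinct rates \<open>a i\<close>. The signed weights \<open>pf_coeff a I i\<close> are the
  values at 0 of the Lagrange basis polynomials with nodes \<open>a i\<close>.\<close>

definition hypoexp_density :: "('i \<Rightarrow> real) \<Rightarrow> 'i set \<Rightarrow> real \<Rightarrow> real" where
  "hypoexp_density a I y = (\<Sum>i\<in>I. pf_coeff a I i * a i * exp (- a i * y))"

lemma pf_coeff_insert_old:
  assumes "finite F" "x \<notin> F" "i \<in> F"
  shows "pf_coeff a (insert x F) i = pf_coeff a F i * (a x / (a x - a i))"
proof -
  have "insert x F - {i} = insert x (F - {i})" using assms by auto
  then show ?thesis using assms by (simp add: pf_coeff_def mult.commute)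
qed

text \<open>By induction: the identity for \<open>F\<close> at the point \<open>s = - a x\<close>
  evaluates the coefficient that a new index \<open>x\<close> receives; then only a product of two
  fractions has to be split. This second point is why \<open>s\<close> is generalized.\<close>

lemma partial_fractions:
  assumes "finite I" "I \<noteq> {}" "inj_on a I" "\<And>i. i \<in> I \<Longrightarrow> a i \<noteq> 0"
    and "\<And>i. i \<in> I \<Longrightarrow> a i + s \<noteq> 0"
  shows "(\<Sum>i\<in>I. pf_coeff a I i * (a i / (a i + s))) = (\<Prod>i\<in>I. a i / (a i + s))"
  using assms
proof (induction I arbitrary: s rule: finite_ne_induct)
  case (singleton x)
  then show ?case by (simp add: pf_coeff_def)
next
  case (insert x F)
  have ne: "a i \<noteq> a x" if "i \<in> F" for i
    using insert.prems(1) insert.hyps that by (auto simp: inj_on_def)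
  have new: "pf_coeff a (insert x F) x = (\<Sum>i\<in>F. pf_coeff a F i * (a i / (a i - a x)))"
  proof -
    have "(\<Sum>i\<in>F. pf_coeff a F i * (a i / (a i + (- a x)))) = (\<Prod>i\<in>F. a i / (a i + (- a x)))"
      using insert.prems ne by (intro insert.IH) (auto simp: inj_on_def)
    then show ?thesis using insert.hyps by (simp add: pf_coeff_def)
  qed
  have split: "a x / (a x - a i) * (a i / (a i + s)) + a i / (a i - a x) * (a x / (a x + s))
      = a i / (a i + s) * (a x / (a x + s))" if "i \<in> F" for i
  proof -
    have "a i + s \<noteq> 0" "a x + s \<noteq> 0" "a x - a i \<noteq> 0" "a i - a x \<noteq> 0"
      using insert.prems(3) ne[OF that] that by auto
    then show ?thesis by (simp add: divide_simps) (simp add: algebra_simps)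
  qed
  have "(\<Sum>i\<in>insert x F. pf_coeff a (insert x F) i * (a i / (a i + s)))
      = (\<Sum>i\<in>F. pf_coeff a F i * (a i / (a i - a x))) * (a x / (a x + s))
        + (\<Sum>i\<in>F. pf_coeff a F i * (a x / (a x - a i)) * (a i / (a i + s)))"
    using insert.hyps by (simp add: new pf_coeff_insert_old)
  also have "\<dots> = (\<Sum>i\<in>F. pf_coeff a F i * (a x / (a x - a i) * (a i / (a i + s))
        + a i / (a i - a x) * (a x / (a x + s))))"
    by (simp add: sum_distrib_right sum_distrib_left sum.distrib[symmetric] algebra_simps)
  also have "\<dots> = (\<Sum>i\<in>F. pf_coeff a F i * (a i / (a i + s))) * (a x / (a x + s))"
    unfolding sum_distrib_right by (intro sum.cong refl) (simp only: split mult.assoc)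
  also have "\<dots> = (\<Prod>i\<in>F. a i / (a i + s)) * (a x / (a x + s))"
    using insert.prems by (subst insert.IH) (auto simp: inj_on_def)
  finally show ?case using insert.hyps by (simp add: mult.commute)
qed

text \<open>Pairing every old exponential with the new one exhibits a convolution: up to the factor
  \<open>a x - a i\<close>, each bracket is the integral of
  \<open>exp (- a i * z) * exp (- a x * (y - z))\<close> over \<open>[0, y]\<close>. In particular
  it vanishes at \<open>y = 0\<close>.\<close>

lemma hypoexp_density_insert:
  assumes "finite F" "F \<noteq> {}" "x \<notin> F" "inj_on a (insert x F)" "\<And>i. i \<in> F \<Longrightarrow> a i \<noteq> 0"
  shows "hypoexp_density a (insert x F) y =
    (\<Sum>i\<in>F. pf_coeff a F i * a i * (a x / (a x - a i)) * (exp (- a i * y) - exp (- a x * y)))"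
proof -
  have ne: "a i \<noteq> a x" if "i \<in> F" for i
    using assms that by (auto simp: inj_on_def)
  have new: "pf_coeff a (insert x F) x = (\<Sum>i\<in>F. pf_coeff a F i * (a i / (a i - a x)))"
  proof -
    have "(\<Sum>i\<in>F. pf_coeff a F i * (a i / (a i + (- a x)))) = (\<Prod>i\<in>F. a i / (a i + (- a x)))"
      using assms ne by (intro partial_fractions) (auto simp: inj_on_def)
    then show ?thesis using assms by (simp add: pf_coeff_def)
  qed
  have "pf_coeff a F i * (a i / (a i - a x)) * a x * exp (- a x * y)
        + pf_coeff a F i * (a x / (a x - a i)) * a i * exp (- a i * y)
      = pf_coeff a F i * a i * (a x / (a x - a i)) * (exp (- a i * y) - exp (- a x * y))"
    if "i \<in> F" for i
    using ne[OF that] by (simp add: divide_simps) (simp add: algebra_simps)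
  then show ?thesis
    using assms by (simp add: hypoexp_density_def new pf_coeff_insert_old sum_distrib_right
        sum.distrib[symmetric])
qed

text \<open>Adding an exponential variable of rate \<open>a x\<close> turns a density \<open>F\<close> into the solution of
  \<open>D' = a x * (F - D)\<close> with \<open>D 0 = 0\<close>, so bounds between 0 and a constant are preserved.\<close>

lemma hypoexp_density_bounds:
  assumes "finite J" "l \<notin> J" "inj_on a (insert l J)" "\<And>i. i \<in> insert l J \<Longrightarrow> a i > 0" "y \<ge> 0"
  shows "0 \<le> hypoexp_density a (insert l J) y \<and> hypoexp_density a (insert l J) y \<le> a l"
  using assms
proof (induction J arbitrary: y rule: finite_induct)
  case empty
  then show ?case by (simp add: hypoexp_density_def pf_coeff_def mult_le_cancel_left1)
next
  case (insert x J)
  define F where "F = insert l J"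
  have F: "finite F" "F \<noteq> {}" "x \<notin> F" "inj_on a (insert x F)"
    and eq: "insert l (insert x J) = insert x F"
    using insert.hyps insert.prems by (auto simp: F_def insert_commute)
  have "a i > 0" if "i \<in> F" for i using insert.prems that by (auto simp: F_def)
  then have F5: "\<And>i. i \<in> F \<Longrightarrow> a i \<noteq> 0" by force
  have IH: "0 \<le> hypoexp_density a F z \<and> hypoexp_density a F z \<le> a l" if "z \<ge> 0" for z
    unfolding F_def using insert.prems that
    by (intro insert.IH) (auto simp: inj_on_def)
  have ne: "a x - a i \<noteq> 0" if "i \<in> F" for i
    using F that by (auto simp: inj_on_def)
  have ax: "a x > 0" using insert.prems by auto
  \<comment> \<open>The new density times the integrating factor \<open>exp (a x * z)\<close>; its
    derivative involves only the density for \<open>F\<close>, to which the induction hypothesis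
    applies.\<close>
  define g where "g z = (\<Sum>i\<in>F. pf_coeff a F i * a i * (a x / (a x - a i)) * (exp ((a x - a i) * z) - 1))" for z
  have D_eq: "hypoexp_density a (insert x F) z =
      (\<Sum>i\<in>F. pf_coeff a F i * a i * (a x / (a x - a i)) * (exp (- a i * z) - exp (- a x * z)))" for z
    by (rule hypoexp_density_insert) (fact | use F5 in blast)+
  have g_eq: "g z = exp (a x * z) * hypoexp_density a (insert x F) z" for z
    unfolding g_def D_eq sum_distrib_left
  proof (intro sum.cong refl)
    fix i
    have "exp ((a x - a i) * z) - 1 = exp (a x * z) * (exp (- a i * z) - exp (- a x * z))"
      by (simp add: algebra_simps flip: exp_add)
    then show "pf_coeff a F i * a i * (a x / (a x - a i)) * (exp ((a x - a i) * z) - 1) =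
        exp (a x * z) * (pf_coeff a F i * a i * (a x / (a x - a i)) * (exp (- a i * z) - exp (- a x * z)))"
      by (simp only: mult_ac)
  qed
  have g_deriv: "(g has_real_derivative a x * exp (a x * z) * hypoexp_density a F z) (at z)" for z
    unfolding g_def[abs_def] hypoexp_density_def sum_distrib_left
  proof (rule DERIV_sum)
    fix i assume i: "i \<in> F"
    have "((\<lambda>z. pf_coeff a F i * a i * (a x / (a x - a i)) * (exp ((a x - a i) * z) - 1)) has_real_derivative
       pf_coeff a F i * a i * (a x / (a x - a i)) * (exp ((a x - a i) * z) * (a x - a i))) (at z)"
      by (auto intro!: derivative_eq_intros)
    also have "pf_coeff a F i * a i * (a x / (a x - a i)) * (exp ((a x - a i) * z) * (a x - a i))
      = pf_coeff a F i * a i * a x * exp ((a x - a i) * z)"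
      using ne[OF i] by simp
    also have "\<dots> = a x * exp (a x * z) * (pf_coeff a F i * a i * exp (- a i * z))"
      by (simp add: algebra_simps flip: exp_add)
    finally show "((\<lambda>z. pf_coeff a F i * a i * (a x / (a x - a i)) * (exp ((a x - a i) * z) - 1)) has_real_derivative
       a x * exp (a x * z) * (pf_coeff a F i * a i * exp (- a i * z))) (at z)" .
  qed
  have g0: "g 0 = 0" by (simp add: g_def)
  have "g 0 \<le> g y"
  proof (rule DERIV_nonneg_imp_nondecreasing[where f = g and a = 0 and b = y])
    fix z assume "0 \<le> z" "z \<le> y"
    then have "a x * exp (a x * z) * hypoexp_density a F z \<ge> 0"
      using IH[of z] ax by simp
    then show "\<exists>D. (g has_real_derivative D) (at z) \<and> 0 \<le> D"
      using g_deriv by blast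
  qed (use insert.prems in auto)
  then have "0 \<le> hypoexp_density a (insert x F) y"
    using g0 by (simp add: g_eq zero_le_mult_iff)
  moreover have "a l * exp (a x * 0) - g 0 \<le> a l * exp (a x * y) - g y"
  proof (rule DERIV_nonneg_imp_nondecreasing[where f = "\<lambda>z. a l * exp (a x * z) - g z" and a = 0 and b = y])
    fix z assume z: "0 \<le> z" "z \<le> y"
    have "((\<lambda>z. a l * exp (a x * z) - g z) has_real_derivative
        (a x * exp (a x * z) * (a l - hypoexp_density a F z))) (at z)"
      by (rule derivative_eq_intros g_deriv refl)+ (simp add: algebra_simps)
    moreover have "a x * exp (a x * z) * (a l - hypoexp_density a F z) \<ge> 0"
      using IH[of z] z ax by simp
    ultimately show "\<exists>D. ((\<lambda>z. a l * exp (a x * z) - g z) has_real_derivative D) (at z) \<and> 0 \<le> D"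
      by blast
  qed (use insert.prems in auto)
  then have "0 \<le> a l * exp (a x * y) - g y"
    using g0 insert.prems(3)[of l] by simp
  then have "0 \<le> exp (a x * y) * (a l - hypoexp_density a (insert x F) y)"
    by (simp add: g_eq algebra_simps)
  then have "hypoexp_density a (insert x F) y \<le> a l"
    by (simp add: zero_le_mult_iff)
  ultimately show ?case by (simp add: eq)
qed

text \<open>Every bracket of \<open>hypoexp_density_insert\<close> vanishes at 0. For the rates
  \<open>m^2\<close> this becomes the value 0 of the alternating series of squares.\<close>

lemma hypoexp_density_0:
  assumes "finite I" "card I \<ge> 2" "inj_on a I" "\<And>i. i \<in> I \<Longrightarrow> a i \<noteq> 0"
  shows "hypoexp_density a I 0 = 0"
proof -
  obtain x where x: "x \<in> I" using assms(2) by fastforce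
  define F where "F = I - {x}"
  have "card F \<ge> 1" using assms x by (simp add: F_def)
  then have "F \<noteq> {}" by auto
  then have F: "F \<noteq> {}" "finite F" "x \<notin> F" "I = insert x F"
    using x assms(1) by (auto simp: F_def)
  then show ?thesis
    using assms by (simp add: hypoexp_density_insert)
qed

text \<open>For \<open>m \<le> M\<close> this is \<open>M!\<^sup>2 / ((M - m)! (M + m)!)\<close>; the factor with \<open>m = M\<close> makes it vanish beyond \<open>M\<close>.\<close>

primrec cutoff :: "nat \<Rightarrow> nat \<Rightarrow> real" where
  "cutoff M 0 = 1"
| "cutoff M (Suc m) = cutoff M m * ((real M - real m) / (real M + real m + 1))"

lemma cutoff_fact: "m \<le> M \<Longrightarrow> cutoff M m * (fact (M - m) * fact (M + m)) = (fact M)\<^sup>2"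
proof (induction m)
  case 0
  then show ?case by (simp add: power2_eq_square)
next
  case (Suc m)
  have 1: "(fact (M - m) :: real) = (real M - real m) * fact (M - Suc m)"
    using Suc.prems by (subst fact_reduce) (auto simp: of_nat_diff)
  have 2: "(fact (M + Suc m) :: real) = (real M + real m + 1) * fact (M + m)"
    by (simp add: algebra_simps)
  have "cutoff M (Suc m) * (fact (M - Suc m) * fact (M + Suc m))
      = cutoff M m * (fact (M - m) * fact (M + m))"
    unfolding 1 2 by (simp add: field_simps)
  then show ?case using Suc by simp
qed

lemma cutoff_eq_0: "M < m \<Longrightarrow> cutoff M m = 0"
proof (induction m)
  case (Suc m)
  then show ?case by (cases "M = m") auto
qed auto

lemma cutoff_bounds: "0 \<le> cutoff M m \<and> cutoff M m \<le> 1"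
proof (induction m)
  case (Suc m)
  show ?case
  proof (cases "m \<le> M")
    case True
    then have "0 \<le> (real M - real m) / (real M + real m + 1)" "(real M - real m) / (real M + real m + 1) \<le> 1"
      by auto
    then show ?thesis using Suc unfolding cutoff.simps
      by (intro conjI mult_nonneg_nonneg mult_le_one) auto
  next
    case False
    then show ?thesis by (simp add: cutoff_eq_0)
  qed
qed auto

lemma cutoff_tendsto: "(\<lambda>M. cutoff M m) \<longlonglongrightarrow> 1"
proof (induction m)
  case (Suc m)
  have "(\<lambda>M. (real M - real m) / (real M + real m + 1)) \<longlonglongrightarrow> 1" by real_asymp
  from tendsto_mult[OF Suc this] show ?case by simp
qed auto

text \<open>The factor is what inserting the rate \<open>(M + 1)^2\<close> contributes to a partial
  fraction coefficient, so \<open>cutoff\<close> and \<open>pf_coeff\<close> obey the same recursion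
  in \<open>M\<close>.\<close>

lemma cutoff_Suc_left:
  "m \<le> M \<Longrightarrow> cutoff (Suc M) m = cutoff M m * (real (Suc M) ^ 2 / (real (Suc M) ^ 2 - real m ^ 2))"
proof (induction m)
  case (Suc m)
  have ne: "real M - real m \<noteq> 0" "real M + 1 - real m \<noteq> 0" "real M + 1 + real m \<noteq> 0" "real M + real m + 2 \<noteq> 0"
    using Suc.prems by auto
  have "real (Suc M) ^ 2 - real m ^ 2 = (real M + 1 - real m) * (real M + 1 + real m)"
    "real (Suc M) ^ 2 - real (Suc m) ^ 2 = (real M - real m) * (real M + real m + 2)"
    by (simp_all add: algebra_simps power2_eq_square)
  note eqs = this
  have alg: "d * (c\<^sup>2 / (u * v)) * (u / w) = d * (x / v) * (c\<^sup>2 / (x * w))" if "u \<noteq> 0" "x \<noteq> 0" for d c u v w x :: real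
    using that by simp
  have "cutoff (Suc M) (Suc m) = cutoff M m * (real (Suc M) ^ 2 / ((real M + 1 - real m) * (real M + 1 + real m)))
      * ((real M + 1 - real m) / (real M + real m + 2))"
    using Suc eqs(1) by (simp add: add.commute add.left_commute)
  also have "\<dots> = cutoff M m * ((real M - real m) / (real M + 1 + real m)) *
      (real (Suc M) ^ 2 / ((real M - real m) * (real M + real m + 2)))"
    using ne by (intro alg)
  also have "\<dots> = cutoff M (Suc m) * (real (Suc M) ^ 2 / (real (Suc M) ^ 2 - real (Suc m) ^ 2))"
    unfolding eqs(2) by (simp add: add.commute add.left_commute)
  finally show ?case .
qed auto

text \<open>Factoring \<open>j^2 - m^2\<close> as \<open>(j - m) * (j + m)\<close> produces
  factorials. The upper end \<open>k\<close> varies for the induction; \<open>k = m - 1\<close> is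
  the start of the induction in \<open>pf_coeff_quadratic\<close>.\<close>

lemma prod_quadratic_below:
  assumes "k < m"
  shows "(\<Prod>j=1..k. real j ^ 2 / (real j ^ 2 - real m ^ 2)) =
    (-1) ^ k * (fact k)\<^sup>2 * fact (m - 1 - k) * fact m / (fact (m - 1) * fact (m + k))"
  using assms
proof (induction k)
  case (Suc k)
  have 1: "(fact (m - 1 - k) :: real) = (real m - 1 - real k) * fact (m - 1 - Suc k)"
    using Suc.prems by (subst fact_reduce) (auto simp: of_nat_diff)
  have 2: "(fact (m + Suc k) :: real) = (real m + real k + 1) * fact (m + k)"
    by (simp add: algebra_simps)
  have 3: "real (Suc k) ^ 2 - real m ^ 2 = - ((real m - 1 - real k) * (real m + real k + 1))"
    by (simp add: algebra_simps power2_eq_square)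
  have ne: "real m - 1 - real k \<noteq> 0" "real m + real k + 1 \<noteq> 0" using Suc.prems by auto
  have "(\<Prod>j=1..Suc k. real j ^ 2 / (real j ^ 2 - real m ^ 2)) =
    ((-1) ^ k * (fact k)\<^sup>2 * fact (m - 1 - k) * fact m / (fact (m - 1) * fact (m + k)))
      * (real (Suc k) ^ 2 / (real (Suc k) ^ 2 - real m ^ 2))"
    using Suc by simp
  also have "\<dots> = (-1) ^ Suc k * (fact (Suc k))\<^sup>2 * fact (m - 1 - Suc k) * fact m / (fact (m - 1) * fact (m + Suc k))"
    unfolding 1 2 3 fact_Suc using ne by (simp add: divide_simps power2_eq_square)
  finally show ?case .
qed auto

text \<open>Both sides obey the same recursion in \<open>M\<close>, and at \<open>M = m\<close> the
  product over \<open>j < m\<close> is a quotient of factorials. As \<open>M\<close> tends to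
  infinity, the classical value \<open>2 * (-1)^(m + 1)\<close> of the product of
  \<open>j^2 / (j^2 - m^2)\<close> over \<open>j \<noteq> m\<close> appears.\<close>

lemma pf_coeff_quadratic:
  assumes "\<kappa> \<noteq> 0" "m \<ge> 1" "m \<le> M"
  shows "pf_coeff (\<lambda>j. \<kappa> * real j ^ 2) {1..M} m = 2 * (-1) ^ Suc m * cutoff M m"
  using assms(3)
proof (induction M rule: dec_induct)
  case base
  obtain k where k: "m = Suc k" using assms(2) by (cases m) auto
  have "pf_coeff (\<lambda>j. \<kappa> * real j ^ 2) {1..m} m = (\<Prod>j=1..k. real j ^ 2 / (real j ^ 2 - real m ^ 2))"
    unfolding pf_coeff_def using assms(1) k
    by (intro prod.cong) (auto simp flip: right_diff_distrib)
  also have "\<dots> = (-1) ^ k * (fact k)\<^sup>2 * fact m / (fact k * fact (m + k))"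
    using k by (subst prod_quadratic_below) auto
  also have "\<dots> = 2 * (-1) ^ k * ((fact m)\<^sup>2 / fact (m + m))"
  proof -
    have "(fact (m + m) :: real) = (2 * real m) * fact (m + k)" "(fact m :: real) = real m * fact k"
      using k by (auto simp: algebra_simps)
    moreover have "real m > 0" using k by simp
    ultimately show ?thesis
      by (simp add: divide_simps power2_eq_square)
  qed
  also have "(fact m)\<^sup>2 / fact (m + m) = cutoff m m"
    using cutoff_fact[of m m] by (simp add: field_simps)
  finally show ?case using k by simp
next
  case (step M)
  have "{1..Suc M} = insert (Suc M) {1..M}" by auto
  then have "pf_coeff (\<lambda>j. \<kappa> * real j ^ 2) {1..Suc M} m =
      pf_coeff (\<lambda>j. \<kappa> * real j ^ 2) {1..M} m * (\<kappa> * real (Suc M) ^ 2 / (\<kappa> * real (Suc M) ^ 2 - \<kappa> * real m ^ 2))"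
    using step assms by (simp add: pf_coeff_insert_old)
  also have "\<kappa> * real (Suc M) ^ 2 / (\<kappa> * real (Suc M) ^ 2 - \<kappa> * real m ^ 2) = real (Suc M) ^ 2 / (real (Suc M) ^ 2 - real m ^ 2)"
    using assms(1) by (simp flip: right_diff_distrib)
  finally show ?case using step by (simp add: cutoff_Suc_left)
qed

text \<open>Dropping the rate of \<open>n\<close> divides by \<open>n^2 / (n^2 - m^2)\<close>. The
  resulting factor, quadratic in \<open>m\<close>, is the origin of the divergence of the integrated
  series.\<close>

lemma pf_coeff_quadratic_remove:
  assumes "\<kappa> \<noteq> 0" "m \<in> {1..M} - {n}" "n \<in> {1..M}"
  shows "pf_coeff (\<lambda>j. \<kappa> * real j ^ 2) ({1..M} - {n}) m =
    2 * (-1) ^ Suc m * cutoff M m * (1 - real m ^ 2 / real n ^ 2)"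
proof -
  have "{1..M} = insert n ({1..M} - {n})" using assms by auto
  then have "pf_coeff (\<lambda>j. \<kappa> * real j ^ 2) {1..M} m =
      pf_coeff (\<lambda>j. \<kappa> * real j ^ 2) ({1..M} - {n}) m * (\<kappa> * real n ^ 2 / (\<kappa> * real n ^ 2 - \<kappa> * real m ^ 2))"
    by (metis (no_types, lifting) Diff_iff assms(2) finite_Diff finite_atLeastAtMost insertCI pf_coeff_insert_old)
  also have "\<kappa> * real n ^ 2 / (\<kappa> * real n ^ 2 - \<kappa> * real m ^ 2) = real n ^ 2 / (real n ^ 2 - real m ^ 2)"
    using assms(1) by (simp flip: right_diff_distrib)
  finally have eq: "2 * (-1) ^ Suc m * cutoff M m =
      pf_coeff (\<lambda>j. \<kappa> * real j ^ 2) ({1..M} - {n}) m * (real n ^ 2 / (real n ^ 2 - real m ^ 2))"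
    using assms pf_coeff_quadratic[OF assms(1), of m M] by simp
  have "m \<noteq> n" "n \<noteq> 0" using assms by auto
  then have ne: "real n ^ 2 \<noteq> 0" "real n ^ 2 - real m ^ 2 \<noteq> 0" by (auto simp: power2_eq_iff)
  then have "1 - real m ^ 2 / real n ^ 2 = (real n ^ 2 - real m ^ 2) / real n ^ 2"
    by (simp add: diff_divide_distrib)
  then show ?thesis
    using ne unfolding eq by simp
qed

lemma inj_on_quadratic: "\<kappa> \<noteq> 0 \<Longrightarrow> inj_on (\<lambda>j::nat. \<kappa> * real j ^ 2) A"
  by (rule inj_onI) (auto simp: power2_eq_iff_nonneg)

text \<open>At \<open>s = 0\<close> the partial fraction expansion says that the coefficients
  \<open>2 * (-1)^(m + 1) * cutoff M m\<close> with \<open>1 \<le> m \<le> M\<close> add up to 1. So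
  the alternating sum from \<open>m = 1\<close> is -1/2, and the term \<open>m = 0\<close> adds
  1.\<close>

lemma cutoff_alternating_sum:
  assumes "M \<ge> 1"
  shows "(\<Sum>m\<le>M. (-1) ^ m * cutoff M m) = 1 / 2"
proof -
  have "(\<Sum>i\<in>{1..M}. pf_coeff (\<lambda>j. 1 * real j ^ 2) {1..M} i * (1 * real i ^ 2 / (1 * real i ^ 2 + 0))) =
     (\<Prod>i\<in>{1..M}. 1 * real i ^ 2 / (1 * real i ^ 2 + 0))"
    using assms by (intro partial_fractions inj_on_quadratic) auto
  also have "\<dots> = 1" by (intro prod.neutral) auto
  also have "(\<Sum>i\<in>{1..M}. pf_coeff (\<lambda>j. 1 * real j ^ 2) {1..M} i * (1 * real i ^ 2 / (1 * real i ^ 2 + 0)))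
      = (\<Sum>i\<in>{1..M}. - 2 * ((-1) ^ i * cutoff M i))"
    by (intro sum.cong) (auto simp: pf_coeff_quadratic[where \<kappa> = 1, simplified])
  also have "\<dots> = - 2 * (\<Sum>i\<in>{1..M}. (-1) ^ i * cutoff M i)"
    by (simp add: sum_distrib_left)
  finally have "(\<Sum>i\<in>{1..M}. (-1) ^ i * cutoff M i) = - 1 / 2" by simp
  moreover have "{..M} = insert 0 {1..M}" by auto
  ultimately show ?thesis by simp
qed

text \<open>Up to the factor -2 the sum is the value at 0 of the density with rates
  \<open>m^2\<close>, which vanishes as soon as there are two rates.\<close>

lemma cutoff_alternating_sum_squares:
  assumes "M \<ge> 2"
  shows "(\<Sum>m\<le>M. (-1) ^ m * cutoff M m * real m ^ 2) = 0"
proof -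
  have "hypoexp_density (\<lambda>j. 1 * real j ^ 2) {1..M} 0 = 0"
    using assms by (intro hypoexp_density_0 inj_on_quadratic) auto
  then have "(\<Sum>i\<in>{1..M}. pf_coeff (\<lambda>j. 1 * real j ^ 2) {1..M} i * real i ^ 2) = 0"
    by (simp add: hypoexp_density_def)
  also have "(\<Sum>i\<in>{1..M}. pf_coeff (\<lambda>j. 1 * real j ^ 2) {1..M} i * real i ^ 2)
      = (\<Sum>i\<in>{1..M}. - 2 * ((-1) ^ i * cutoff M i * real i ^ 2))"
    by (intro sum.cong) (auto simp: pf_coeff_quadratic[where \<kappa> = 1, simplified])
  also have "\<dots> = - 2 * (\<Sum>i\<in>{1..M}. (-1) ^ i * cutoff M i * real i ^ 2)"
    by (simp add: sum_distrib_left)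
  finally have "(\<Sum>i\<in>{1..M}. (-1) ^ i * cutoff M i * real i ^ 2) = 0" by simp
  moreover have "{..M} = insert 0 {1..M}" by auto
  ultimately show ?thesis by simp
qed

subsection \<open>The density of the soft modes other than the observed one\<close>

lemma tendsto_suminf_dominated:
  fixes a :: "nat \<Rightarrow> 'b \<Rightarrow> real"
  assumes "\<And>k. ((\<lambda>x. a k x) \<longlongrightarrow> b k) F" "eventually (\<lambda>x. \<forall>k. \<bar>a k x\<bar> \<le> B k) F" "summable B" "F \<noteq> bot"
  shows "((\<lambda>x. \<Sum>k. a k x) \<longlongrightarrow> (\<Sum>k. b k)) F"
proof -
  have "eventually (\<lambda>(k,x). norm (a k x) \<le> B k) (at_top \<times>\<^sub>F F)"
    unfolding eventually_prod_filter
    by (rule exI[of _ "\<lambda>_. True"], rule exI[of _ "\<lambda>x. \<forall>k. \<bar>a k x\<bar> \<le> B k"]) (use assms(2) in auto)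
  from tannerys_theorem[OF assms(1) this assms(3,4)] show ?thesis by blast
qed

lemma summable_inverse_squares_real: "summable (\<lambda>m. 1 / real m ^ 2)"
  using inverse_power_summable[of 2, where ?'a = real] by (simp add: inverse_eq_divide)

text \<open>The limit, as \<open>M\<close> grows, of weight times rate in the density with rates
  \<open>\<kappa> * m^2\<close> and index set \<open>{1..M} - {n}\<close>. The formula gives 0 at
  \<open>m = 0\<close> and \<open>m = n\<close>, so sums may run over all \<open>m\<close>.\<close>

definition gap_weight :: "real \<Rightarrow> nat \<Rightarrow> nat \<Rightarrow> real" where
  "gap_weight \<kappa> n m = 2 * (-1) ^ Suc m * (1 - real m ^ 2 / real n ^ 2) * (\<kappa> * real m ^ 2)"

text \<open>The series diverges at \<open>y = 0\<close>, where the limit of the finite densities is 0.\<close>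

definition gap_density :: "real \<Rightarrow> nat \<Rightarrow> real \<Rightarrow> real" where
  "gap_density \<kappa> n y = (if y \<le> 0 then 0 else \<Sum>m. gap_weight \<kappa> n m * exp (- (\<kappa> * real m ^ 2) * y))"

definition gap_density_M :: "real \<Rightarrow> nat \<Rightarrow> nat \<Rightarrow> real \<Rightarrow> real" where
  "gap_density_M \<kappa> n M = hypoexp_density (\<lambda>j. \<kappa> * real j ^ 2) ({1..M} - {n})"

lemma gap_density_M_eq:
  assumes "\<kappa> > 0" "n \<ge> 1" "n \<le> M"
  shows "gap_density_M \<kappa> n M y = (\<Sum>m\<le>M. cutoff M m * (gap_weight \<kappa> n m * exp (- (\<kappa> * real m ^ 2) * y)))"
proof -
  have "(\<Sum>m\<le>M. cutoff M m * (gap_weight \<kappa> n m * exp (- (\<kappa> * real m ^ 2) * y)))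
      = (\<Sum>m\<in>{1..M} - {n}. cutoff M m * (gap_weight \<kappa> n m * exp (- (\<kappa> * real m ^ 2) * y)))"
    using assms by (intro sum.mono_neutral_right) (auto simp: gap_weight_def)
  also have "\<dots> = gap_density_M \<kappa> n M y"
    unfolding gap_density_M_def hypoexp_density_def
    by (intro sum.cong refl, subst pf_coeff_quadratic_remove) (use assms in \<open>auto simp: gap_weight_def\<close>)
  finally show ?thesis ..
qed

lemma gap_weight_summable:
  assumes "\<kappa> > 0" "y > 0"
  shows "summable (\<lambda>m. \<bar>gap_weight \<kappa> n m * exp (- (\<kappa> * real m ^ 2) * y)\<bar>)"
proof -
  define c where "c = \<kappa> * y"
  have c: "c > 0" using assms by (simp add: c_def)
  have "(\<lambda>m. 2 * (1 + real m ^ 2) * (\<kappa> * real m ^ 2) * exp (- (c * real m ^ 2))) \<in> O(\<lambda>m. 1 / real m ^ 2)"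
    using assms c by real_asymp
  then have s: "summable (\<lambda>m. 2 * (1 + real m ^ 2) * (\<kappa> * real m ^ 2) * exp (- (c * real m ^ 2)))"
    by (rule summable_comparison_test_bigo[rotated]) (use summable_inverse_squares_real in simp)
  show ?thesis
  proof (rule summable_comparison_test[OF _ s], intro exI[of _ 0] allI impI)
    fix m :: nat
    have "real m ^ 2 / real n ^ 2 \<le> real m ^ 2"
    proof (cases "n = 0")
      case False
      then have "1 \<le> real n ^ 2" by simp
      then show ?thesis by (simp add: divide_le_eq mult_le_cancel_left1)
    qed auto
    then have "\<bar>1 - real m ^ 2 / real n ^ 2\<bar> \<le> 1 + real m ^ 2"
      by (smt (verit) divide_nonneg_nonneg zero_le_power2)
    then have "\<bar>gap_weight \<kappa> n m\<bar> \<le> 2 * (1 + real m ^ 2) * (\<kappa> * real m ^ 2)"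
      using assms by (simp add: gap_weight_def abs_mult power_abs mult_right_mono)
    then show "norm \<bar>gap_weight \<kappa> n m * exp (- (\<kappa> * real m ^ 2) * y)\<bar>
        \<le> 2 * (1 + real m ^ 2) * (\<kappa> * real m ^ 2) * exp (- (c * real m ^ 2))"
      by (simp add: abs_mult c_def mult_ac)
  qed
qed

lemma gap_density_tendsto:
  assumes "\<kappa> > 0" "n \<ge> 1" "y \<ge> 0"
  shows "(\<lambda>M. gap_density_M \<kappa> n M y) \<longlonglongrightarrow> gap_density \<kappa> n y"
proof (cases "y = 0")
  case True
  \<comment> \<open>From \<open>M = 3\<close> on, at least two rates survive the removal of
    \<open>n\<close>.\<close>
  have "gap_density_M \<kappa> n M y = 0" if "M \<ge> 3" for M
    unfolding gap_density_M_def True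
  proof (rule hypoexp_density_0)
    have "card {1..M} - card {n} \<le> card ({1..M} - {n})" by (rule diff_card_le_card_Diff) auto
    then show "2 \<le> card ({1..M} - {n})" using that by simp
  qed (use assms in \<open>auto intro: inj_on_quadratic\<close>)
  then have "eventually (\<lambda>M. gap_density_M \<kappa> n M y = 0) sequentially"
    by (auto simp: eventually_at_top_linorder)
  then show ?thesis using True by (auto simp: gap_density_def intro: tendsto_eventually)
next
  case False
  then have y: "y > 0" using assms by simp
  let ?g = "\<lambda>m. gap_weight \<kappa> n m * exp (- (\<kappa> * real m ^ 2) * y)"
  have lim: "(\<lambda>M. \<Sum>m. cutoff M m * ?g m) \<longlonglongrightarrow> (\<Sum>m. 1 * ?g m)"
  proof (rule tendsto_suminf_dominated)
    show "eventually (\<lambda>M. \<forall>m. \<bar>cutoff M m * ?g m\<bar> \<le> \<bar>?g m\<bar>) sequentially"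
      using cutoff_bounds by (intro always_eventually allI) (auto simp: abs_mult mult_left_le_one_le)
    show "(\<lambda>M. cutoff M m * ?g m) \<longlonglongrightarrow> 1 * ?g m" for m
      by (rule tendsto_mult[OF cutoff_tendsto tendsto_const])
  qed (use gap_weight_summable[OF assms(1) y] in auto)
  have "eventually (\<lambda>M. (\<Sum>m. cutoff M m * ?g m) = gap_density_M \<kappa> n M y) sequentially"
    using eventually_ge_at_top[of n]
  proof eventually_elim
    case (elim M)
    have "(\<Sum>m. cutoff M m * ?g m) = (\<Sum>m\<in>{..M}. cutoff M m * ?g m)"
      by (rule suminf_finite) (auto simp: cutoff_eq_0)
    then show ?case using gap_density_M_eq[OF assms(1,2) elim] by simp
  qed
  then have "(\<lambda>M. gap_density_M \<kappa> n M y) \<longlonglongrightarrow> (\<Sum>m. 1 * ?g m)"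
    using lim by (rule Lim_transform_eventually[rotated])
  then show ?thesis using y by (simp add: gap_density_def)
qed

lemma gap_density_M_bounds:
  assumes "\<kappa> > 0" "M \<ge> 2" "y \<ge> 0"
  shows "0 \<le> gap_density_M \<kappa> n M y \<and> gap_density_M \<kappa> n M y \<le> 4 * \<kappa>"
proof -
  \<comment> \<open>The smallest rate present bounds the density; \<open>l = 2\<close> occurs when
    \<open>n = 1\<close> removes the first one, whence the constant
    \<open>4 * \<kappa>\<close>.\<close>
  define l where "l = (if n = 1 then 2 else 1 :: nat)"
  define J where "J = {1..M} - {n} - {l}"
  have I: "{1..M} - {n} = insert l J" using assms by (auto simp: J_def l_def)
  have "0 \<le> hypoexp_density (\<lambda>j. \<kappa> * real j ^ 2) (insert l J) y \<and>
      hypoexp_density (\<lambda>j. \<kappa> * real j ^ 2) (insert l J) y \<le> \<kappa> * real l ^ 2"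
    using assms by (intro hypoexp_density_bounds inj_on_quadratic) (auto simp: J_def l_def)
  moreover have "\<kappa> * real l ^ 2 \<le> 4 * \<kappa>" using assms by (auto simp: l_def)
  ultimately show ?thesis unfolding gap_density_M_def I by linarith
qed

lemma gap_density_bounds:
  assumes "\<kappa> > 0" "n \<ge> 1" "y \<ge> 0"
  shows "0 \<le> gap_density \<kappa> n y" "gap_density \<kappa> n y \<le> 4 * \<kappa>"
proof -
  have ev: "eventually (\<lambda>M. 0 \<le> gap_density_M \<kappa> n M y \<and> gap_density_M \<kappa> n M y \<le> 4 * \<kappa>) sequentially"
    using eventually_ge_at_top[of 2] by eventually_elim (use gap_density_M_bounds assms in auto)
  show "0 \<le> gap_density \<kappa> n y"
    by (rule tendsto_lowerbound[OF gap_density_tendsto[OF assms]]) (use ev in \<open>auto elim: eventually_mono\<close>)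
  show "gap_density \<kappa> n y \<le> 4 * \<kappa>"
    by (rule tendsto_upperbound[OF gap_density_tendsto[OF assms]]) (use ev in \<open>auto elim: eventually_mono\<close>)
qed

text \<open>The majorant is \<open>4 * \<kappa> * g\<close>. It serves on \<open>{0..}\<close> for
  the Laplace transform and on \<open>{0..r}\<close> for the series. Starting at
  \<open>M = n + 2\<close> ensures \<open>n \<le> M\<close>, a nonempty set of rates and the uniform
  bound.\<close>

lemma gap_density_dominated_convergence:
  assumes \<kappa>: "\<kappa> > 0" "n \<ge> 1" and S: "S \<subseteq> {0..}" and g: "g integrable_on S" "\<And>y. y \<in> S \<Longrightarrow> g y \<ge> 0"
    and I: "\<And>M. M \<ge> n + 2 \<Longrightarrow> ((\<lambda>y. g y * gap_density_M \<kappa> n M y) has_integral I M) S"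
    and L: "I \<longlonglongrightarrow> L"
  shows "((\<lambda>y. g y * gap_density \<kappa> n y) has_integral L) S"
proof -
  define f where "f k y = g y * gap_density_M \<kappa> n (k + (n + 2)) y" for k y
  have fI: "(f k has_integral I (k + (n + 2))) S" for k
    unfolding f_def by (rule I) simp
  have 1: "\<And>k. f k integrable_on S" using fI by blast
  have 2: "(\<lambda>y. g y * (4 * \<kappa>)) integrable_on S"
    using g(1) by (rule integrable_on_mult_left)
  have 3: "norm (f k y) \<le> g y * (4 * \<kappa>)" if "y \<in> S" for k y
    using gap_density_M_bounds[OF \<kappa>(1), of "k + (n+2)" y n] S g(2)[OF that] that
    by (auto simp: f_def abs_mult intro!: mult_left_mono)
  have 4: "(\<lambda>k. f k y) \<longlonglongrightarrow> g y * gap_density \<kappa> n y" if "y \<in> S" for y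
    unfolding f_def using gap_density_tendsto[OF \<kappa>, of y] S that
    by (intro tendsto_mult tendsto_const LIMSEQ_ignore_initial_segment) auto
  have "(\<lambda>k. integral S (f k)) \<longlonglongrightarrow> integral S (\<lambda>y. g y * gap_density \<kappa> n y)"
    and int: "(\<lambda>y. g y * gap_density \<kappa> n y) integrable_on S"
    using dominated_convergence[OF 1 2 3 4] by auto
  moreover have "integral S (f k) = I (k + (n + 2))" for k
    using fI by (rule integral_unique)
  ultimately have "integral S (\<lambda>y. g y * gap_density \<kappa> n y) = L"
    using LIMSEQ_ignore_initial_segment[OF L, of "n + 2"] LIMSEQ_unique by auto
  then show ?thesis using int by (simp add: has_integral_iff)
qed

section \<open>Laplace transform and positivity of the gap density\<close>

text \<open>Minus the logarithm of the Laplace transform at \<open>s\<close> of an exponential law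
  of rate \<open>\<kappa> * m^2\<close>, extended by 0 to the indices that carry no rate.\<close>

definition log_gap :: "real \<Rightarrow> nat \<Rightarrow> real \<Rightarrow> nat \<Rightarrow> real" where
  "log_gap \<kappa> n s m = (if m = 0 \<or> m = n then 0 else ln (1 + s / (\<kappa> * real m ^ 2)))"

lemma log_gap_bounds:
  assumes "\<kappa> > 0" "s \<ge> 0"
  shows "0 \<le> log_gap \<kappa> n s m" "log_gap \<kappa> n s m \<le> s / \<kappa> * (1 / real m ^ 2)"
proof -
  have "0 \<le> s / (\<kappa> * real m ^ 2)" using assms by simp
  then show "0 \<le> log_gap \<kappa> n s m" "log_gap \<kappa> n s m \<le> s / \<kappa> * (1 / real m ^ 2)"
    using assms ln_add_one_self_le_self[of "s / (\<kappa> * real m ^ 2)"] by (auto simp: log_gap_def)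
qed

lemma summable_log_gap:
  assumes "\<kappa> > 0" "s \<ge> 0"
  shows "summable (log_gap \<kappa> n s)"
  by (rule summable_comparison_test[OF _ summable_mult[OF summable_inverse_squares_real, of "s / \<kappa>"]])
     (use log_gap_bounds[OF assms] in auto)

text \<open>For finite \<open>M\<close>, integrating the exponentials gives a partial fraction
  expansion, hence the product of the single transforms; the sum of the logarithms converges as
  \<open>M\<close> grows.\<close>

lemma gap_density_laplace:
  assumes \<kappa>: "\<kappa> > 0" "n \<ge> 1" and s: "s > 0"
  shows "((\<lambda>y. exp (- s * y) * gap_density \<kappa> n y) has_integral exp (- (\<Sum>m. log_gap \<kappa> n s m))) {0..}"
proof (rule gap_density_dominated_convergence[OF \<kappa>])
  let ?a = "\<lambda>j. \<kappa> * real j ^ 2"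
  show "(\<lambda>y. exp (- s * y)) integrable_on {0..}"
    using has_integral_exp_minus_to_infinity[OF s, of 0] by (auto simp: integrable_on_def)
  show "((\<lambda>y. exp (- s * y) * gap_density_M \<kappa> n M y) has_integral exp (- (\<Sum>m\<le>M. log_gap \<kappa> n s m))) {0..}"
    if "M \<ge> n + 2" for M
  proof -
    have "M \<in> {1..M} - {n}" using that by auto
    then have nonempty: "{1..M} - {n} \<noteq> {}" by blast
    have "((\<lambda>y. \<Sum>i\<in>{1..M} - {n}. pf_coeff ?a ({1..M} - {n}) i * ?a i * exp (- (?a i + s) * y))
      has_integral (\<Sum>i\<in>{1..M} - {n}. pf_coeff ?a ({1..M} - {n}) i * ?a i * (exp (- (?a i + s) * 0) / (?a i + s)))) {0..}"
      by (intro has_integral_sum has_integral_mult_right has_integral_exp_minus_to_infinity)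
         (use \<kappa> s in \<open>auto intro!: add_pos_pos\<close>)
    also have "(\<lambda>y. \<Sum>i\<in>{1..M} - {n}. pf_coeff ?a ({1..M} - {n}) i * ?a i * exp (- (?a i + s) * y))
      = (\<lambda>y. exp (- s * y) * gap_density_M \<kappa> n M y)"
      unfolding gap_density_M_def hypoexp_density_def sum_distrib_left
      by (intro ext sum.cong refl) (simp add: algebra_simps flip: exp_add)
    also have "(\<Sum>i\<in>{1..M} - {n}. pf_coeff ?a ({1..M} - {n}) i * ?a i * (exp (- (?a i + s) * 0) / (?a i + s)))
      = (\<Sum>i\<in>{1..M} - {n}. pf_coeff ?a ({1..M} - {n}) i * (?a i / (?a i + s)))"
      by simp
    also have "\<dots> = (\<Prod>i\<in>{1..M} - {n}. ?a i / (?a i + s))"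
    proof (rule partial_fractions)
      fix i assume "i \<in> {1..M} - {n}"
      then have "?a i > 0" using \<kappa> by simp
      then show "?a i \<noteq> 0" "?a i + s \<noteq> 0" using s by linarith+
    qed (use \<kappa> nonempty in \<open>auto intro!: inj_on_quadratic\<close>)
    also have "\<dots> = (\<Prod>i\<in>{1..M} - {n}. exp (- log_gap \<kappa> n s i))"
    proof (rule prod.cong)
      fix i assume i: "i \<in> {1..M} - {n}"
      then have "?a i > 0" using \<kappa> by simp
      have "exp (- ln (1 + s / c)) = c / (c + s)" if "c > 0" for c
      proof -
        have "1 + s / c = (c + s) / c" using that by (simp add: add_divide_distrib)
        then show ?thesis using that s by (simp add: exp_minus)
      qed
      from this[OF \<open>?a i > 0\<close>]
      show "?a i / (?a i + s) = exp (- log_gap \<kappa> n s i)"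
        using i by (simp add: log_gap_def)
    qed auto
    also have "\<dots> = exp (- (\<Sum>i\<in>{1..M} - {n}. log_gap \<kappa> n s i))"
      by (simp add: exp_sum flip: sum_negf)
    also have "(\<Sum>i\<in>{1..M} - {n}. log_gap \<kappa> n s i) = (\<Sum>m\<le>M. log_gap \<kappa> n s m)"
      by (intro sum.mono_neutral_left) (auto simp: log_gap_def)
    finally show ?thesis .
  qed
  show "(\<lambda>M. exp (- (\<Sum>m\<le>M. log_gap \<kappa> n s m))) \<longlonglongrightarrow> exp (- (\<Sum>m. log_gap \<kappa> n s m))"
    using summable_LIMSEQ'[OF summable_log_gap[OF \<kappa>(1), of s n]] s by (intro tendsto_intros) auto
qed auto

text \<open>If the integral vanished, the density would vanish on \<open>[0, r]\<close> and its Laplace transform would be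
  \<open>O(exp (- s r))\<close>; but the logarithm of the transform is \<open>o(s)\<close>.\<close>

lemma gap_density_integral_pos:
  assumes \<kappa>: "\<kappa> > 0" "n \<ge> 1" and r: "r > 0" and \<mu>: "\<mu> \<ge> 0"
    and J: "((\<lambda>y. exp (- \<mu> * (r - y)) * gap_density \<kappa> n y) has_integral J) {0..r}"
  shows "J > 0"
proof (rule ccontr)
  assume "\<not> J > 0"
  have le: "exp (- (\<Sum>m. log_gap \<kappa> n s m)) \<le> 4 * \<kappa> * (exp (- s * r) / s)" if s: "s > 0" for s
  proof -
    let ?g1 = "\<lambda>y. if y \<in> {0..r} then exp (- \<mu> * (r - y)) * gap_density \<kappa> n y else 0"
    let ?g2 = "\<lambda>y. if y \<in> {r..} then exp (- s * y) else 0"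
    have 1: "(?g1 has_integral J) {0..}"
      using J r by (subst has_integral_restrict) auto
    have 2: "(?g2 has_integral exp (- s * r) / s) {0..}"
      using has_integral_exp_minus_to_infinity[OF s, of r] r by (subst has_integral_restrict) auto
    \<comment> \<open>On \<open>[0, r]\<close> the weight \<open>exp (- s * y)\<close> is at most
      \<open>exp (\<mu> * r)\<close> times the weight that defines \<open>J\<close>, so this part
      contributes nothing positive. Beyond \<open>r\<close> the density is at most
      \<open>4 * \<kappa>\<close>.\<close>
    have "exp (- (\<Sum>m. log_gap \<kappa> n s m)) \<le> exp (\<mu> * r) * J + 4 * \<kappa> * (exp (- s * r) / s)"
    proof (rule has_integral_le[OF gap_density_laplace[OF \<kappa> s]])
      show "((\<lambda>y. exp (\<mu> * r) * ?g1 y + 4 * \<kappa> * ?g2 y) has_integral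
          exp (\<mu> * r) * J + 4 * \<kappa> * (exp (- s * r) / s)) {0..}"
        by (intro has_integral_add has_integral_mult_right 1 2)
      fix y :: real assume y: "y \<in> {0..}"
      note b = gap_density_bounds[OF \<kappa>, of y]
      show "exp (- s * y) * gap_density \<kappa> n y \<le> exp (\<mu> * r) * ?g1 y + 4 * \<kappa> * ?g2 y"
      proof (cases "y \<le> r")
        case True
        have "exp (- s * y) * gap_density \<kappa> n y \<le> exp (\<mu> * y) * gap_density \<kappa> n y"
          using b y \<mu> s by (intro mult_right_mono) (auto intro: order.trans[of _ 0])
        also have "\<dots> = exp (\<mu> * r) * (exp (- \<mu> * (r - y)) * gap_density \<kappa> n y)"
          by (simp add: algebra_simps flip: exp_add mult.assoc)
        also have "\<dots> = exp (\<mu> * r) * ?g1 y" using True y by simp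
        also have "\<dots> \<le> exp (\<mu> * r) * ?g1 y + 4 * \<kappa> * ?g2 y" using \<kappa> by simp
        finally show ?thesis .
      next
        case False
        then show ?thesis using b y by (simp add: mult.commute)
      qed
    qed
    moreover have "exp (\<mu> * r) * J \<le> 0" using \<open>\<not> J > 0\<close> by (simp add: mult_le_0_iff)
    ultimately show ?thesis by linarith
  qed
  have "((\<lambda>s. \<Sum>m. log_gap \<kappa> n s m / s) \<longlongrightarrow> (\<Sum>m. 0)) at_top"
  proof (rule tendsto_suminf_dominated)
    fix m
    have "((\<lambda>s. ln (1 + s / c) / s) \<longlongrightarrow> 0) at_top" if "c > 0" for c :: real
      using that by real_asymp
    then show "((\<lambda>s. log_gap \<kappa> n s m / s) \<longlongrightarrow> 0) at_top"
      using \<kappa> by (cases "m = 0 \<or> m = n") (auto simp: log_gap_def)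
  next
    show "\<forall>\<^sub>F s in at_top. \<forall>m. \<bar>log_gap \<kappa> n s m / s\<bar> \<le> 1 / \<kappa> * (1 / real m ^ 2)"
      using eventually_gt_at_top[of 0]
    proof eventually_elim
      case (elim s)
      then show ?case using log_gap_bounds[OF \<kappa>(1), of s n]
        by (auto simp: field_simps)
    qed
    show "summable (\<lambda>m. 1 / \<kappa> * (1 / real m ^ 2))"
      by (rule summable_mult[OF summable_inverse_squares_real])
  qed auto
  then have "eventually (\<lambda>s. (\<Sum>m. log_gap \<kappa> n s m / s) < r / 2) at_top"
    using r by (intro order_tendstoD(2)[where y = 0]) auto
  then have "eventually (\<lambda>s. (\<Sum>m. log_gap \<kappa> n s m / s) < r / 2 \<and> s > 4 * \<kappa> \<and> s > 0) at_top"
    by (intro eventually_conj eventually_gt_at_top)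
  \<comment> \<open>With \<open>s > 4 * \<kappa>\<close> the prefactor
    \<open>4 * \<kappa> / s\<close> is at most 1, and the contradiction is
    \<open>exp (- s * r / 2) < exp (- s * r)\<close>.\<close>
  then obtain s where s: "(\<Sum>m. log_gap \<kappa> n s m / s) < r / 2" "s > 4 * \<kappa>" "s > 0"
    by (auto dest: eventually_happens'[rotated])
  have "(\<Sum>m. log_gap \<kappa> n s m / s) = (\<Sum>m. log_gap \<kappa> n s m) / s"
    using summable_log_gap[OF \<kappa>(1), of s n] s by (simp add: suminf_divide)
  then have lt: "(\<Sum>m. log_gap \<kappa> n s m) < s * r / 2"
    using s by (simp add: pos_divide_less_eq mult.commute)
  have "exp (- (s * r) / 2) < exp (- (\<Sum>m. log_gap \<kappa> n s m))" using lt by simp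
  also have "\<dots> \<le> (4 * \<kappa> / s) * exp (- s * r)" using le[OF s(3)] by (simp add: field_simps)
  also have "\<dots> \<le> 1 * exp (- s * r)" using s by (intro mult_right_mono) auto
  finally have "exp (- (s * r) / 2) < exp (- s * r)" by simp
  then have "- (s * r) / 2 < - (s * r)" by simp
  moreover have "s * r > 0" using s r by simp
  ultimately show False by linarith
qed

subsection \<open>Abel summation and the coefficients b\<close>

lemma summable_poly2_geometric:
  fixes t :: real
  assumes "\<bar>t\<bar> < 1"
  shows "summable (\<lambda>m. real m ^ 2 * t ^ m)"
proof (cases "t = 0")
  case True
  have "(\<lambda>m. real m ^ 2 * t ^ m) = (\<lambda>m. 0)" using True by (auto simp: fun_eq_iff power_0_left)
  then show ?thesis by simp
next
  case False
  define c where "c = - ln \<bar>t\<bar>"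
  have c: "c > 0" using assms False by (simp add: c_def)
  have pow: "\<bar>t\<bar> ^ m = exp (- (c * real m))" for m
    using False by (simp add: c_def exp_of_nat2_mult)
  have "(\<lambda>m. real m ^ 2 * exp (- (c * real m))) \<in> O(\<lambda>m. 1 / real m ^ 2)"
    using c by real_asymp
  then have "summable (\<lambda>m. real m ^ 2 * exp (- (c * real m)))"
    by (rule summable_comparison_test_bigo[rotated]) (use summable_inverse_squares_real in simp)
  then have "summable (\<lambda>m. \<bar>real m ^ 2 * t ^ m\<bar>)"
    by (simp add: abs_mult power_abs pow)
  then show ?thesis by (rule summable_rabs_cancel)
qed

text \<open>Shifting the index and writing \<open>(m + 1)^2 = m^2 + 2 * (m + 1) - 1\<close> gives a
  linear equation for the sum. At \<open>x = - t\<close> the numerator contains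
  \<open>1 - t\<close>, which makes the Abel value 0.\<close>

lemma suminf_squares_geometric:
  fixes x :: real
  assumes x: "\<bar>x\<bar> < 1"
  shows "(\<Sum>m. real m ^ 2 * x ^ m) = x * (1 + x) / (1 - x) ^ 3"
proof -
  let ?S = "\<Sum>m. real m ^ 2 * x ^ m"
  note s2 = summable_poly2_geometric[OF x]
  have g: "(\<lambda>m. x ^ m) sums (1 / (1 - x))" using x by (intro geometric_sums) auto
  have d: "(\<lambda>m. real (Suc m) * x ^ m) sums (1 / (1 - x)\<^sup>2)" using geometric_deriv_sums[of x] x by simp
  have "?S = (\<Sum>m. real (Suc m) ^ 2 * x ^ Suc m)"
    using suminf_split_head[OF s2] by simp
  also have "\<dots> = (\<Sum>m. x * (real m ^ 2 * x ^ m + (2 * (real (Suc m) * x ^ m) - x ^ m)))"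
    by (intro suminf_cong) (simp add: power2_eq_square algebra_simps)
  also have "\<dots> = x * (?S + (2 * (1 / (1 - x)\<^sup>2) - 1 / (1 - x)))"
    using s2 by (intro sums_unique[symmetric] sums_mult sums_add sums_diff g d summable_sums)
  finally have eq: "?S = x * (?S + (2 * (1 / (1 - x)\<^sup>2) - 1 / (1 - x)))" .
  define u where "u = 1 - x"
  have u: "u \<noteq> 0" "x = 1 - u" using x by (auto simp: u_def)
  have eq': "?S = (1 - u) * (?S + (2 / u\<^sup>2 - 1 / u))"
    using eq u_def by simp
  then have "u * ?S = (1 - u) * (2 / u\<^sup>2 - 1 / u)" by algebra
  also have "\<dots> = (1 - u) * (2 - u) / u\<^sup>2" using u(1) by (simp add: field_simps power2_eq_square)
  finally have "?S = (1 - u) * (2 - u) / u ^ 3"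
    using u(1) by (simp add: field_simps power2_eq_square power3_eq_cube)
  also have "\<dots> = x * (1 + x) / (1 - x) ^ 3" by (simp add: u_def)
  finally show ?thesis .
qed

text \<open>The polynomial part is summed exactly for every \<open>M \<ge> 2\<close>; only the
  remainder \<open>g\<close> needs a limit, which domination by its absolute values provides.
  \<open>abel_sums_alternating\<close> assigns the same value.\<close>

lemma cutoff_sum_tendsto:
  assumes g: "summable (\<lambda>m. \<bar>g m\<bar>)"
  shows "(\<lambda>M. \<Sum>m\<le>M. cutoff M m * ((-1) ^ m * (A * real m ^ 2 + B + g m)))
    \<longlonglongrightarrow> B / 2 + (\<Sum>m. (-1) ^ m * g m)"
proof -
  have lim: "(\<lambda>M. \<Sum>m. cutoff M m * ((-1) ^ m * g m)) \<longlonglongrightarrow> (\<Sum>m. 1 * ((-1) ^ m * g m))"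
  proof (rule tendsto_suminf_dominated)
    show "eventually (\<lambda>M. \<forall>m. \<bar>cutoff M m * ((-1) ^ m * g m)\<bar> \<le> \<bar>g m\<bar>) sequentially"
      using cutoff_bounds by (intro always_eventually allI) (auto simp: abs_mult mult_left_le_one_le)
    show "(\<lambda>M. cutoff M m * ((-1) ^ m * g m)) \<longlonglongrightarrow> 1 * ((-1) ^ m * g m)" for m
      by (rule tendsto_mult[OF cutoff_tendsto tendsto_const])
  qed (use g in auto)
  have "eventually (\<lambda>M. B / 2 + (\<Sum>m. cutoff M m * ((-1) ^ m * g m)) =
      (\<Sum>m\<le>M. cutoff M m * ((-1) ^ m * (A * real m ^ 2 + B + g m)))) sequentially"
    using eventually_ge_at_top[of 2]
  proof eventually_elim
    case (elim M)
    have "(\<Sum>m. cutoff M m * ((-1) ^ m * g m)) = (\<Sum>m\<in>{..M}. cutoff M m * ((-1) ^ m * g m))"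
      by (rule suminf_finite) (auto simp: cutoff_eq_0)
    moreover have "(\<Sum>m\<le>M. cutoff M m * ((-1) ^ m * (A * real m ^ 2 + B + g m))) =
        (\<Sum>m\<le>M. A * ((-1) ^ m * cutoff M m * real m ^ 2) + B * ((-1) ^ m * cutoff M m) + cutoff M m * ((-1) ^ m * g m))"
      by (intro sum.cong refl) (simp add: algebra_simps)
    moreover have "\<dots> = A * (\<Sum>m\<le>M. (-1) ^ m * cutoff M m * real m ^ 2) + B * (\<Sum>m\<le>M. (-1) ^ m * cutoff M m)
        + (\<Sum>m\<le>M. cutoff M m * ((-1) ^ m * g m))"
      by (simp only: sum.distrib sum_distrib_left)
    ultimately show ?case
      using cutoff_alternating_sum[of M] cutoff_alternating_sum_squares[of M] elim by simp
  qed
  then show ?thesis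
    using tendsto_add[OF tendsto_const[of "B / 2"] lim] by (auto intro: Lim_transform_eventually)
qed

text \<open>The alternating signs turn the power series into the generating functions of
  \<open>m^2\<close> and 1 at \<open>- t\<close>, which have finite limits as \<open>t\<close> tends
  to 1; the remainder is dominated.\<close>

lemma abel_sums_alternating:
  assumes g: "summable (\<lambda>m. \<bar>g m\<bar>)"
  shows "abel_sums (\<lambda>m. (-1) ^ m * (A * real m ^ 2 + B + g m)) (B / 2 + (\<Sum>m. (-1) ^ m * g m))"
proof -
  have sums: "(\<lambda>m. ((-1) ^ m * (A * real m ^ 2 + B + g m)) * t ^ m) sums
      (A * ((- t) * (1 - t) / (1 + t) ^ 3) + B * (1 / (1 + t)) + (\<Sum>m. (-1) ^ m * g m * t ^ m))"
    if t: "0 < t" "t < 1" for t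
  proof -
    have 1: "(\<lambda>m. real m ^ 2 * (- t) ^ m) sums ((- t) * (1 - t) / (1 + t) ^ 3)"
      using summable_sums[OF summable_poly2_geometric[of "- t"]] suminf_squares_geometric[of "- t"] t by simp
    have 2: "(\<lambda>m. (- t) ^ m) sums (1 / (1 + t))"
      using geometric_sums[of "- t"] t by simp
    have "summable (\<lambda>m. (-1) ^ m * g m * t ^ m)"
    proof (rule summable_comparison_test[OF _ g], intro exI[of _ 0] allI impI)
      fix m
      show "norm ((-1) ^ m * g m * t ^ m) \<le> \<bar>g m\<bar>"
        using t by (simp add: abs_mult power_abs mult_left_le power_le_one)
    qed
    then have 3: "(\<lambda>m. (-1) ^ m * g m * t ^ m) sums (\<Sum>m. (-1) ^ m * g m * t ^ m)"
      by (rule summable_sums)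
    have eq: "((-1) ^ m * (A * real m ^ 2 + B + g m)) * t ^ m =
       A * (real m ^ 2 * (- t) ^ m) + B * (- t) ^ m + (-1) ^ m * g m * t ^ m" for m
      by (subst (1 2) power_minus) (simp add: algebra_simps)
    show ?thesis unfolding eq by (intro sums_add sums_mult 1 2 3)
  qed
  have ev: "eventually (\<lambda>t::real. 0 < t \<and> t < 1) (at_left 1)"
    by (rule eventually_at_leftI[of 0]) auto
  have "((\<lambda>t. A * ((- t) * (1 - t) / (1 + t) ^ 3) + B * (1 / (1 + t)) + (\<Sum>m. (-1) ^ m * g m * t ^ m))
      \<longlongrightarrow> A * ((- 1) * (1 - 1) / (1 + 1) ^ 3) + B * (1 / (1 + 1)) + (\<Sum>m. (-1) ^ m * g m * 1 ^ m)) (at_left 1)"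
  proof (intro tendsto_add tendsto_mult tendsto_divide tendsto_power tendsto_minus tendsto_diff tendsto_const
      tendsto_ident_at tendsto_suminf_dominated)
    show "\<forall>\<^sub>F t in at_left 1. \<forall>m. \<bar>(-1) ^ m * g m * t ^ m\<bar> \<le> \<bar>g m\<bar>"
      using ev by eventually_elim (auto simp: abs_mult power_abs mult_left_le power_le_one)
  qed (use g in auto)
  then have lim: "((\<lambda>t. A * ((- t) * (1 - t) / (1 + t) ^ 3) + B * (1 / (1 + t)) + (\<Sum>m. (-1) ^ m * g m * t ^ m))
      \<longlongrightarrow> B / 2 + (\<Sum>m. (-1) ^ m * g m)) (at_left 1)"
    by simp
  have "((\<lambda>t. \<Sum>m. ((-1) ^ m * (A * real m ^ 2 + B + g m)) * t ^ m) \<longlongrightarrow> B / 2 + (\<Sum>m. (-1) ^ m * g m)) (at_left 1)"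
    by (rule Lim_transform_eventually[OF lim]) (use ev in eventually_elim, use sums in \<open>auto simp: sums_iff\<close>)
  moreover have "\<forall>t\<in>{0<..<1}. summable (\<lambda>m. ((-1) ^ m * (A * real m ^ 2 + B + g m)) * t ^ m)"
    using sums by (auto simp: sums_iff)
  ultimately show ?thesis unfolding abel_sums_def by blast
qed

lemma abel_sums_cmult:
  assumes "abel_sums f S"
  shows "abel_sums (\<lambda>m. c * f m) (c * S)"
proof -
  have s: "summable (\<lambda>m. f m * t ^ m)" if "t \<in> {0<..<1}" for t
    using assms that by (auto simp: abel_sums_def)
  have ev: "eventually (\<lambda>t::real. t \<in> {0<..<1}) (at_left 1)"
    by (rule eventually_at_leftI[of 0]) auto
  have "((\<lambda>t. c * (\<Sum>m. f m * t ^ m)) \<longlongrightarrow> c * S) (at_left 1)"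
    using assms by (intro tendsto_intros) (auto simp: abel_sums_def)
  then have "((\<lambda>t. \<Sum>m. c * f m * t ^ m) \<longlongrightarrow> c * S) (at_left 1)"
    by (rule Lim_transform_eventually)
       (use ev in eventually_elim, use s in \<open>simp add: suminf_mult[symmetric] mult.assoc\<close>)
  moreover have "\<forall>t\<in>{0<..<1}. summable (\<lambda>m. c * f m * t ^ m)"
    using s by (auto simp: mult.assoc intro: summable_mult)
  ultimately show ?thesis by (simp add: abel_sums_def)
qed

section \<open>The coefficients of the theorem and its Abel sums\<close>

text \<open>With \<open>a j = \<kappa> * j^2\<close> a factor of the product is
  \<open>(a j - a n) / (a j - a m)\<close>, so a finite product is the quotient of two partial
  fraction coefficients: that of \<open>m\<close> with \<open>n\<close> removed over that of
  \<open>n\<close> with \<open>m\<close> removed. Their \<open>cutoff\<close> factors tend to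
  1.\<close>

lemma bcoef_times_eta:
  assumes \<beta>: "\<beta> > 0" and mn: "m \<ge> 1" "n \<ge> 1" "m \<noteq> n"
  shows "bcoef \<beta> m n * eta \<beta> m n = (-1) ^ (m + n + 1) * real m ^ 2 / real n ^ 2"
proof -
  define \<kappa> where "\<kappa> = \<beta> * pi\<^sup>2 / 2"
  have \<kappa>: "\<kappa> > 0" using \<beta> by (simp add: \<kappa>_def)
  have eta: "eta \<beta> j l = \<kappa> * real j ^ 2 - \<kappa> * real l ^ 2" for j l
    by (simp add: eta_def eps1_def \<kappa>_def field_simps)
  let ?a = "\<lambda>j. \<kappa> * real j ^ 2"
  have a_inj: "?a i \<noteq> ?a j" if "i \<noteq> j" for i j
    using inj_on_quadratic[of \<kappa> UNIV] \<kappa> that by (auto simp: inj_on_def)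
  define f where "f = (\<lambda>m'. if m' = 0 \<or> m' = n \<or> m' = m then 1 else inverse (1 - eta \<beta> m n / eta \<beta> m' n))"
  define p where "p = (-1) ^ (m + n) * (1 - real m ^ 2 / real n ^ 2) / (1 - real n ^ 2 / real m ^ 2)"
  have "real m ^ 2 \<noteq> real n ^ 2" "real m ^ 2 \<noteq> 0" "real n ^ 2 \<noteq> 0" using mn by (auto simp: power2_eq_iff_nonneg)
  then have p: "p = (-1) ^ (m + n + 1) * real m ^ 2 / real n ^ 2"
    by (simp add: p_def divide_simps) (simp add: algebra_simps)
  have partial: "prod f {..M} = (-1) ^ (m + n) * (1 - real m ^ 2 / real n ^ 2) / (1 - real n ^ 2 / real m ^ 2) * (cutoff M m / cutoff M n)"
    if M: "M \<ge> m" "M \<ge> n" for M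
  proof -
    let ?I = "{1..M} - {n} - {m}"
    have I_eq: "{1..M} - {m} - {n} = ?I" by auto
    have "prod f {..M} = prod f ?I"
      by (intro prod.mono_neutral_right) (auto simp: f_def)
    also have "\<dots> = (\<Prod>j\<in>?I. (?a j / (?a j - ?a m)) / (?a j / (?a j - ?a n)))"
    proof (rule prod.cong)
      fix j assume j: "j \<in> ?I"
      then have "?a j > 0" "?a j - ?a n \<noteq> 0" "?a j - ?a m \<noteq> 0"
        using \<kappa> a_inj[of j n] a_inj[of j m] by auto
      moreover have "inverse (1 - (u - v) / (w - v)) = w / (w - u) / (w / (w - v))"
        if "w > 0" "w - v \<noteq> 0" "w - u \<noteq> 0" for u v w :: real
      proof -
        have "1 - (u - v) / (w - v) = (w - u) / (w - v)" using that by (simp add: field_simps)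
        then show ?thesis using that by simp
      qed
      ultimately show "f j = (?a j / (?a j - ?a m)) / (?a j / (?a j - ?a n))"
        using j unfolding f_def eta by auto
    qed auto
    also have "\<dots> = pf_coeff ?a ({1..M} - {n}) m / pf_coeff ?a ({1..M} - {m}) n"
      unfolding pf_coeff_def prod_dividef I_eq ..
    also have "\<dots> = (2 * (-1) ^ Suc m * cutoff M m * (1 - real m ^ 2 / real n ^ 2)) /
        (2 * (-1) ^ Suc n * cutoff M n * (1 - real n ^ 2 / real m ^ 2))"
      using \<kappa> mn M by (subst (1 2) pf_coeff_quadratic_remove) auto
    also have "\<dots> = (-1) ^ (m + n) * (1 - real m ^ 2 / real n ^ 2) / (1 - real n ^ 2 / real m ^ 2) * (cutoff M m / cutoff M n)"
      by (simp add: power_add) (simp add: divide_simps)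
    finally show ?thesis .
  qed
  have "(\<lambda>M. p * (cutoff M m / cutoff M n)) \<longlonglongrightarrow> p * (1 / 1)"
    by (intro tendsto_intros cutoff_tendsto) auto
  moreover have "eventually (\<lambda>M. p * (cutoff M m / cutoff M n) = prod f {..M}) sequentially"
    using eventually_ge_at_top[of "max m n"] by eventually_elim (simp add: partial p_def)
  ultimately have "(\<lambda>M. prod f {..M}) \<longlonglongrightarrow> p"
    by (auto intro: Lim_transform_eventually)
  \<comment> \<open>Convergence of the partial products yields \<open>has_prod\<close> in this way
    only for a nonzero limit.\<close>
  moreover have "p \<noteq> 0" using mn by (simp add: p)
  ultimately have "f has_prod p" by (simp add: has_prod_def raw_has_prod_def)
  then have "prodinf f = p" by (rule has_prod_unique[symmetric])
  moreover have "eta \<beta> m n \<noteq> 0" using a_inj[OF mn(3)] by (simp add: eta)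
  ultimately show ?thesis unfolding bcoef_def f_def[symmetric] p[symmetric] by simp
qed

text \<open>Serves the numerator with \<open>lam > 0\<close> and the denominator with
  \<open>lam = 0\<close>. Each exponential of a finite density integrates to a multiple of the
  matching term, a quadratic polynomial in \<open>m\<close> plus a summable remainder, so that the
  \<open>cutoff\<close> limit and the Abel sum share the value \<open>S\<close>. The prefactor of
  \<open>S\<close> is independent of \<open>lam\<close> and cancels in the quotient.\<close>

lemma gap_density_abel:
  assumes \<kappa>: "\<kappa> > 0" "n \<ge> 1" and r: "r > 0" and lam: "lam \<ge> 0"
    and ne: "\<And>m. m \<ge> 1 \<Longrightarrow> m \<noteq> n \<Longrightarrow> \<kappa> * (real m ^ 2 - real n ^ 2) \<noteq> lam"
  defines "e \<equiv> \<lambda>m. \<kappa> * (real m ^ 2 - real n ^ 2)"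
  shows "\<exists>S. abel_sums (\<lambda>m. (-1) ^ m * (real m ^ 2 * e m * ((exp (- lam * r) - exp (- e m * r)) / (e m - lam)))) S \<and>
    ((\<lambda>y. exp (- (lam + \<kappa> * real n ^ 2) * (r - y)) * gap_density \<kappa> n y) has_integral
       (2 * exp (- \<kappa> * real n ^ 2 * r) / real n ^ 2 * S)) {0..r}"
proof -
  define \<mu> where "\<mu> = lam + \<kappa> * real n ^ 2"
  have n0: "real n ^ 2 > 0" using \<kappa>(2) by simp
  have \<mu>: "\<mu> > 0" using \<kappa> lam n0 by (simp add: \<mu>_def add_nonneg_pos)
  define T where "T m = real m ^ 2 * e m * ((exp (- lam * r) - exp (- e m * r)) / (e m - lam))" for m
  define g where "g m = exp (- lam * r) * ((lam * \<mu> / \<kappa>) / (e m - lam))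
      - (real m ^ 2 + lam / \<kappa> + (lam * \<mu> / \<kappa>) / (e m - lam)) * exp (- e m * r)" for m
  have e0: "e m - lam \<noteq> 0" if "m \<noteq> n" for m
  proof (cases "m = 0")
    case True
    then have "e m < 0" using \<kappa> n0 by (simp add: e_def)
    then show ?thesis using lam by simp
  next
    case False
    then show ?thesis using ne[of m] that by (auto simp: e_def)
  qed
  have T_eq: "T m = exp (- lam * r) * real m ^ 2 + exp (- lam * r) * (lam / \<kappa>) + g m" for m
  proof (cases "e m - lam = 0")
    \<comment> \<open>This occurs only for \<open>m = n\<close> and \<open>lam = 0\<close>; division
      by 0 gives 0 and both sides vanish.\<close>
    case True
    then have "m = n" using e0 by blast
    then show ?thesis using True by (simp add: T_def g_def e_def)
  next
    case False
    have m2: "real m ^ 2 = ((e m - lam) + \<mu>) / \<kappa>"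
      using \<kappa> by (simp add: e_def \<mu>_def field_simps)
    \<comment> \<open>Polynomial division in \<open>D = e m - lam\<close>, with
      \<open>e m = D + lam\<close>: the quotient supplies the coefficients of the divergent part,
      the rest decays like \<open>1 / m^2\<close>.\<close>
    have "(D + \<mu>) / \<kappa> * (D + lam) / D = (D + \<mu>) / \<kappa> + lam / \<kappa> + (lam * \<mu> / \<kappa>) / D" if "D \<noteq> 0" for D
      using \<kappa>(1) that by (simp add: field_simps)
    from this[OF False] have key: "real m ^ 2 * e m / (e m - lam) = real m ^ 2 + lam / \<kappa> + (lam * \<mu> / \<kappa>) / (e m - lam)"
      unfolding m2 by simp
    have "T m = (real m ^ 2 * e m / (e m - lam)) * (exp (- lam * r) - exp (- e m * r))"
      by (simp add: T_def)
    moreover define q where "q = (lam * \<mu> / \<kappa>) / (e m - lam)"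
    ultimately show ?thesis unfolding key g_def q_def[symmetric] by (simp only: algebra_simps)
  qed
  have g_sum: "summable (\<lambda>m. \<bar>g m\<bar>)"
  proof (rule summable_comparison_test_bigo)
    show "summable (\<lambda>m. norm (1 / real m ^ 2))" using summable_inverse_squares_real by simp
    have 1: "(\<lambda>m. 1 / (e m - lam)) \<in> O(\<lambda>m. 1 / real m ^ 2)"
      unfolding e_def using \<kappa> by real_asymp
    define c where "c = \<kappa> * r"
    have c: "c > 0" using \<kappa> r by (simp add: c_def)
    have er: "- e m * r = - c * (real m ^ 2 - real n ^ 2)" for m by (simp add: e_def c_def)
    have 2: "(\<lambda>m. (real m ^ 2 + lam / \<kappa>) * exp (- e m * r)) \<in> O(\<lambda>m. 1 / real m ^ 2)"
      unfolding er using c by real_asymp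
    have 3: "(\<lambda>m. exp (- e m * r)) \<in> O(\<lambda>m. 1)"
      unfolding er using c by real_asymp
    have 4: "(\<lambda>m. 1 / (e m - lam) * exp (- e m * r)) \<in> O(\<lambda>m. 1 / real m ^ 2)"
      using landau_o.big.mult[OF 1 3] by simp
    have cm: "(\<lambda>m. c * f m) \<in> O(\<lambda>m. 1 / real m ^ 2)"
      if "f \<in> O(\<lambda>m. 1 / real m ^ 2)" for c :: real and f :: "nat \<Rightarrow> real"
      using that by (cases "c = 0") auto
    have "g = (\<lambda>m. exp (- lam * r) * (lam * \<mu> / \<kappa>) * (1 / (e m - lam))
        - ((real m ^ 2 + lam / \<kappa>) * exp (- e m * r) + (lam * \<mu> / \<kappa>) * (1 / (e m - lam) * exp (- e m * r))))"
      by (auto simp: g_def fun_eq_iff algebra_simps)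
    also have "\<dots> \<in> O(\<lambda>m. 1 / real m ^ 2)"
      by (intro sum_in_bigo cm 1 2 4)
    finally show "(\<lambda>m. \<bar>g m\<bar>) \<in> O(\<lambda>m. 1 / real m ^ 2)" by simp
  qed
  define S where "S = exp (- lam * r) * (lam / \<kappa>) / 2 + (\<Sum>m. (-1) ^ m * g m)"
  have "abel_sums (\<lambda>m. (-1) ^ m * T m) S"
    unfolding T_eq S_def by (rule abel_sums_alternating[OF g_sum])
  moreover have "((\<lambda>y. exp (- \<mu> * (r - y)) * gap_density \<kappa> n y) has_integral
       (2 * exp (- \<kappa> * real n ^ 2 * r) / real n ^ 2 * S)) {0..r}"
  proof (rule gap_density_dominated_convergence[OF \<kappa>])
    show "(\<lambda>y. exp (- \<mu> * (r - y))) integrable_on {0..r}"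
      by (intro integrable_continuous_interval continuous_intros)
    let ?C = "2 * exp (- \<kappa> * real n ^ 2 * r) / real n ^ 2"
    show "(\<lambda>M. ?C * (\<Sum>m\<le>M. cutoff M m * ((-1) ^ m * T m))) \<longlonglongrightarrow> ?C * S"
      unfolding T_eq S_def by (intro tendsto_mult tendsto_const cutoff_sum_tendsto[OF g_sum])
    fix M assume M: "M \<ge> n + 2"
    have summand: "((\<lambda>y. cutoff M m * (gap_weight \<kappa> n m * (exp (- \<mu> * (r - y)) * exp (- (\<kappa> * real m ^ 2) * y)))) has_integral
        ?C * (cutoff M m * ((-1) ^ m * T m))) {0..r}" for m
    proof (cases "m = n")
      case True
      then show ?thesis using n0 by (simp add: gap_weight_def T_def e_def)
    next
      case False
      note e0 = e0[OF False]
      have am: "\<kappa> * real m ^ 2 = e m + \<kappa> * real n ^ 2" by (simp add: e_def algebra_simps)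
      have "((\<lambda>y. exp (- \<mu> * r) * exp (- (e m - lam) * y)) has_integral
         exp (- \<mu> * r) * (- exp (- (e m - lam) * r) / (e m - lam)) - exp (- \<mu> * r) * (- exp (- (e m - lam) * 0) / (e m - lam))) {0..r}"
        by (rule fundamental_theorem_of_calculus)
           (use r e0 in \<open>auto intro!: derivative_eq_intros simp: divide_simps simp flip: has_real_derivative_iff_has_vector_derivative\<close>,
            simp add: algebra_simps)
      also have "(\<lambda>y. exp (- \<mu> * r) * exp (- (e m - lam) * y)) = (\<lambda>y. exp (- \<mu> * (r - y)) * exp (- (\<kappa> * real m ^ 2) * y))"
        unfolding am \<mu>_def by (auto simp: fun_eq_iff algebra_simps simp flip: exp_add)
      also have "exp (- \<mu> * r) * (- exp (- (e m - lam) * r) / (e m - lam)) - exp (- \<mu> * r) * (- exp (- (e m - lam) * 0) / (e m - lam))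
        = (exp (- \<mu> * r) - exp (- \<mu> * r) * exp (- (e m - lam) * r)) / (e m - lam)"
        using e0 by (simp add: divide_simps)
      also have "exp (- \<mu> * r) - exp (- \<mu> * r) * exp (- (e m - lam) * r)
        = exp (- \<kappa> * real n ^ 2 * r) * (exp (- lam * r) - exp (- e m * r))"
        unfolding \<mu>_def by (simp add: algebra_simps flip: exp_add)
      finally have I: "((\<lambda>y. exp (- \<mu> * (r - y)) * exp (- (\<kappa> * real m ^ 2) * y)) has_integral
         exp (- \<kappa> * real n ^ 2 * r) * (exp (- lam * r) - exp (- e m * r)) / (e m - lam)) {0..r}" .
      have w: "gap_weight \<kappa> n m = 2 * (-1) ^ m * real m ^ 2 * e m / real n ^ 2"
        using n0 by (simp add: gap_weight_def e_def field_simps)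
      show ?thesis
        using has_integral_mult_right[OF has_integral_mult_right[OF I, of "gap_weight \<kappa> n m"], of "cutoff M m"]
        by (simp add: w T_def mult_ac)
    qed
    have "((\<lambda>y. \<Sum>m\<le>M. cutoff M m * (gap_weight \<kappa> n m * (exp (- \<mu> * (r - y)) * exp (- (\<kappa> * real m ^ 2) * y)))) has_integral
        (\<Sum>m\<le>M. ?C * (cutoff M m * ((-1) ^ m * T m)))) {0..r}"
      by (intro has_integral_sum summand) auto
    moreover have "exp (- \<mu> * (r - y)) * gap_density_M \<kappa> n M y =
        (\<Sum>m\<le>M. cutoff M m * (gap_weight \<kappa> n m * (exp (- \<mu> * (r - y)) * exp (- (\<kappa> * real m ^ 2) * y))))" for y
      using M by (subst gap_density_M_eq[OF \<kappa>]) (auto simp: sum_distrib_left mult_ac)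
    ultimately show "((\<lambda>y. exp (- \<mu> * (r - y)) * gap_density_M \<kappa> n M y) has_integral
        ?C * (\<Sum>m\<le>M. cutoff M m * ((-1) ^ m * T m))) {0..r}"
      by (simp only: sum_distrib_left)
  qed auto
  ultimately show ?thesis unfolding T_def \<mu>_def by blast
qed

subsection \<open>From Laplace transforms to exponential cutoffs\<close>

definition ramp :: "real \<Rightarrow> real \<Rightarrow> real \<Rightarrow> real" where
  "ramp a b z = max 0 (min 1 ((z - a) / (b - a)))"

lemma ramp_simps:
  assumes "a < b"
  shows "z \<le> a \<Longrightarrow> ramp a b z = 0" "z \<ge> b \<Longrightarrow> ramp a b z = 1" "0 \<le> ramp a b z" "ramp a b z \<le> 1"
  using assms by (auto simp: ramp_def divide_le_0_iff)

lemma continuous_on_ramp: "continuous_on A (ramp a b)"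
  unfolding ramp_def divide_inverse by (intro continuous_intros)

lemma polynomial_approx_unit_interval:
  assumes "continuous_on {0..1} g" "\<epsilon> > 0"
  obtains d and a :: "nat \<Rightarrow> real" where "\<And>z. z \<in> {0..1} \<Longrightarrow> \<bar>g z - (\<Sum>k\<le>d. a k * z ^ k)\<bar> < \<epsilon>"
proof -
  obtain q where q: "real_polynomial_function q" "\<And>z. z \<in> {0..1} \<Longrightarrow> \<bar>g z - q z\<bar> < \<epsilon>"
    using Stone_Weierstrass_real_polynomial_function[OF compact_Icc assms] by blast
  from q(1) obtain a d where "q = (\<lambda>x. \<Sum>i\<le>d. a i * x ^ i)"
    unfolding real_polynomial_function_iff_sum by blast
  with q(2) show thesis by (intro that[of a d]) auto
qed

text \<open>\<open>w N\<close> is a measure on the points \<open>y N i\<close>, and \<open>f\<close>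
  is the density of the limit law translated by \<open>c\<close>. In \<open>z = exp (- y)\<close>
  the transforms at positive integers are moments on \<open>[0, 1]\<close> of the measure with an
  extra factor \<open>z\<close>, so polynomials in \<open>z\<close> may be tested. The jump of the
  target function is harmless because \<open>f\<close> is bounded.\<close>

lemma laplace_convergence_exp_cutoff:
  fixes w y :: "nat \<Rightarrow> nat \<Rightarrow> real" and f :: "real \<Rightarrow> real"
  assumes w: "\<And>N i. w N i \<ge> 0" and y: "\<And>N i. y N i \<ge> 0"
    and summ: "\<And>N. summable (\<lambda>i. w N i * exp (- y N i))"
    and f: "\<And>x. x \<ge> 0 \<Longrightarrow> 0 \<le> f x" "\<And>x. x \<ge> 0 \<Longrightarrow> f x \<le> K"
    and c: "c \<ge> 0" "c < \<rho>" and \<mu>: "\<mu> \<ge> 0"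
    and lim: "\<And>k. (\<lambda>N. \<Sum>i. w N i * exp (- real (Suc k) * y N i)) \<longlonglongrightarrow> L k"
    and L: "\<And>k. ((\<lambda>x. exp (- real (Suc k) * (x + c)) * f x) has_integral L k) {0..}"
    and J: "((\<lambda>x. exp (- \<mu> * (\<rho> - c - x)) * f x) has_integral J) {0..\<rho> - c}"
  shows "(\<lambda>N. \<Sum>i. w N i * (if y N i \<le> \<rho> then exp (- \<mu> * (\<rho> - y N i)) else 0)) \<longlonglongrightarrow> J"
proof -
  \<comment> \<open>In terms of \<open>z\<close>, \<open>exp (- \<mu> * (\<rho> - y))\<close> is
    \<open>exp (- \<mu> * \<rho>) * z powr (- \<mu>)\<close>; dividing by the reserved factor
    \<open>z\<close> lowers the exponent by 1. The \<open>max\<close> continues the function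
    continuously below the jump at \<open>exp (- \<rho>)\<close>.\<close>
  define \<psi>0 where "\<psi>0 z = exp (- \<mu> * \<rho>) * (max z (exp (- \<rho>))) powr (- \<mu> - 1)" for z
  define \<psi> where "\<psi> z = (if z \<ge> exp (- \<rho>) then \<psi>0 z else 0)" for z
  define C where "C = exp (- \<mu> * \<rho>) * exp (\<rho> * (\<mu> + 1))"
  have \<psi>0_bounds: "0 \<le> \<psi>0 z" "\<psi>0 z \<le> C" for z
  proof -
    show "0 \<le> \<psi>0 z" by (simp add: \<psi>0_def)
    have "(max z (exp (- \<rho>))) powr (- \<mu> - 1) \<le> exp (- \<rho>) powr (- \<mu> - 1)"
      using \<mu> by (intro powr_mono2') auto
    also have "\<dots> = exp (\<rho> * (\<mu> + 1))" by (simp add: powr_def algebra_simps)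
    finally show "\<psi>0 z \<le> C" by (simp add: \<psi>0_def C_def)
  qed
  have \<psi>_exp: "exp (- u) * \<psi> (exp (- u)) = (if u \<le> \<rho> then exp (- \<mu> * (\<rho> - u)) else 0)" for u
    by (auto simp: \<psi>_def \<psi>0_def max_def powr_def algebra_simps simp flip: exp_add)
  have \<psi>0_cont: "continuous_on {0..1} \<psi>0"
    unfolding \<psi>0_def by (intro continuous_intros) (auto simp: max_def)
  define E where "E N g = (\<Sum>i. w N i * (exp (- y N i) * g (exp (- y N i))))" for N and g :: "real \<Rightarrow> real"
  have K: "K \<ge> 0" using f[of 0] by simp
  have E_summable: "summable (\<lambda>i. w N i * (exp (- y N i) * g (exp (- y N i))))"
    if g: "\<And>z. z \<in> {0..1} \<Longrightarrow> \<bar>g z\<bar> \<le> B" for N B and g :: "real \<Rightarrow> real"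
  proof (rule summable_comparison_test[OF _ summable_mult[OF summ, of B]], intro exI[of _ 0] allI impI)
    fix i
    have "\<bar>g (exp (- y N i))\<bar> \<le> B" using y by (intro g) auto
    then show "norm (w N i * (exp (- y N i) * g (exp (- y N i)))) \<le> B * (w N i * exp (- y N i))"
      using w[of N i] by (simp add: abs_mult) (metis mult.commute mult.left_commute mult_left_mono mult_nonneg_nonneg exp_ge_zero)
  qed
  have poly: "(\<lambda>N. E N (\<lambda>z. \<Sum>k\<le>d. a k * z ^ k)) \<longlonglongrightarrow> (\<Sum>k\<le>d. a k * L k)"
    "((\<lambda>x. exp (- (x + c)) * (\<Sum>k\<le>d. a k * exp (- (x + c)) ^ k) * f x) has_integral (\<Sum>k\<le>d. a k * L k)) {0..}" for d a
  proof -
    have pow: "exp (- u) * exp (- u) ^ k = exp (- real (Suc k) * u)" for u k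
      by (simp add: algebra_simps flip: exp_of_nat_mult exp_add)
    have sm: "summable (\<lambda>i. w N i * (exp (- y N i) * exp (- y N i) ^ k))" for N k
      by (rule E_summable[of "\<lambda>z. z ^ k" 1]) (auto simp: power_abs power_le_one)
    have "E N (\<lambda>z. \<Sum>k\<le>d. a k * z ^ k) = (\<Sum>k\<le>d. a k * (\<Sum>i. w N i * exp (- real (Suc k) * y N i)))" for N
    proof -
      have "E N (\<lambda>z. \<Sum>k\<le>d. a k * z ^ k) = (\<Sum>i. \<Sum>k\<le>d. a k * (w N i * (exp (- y N i) * exp (- y N i) ^ k)))"
        unfolding E_def by (intro suminf_cong) (simp add: sum_distrib_left mult_ac)
      also have "\<dots> = (\<Sum>k\<le>d. \<Sum>i. a k * (w N i * (exp (- y N i) * exp (- y N i) ^ k)))"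
        by (intro suminf_sum summable_mult sm)
      also have "\<dots> = (\<Sum>k\<le>d. a k * (\<Sum>i. w N i * (exp (- y N i) * exp (- y N i) ^ k)))"
        by (intro sum.cong refl suminf_mult sm)
      finally show ?thesis unfolding pow .
    qed
    then show "(\<lambda>N. E N (\<lambda>z. \<Sum>k\<le>d. a k * z ^ k)) \<longlonglongrightarrow> (\<Sum>k\<le>d. a k * L k)"
      using lim by (auto intro!: tendsto_sum tendsto_mult)
    have "((\<lambda>x. \<Sum>k\<le>d. a k * (exp (- real (Suc k) * (x + c)) * f x)) has_integral (\<Sum>k\<le>d. a k * L k)) {0..}"
      by (intro has_integral_sum has_integral_mult_right L) auto
    moreover have "(\<Sum>k\<le>d. a k * (exp (- real (Suc k) * (x + c)) * f x)) =
        exp (- (x + c)) * (\<Sum>k\<le>d. a k * exp (- (x + c)) ^ k) * f x" for x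
      unfolding pow[symmetric] by (simp add: sum_distrib_left sum_distrib_right mult_ac)
    ultimately show "((\<lambda>x. exp (- (x + c)) * (\<Sum>k\<le>d. a k * exp (- (x + c)) ^ k) * f x) has_integral (\<Sum>k\<le>d. a k * L k)) {0..}"
      by simp
  qed
  have sandwich: "\<exists>d1 a1 d2 a2. (\<forall>z\<in>{0..1}. (\<Sum>k\<le>d1. a1 k * z ^ k) \<le> \<psi> z \<and> \<psi> z \<le> (\<Sum>k\<le>d2. a2 k * z ^ k)) \<and>
      (\<Sum>k\<le>d2. a2 k * L k) - (\<Sum>k\<le>d1. a1 k * L k) \<le> \<epsilon>" if \<epsilon>: "\<epsilon> > 0" for \<epsilon>
  proof -
    \<comment> \<open>Half the width of the window around the jump. Half of \<epsilon> pays for this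
      window, of length \<open>2 * \<delta>\<close>, where the integrand is at most
      \<open>K * C\<close>; the other half pays for the polynomial errors.
      \<open>\<delta> < \<rho> - c\<close> keeps the window inside the half-line.\<close>
    define \<delta> where "\<delta> = min ((\<rho> - c) / 2) (\<epsilon> / (4 * (K + 1) * (C + 1)))"
    have C: "C \<ge> 0" by (simp add: C_def)
    have \<delta>: "\<delta> > 0" "\<delta> < \<rho> - c" "2 * \<delta> * K * C \<le> \<epsilon> / 2"
    proof -
      show "\<delta> > 0" using c \<epsilon> K C by (simp add: \<delta>_def)
      show "\<delta> < \<rho> - c" using c by (simp add: \<delta>_def min_less_iff_disj)
      have "\<delta> \<le> \<epsilon> / (4 * (K + 1) * (C + 1))" by (simp add: \<delta>_def)
      then have "\<delta> * (4 * (K + 1) * (C + 1)) \<le> \<epsilon>" using K C by (simp add: pos_le_divide_eq)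
      moreover have "\<delta> * (4 * (K + 1) * (C + 1)) = 4 * (\<delta> * K * C) + \<delta> * (4 * (K + C + 1))"
        by (simp add: algebra_simps)
      moreover have "\<delta> * (4 * (K + C + 1)) \<ge> 0" using \<open>\<delta> > 0\<close> K C by simp
      ultimately show "2 * \<delta> * K * C \<le> \<epsilon> / 2" by simp
    qed
    define \<epsilon>' where "\<epsilon>' = \<epsilon> / (8 * (K + 1))"
    have \<epsilon>': "\<epsilon>' > 0" "4 * \<epsilon>' * K \<le> \<epsilon> / 2"
      using \<epsilon> K by (auto simp: \<epsilon>'_def field_simps)
    define gp where "gp z = \<psi>0 z * ramp (exp (- (\<rho> + \<delta>))) (exp (- \<rho>)) z" for z
    define gm where "gm z = \<psi>0 z * ramp (exp (- \<rho>)) (exp (- (\<rho> - \<delta>))) z" for z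
    note rp = ramp_simps[of "exp (- (\<rho> + \<delta>))" "exp (- \<rho>)"] and rm = ramp_simps[of "exp (- \<rho>)" "exp (- (\<rho> - \<delta>))"]
    have gp_ge: "\<psi> z \<le> gp z" and gm_le: "gm z \<le> \<psi> z" and gp_C: "gp z \<le> C" and gm_0: "0 \<le> gm z" for z
    proof -
      show "\<psi> z \<le> gp z" using \<delta> \<psi>0_bounds(1)[of z] rp(2,3)[of z] by (auto simp: \<psi>_def gp_def)
      show "gm z \<le> \<psi> z" using \<delta> \<psi>0_bounds(1)[of z] rm(1,4)[of z] by (auto simp: \<psi>_def gm_def mult_left_le)
      have "gp z \<le> \<psi>0 z * 1" unfolding gp_def using \<delta> \<psi>0_bounds(1)[of z] rp(4)[of z] by (intro mult_left_mono) auto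
      then show "gp z \<le> C" using \<psi>0_bounds(2)[of z] by simp
      show "0 \<le> gm z" using \<delta> \<psi>0_bounds(1)[of z] rm(3)[of z] by (auto simp: gm_def)
    qed
    have gp_gm: "gp (exp (- u)) = gm (exp (- u))" if "u \<notin> {\<rho> - \<delta>..\<rho> + \<delta>}" for u
      using that \<delta> by (auto simp: gp_def gm_def not_le ramp_simps)
    \<comment> \<open>Approximating the functions moved by \<epsilon>' up or down with error below
      \<epsilon>' makes the polynomials one-sided; together they exceed \<open>gp - gm\<close> by at
      most \<open>4 * \<epsilon>'\<close>.\<close>
    have "continuous_on {0..1} (\<lambda>z. gp z + \<epsilon>')" "continuous_on {0..1} (\<lambda>z. gm z - \<epsilon>')"
      unfolding gp_def gm_def by (intro continuous_intros \<psi>0_cont continuous_on_ramp)+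
    note cont = this
    obtain d2 a2 where P2: "\<And>z. z \<in> {0..1} \<Longrightarrow> \<bar>gp z + \<epsilon>' - (\<Sum>k\<le>d2. a2 k * z ^ k)\<bar> < \<epsilon>'"
      using polynomial_approx_unit_interval[OF cont(1) \<epsilon>'(1)] by blast
    obtain d1 a1 where P1: "\<And>z. z \<in> {0..1} \<Longrightarrow> \<bar>gm z - \<epsilon>' - (\<Sum>k\<le>d1. a1 k * z ^ k)\<bar> < \<epsilon>'"
      using polynomial_approx_unit_interval[OF cont(2) \<epsilon>'(1)] by blast
    let ?P1 = "\<lambda>z. \<Sum>k\<le>d1. a1 k * z ^ k" and ?P2 = "\<lambda>z. \<Sum>k\<le>d2. a2 k * z ^ k"
    have "(\<Sum>k\<le>d2. a2 k * L k) - (\<Sum>k\<le>d1. a1 k * L k) \<le> 4 * \<epsilon>' * K * (exp (- 1 * 0) / 1) + K * C * (2 * \<delta>)"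
    proof (rule has_integral_le[OF has_integral_diff[OF poly(2) poly(2)]])
      have 1: "((\<lambda>x. 4 * \<epsilon>' * K * exp (- 1 * x)) has_integral 4 * \<epsilon>' * K * (exp (- 1 * 0) / 1)) {0::real..}"
        by (intro has_integral_mult_right has_integral_exp_minus_to_infinity) auto
      have "((\<lambda>x. K * C) has_integral K * C * (2 * \<delta>)) {\<rho> - c - \<delta>..\<rho> - c + \<delta>}"
        using has_integral_const_real[of "K * C" "\<rho> - c - \<delta>" "\<rho> - c + \<delta>"] \<delta> by (simp add: mult.commute)
      then have 2: "((\<lambda>x. if x \<in> {\<rho> - c - \<delta>..\<rho> - c + \<delta>} then K * C else 0) has_integral K * C * (2 * \<delta>)) {0..}"
        using \<delta> by (subst has_integral_restrict) auto
      show "((\<lambda>x. 4 * \<epsilon>' * K * exp (- 1 * x) + (if x \<in> {\<rho> - c - \<delta>..\<rho> - c + \<delta>} then K * C else 0)) has_integral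
          4 * \<epsilon>' * K * (exp (- 1 * 0) / 1) + K * C * (2 * \<delta>)) {0..}"
        by (rule has_integral_add[OF 1 2])
      fix x :: real assume x: "x \<in> {0..}"
      define z where "z = exp (- (x + c))"
      have z: "z \<in> {0..1}" "z \<le> exp (- x)" "z \<le> 1" "z \<ge> 0" using x c by (auto simp: z_def)
      define D where "D = (if x \<in> {\<rho> - c - \<delta>..\<rho> - c + \<delta>} then C else 0)"
      have D0: "D \<ge> 0" using C by (simp add: D_def)
      have "gp z - gm z \<le> D"
        using gp_gm[of "x + c"] gp_C[of z] gm_0[of z] by (auto simp: D_def z_def)
      then have "?P2 z - ?P1 z \<le> 4 * \<epsilon>' + D"
        using P1[OF z(1)] P2[OF z(1)] by linarith
      then have "z * (?P2 z - ?P1 z) \<le> z * (4 * \<epsilon>' + D)" using z by (intro mult_left_mono)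
      also have "\<dots> = 4 * \<epsilon>' * z + z * D" by (simp add: algebra_simps)
      also have "\<dots> \<le> 4 * \<epsilon>' * exp (- x) + D"
        using z \<epsilon>' D0 by (intro add_mono mult_left_mono) (auto simp: mult_left_le_one_le)
      finally have le: "z * (?P2 z - ?P1 z) \<le> 4 * \<epsilon>' * exp (- x) + D" .
      have "z * (?P2 z - ?P1 z) * f x \<le> (4 * \<epsilon>' * exp (- x) + D) * f x"
        using le f(1)[of x] x by (intro mult_right_mono) auto
      also have "\<dots> \<le> (4 * \<epsilon>' * exp (- x) + D) * K"
        using D0 \<epsilon>' f(2)[of x] x by (intro mult_left_mono) auto
      finally show "exp (- (x + c)) * ?P2 (exp (- (x + c))) * f x - exp (- (x + c)) * ?P1 (exp (- (x + c))) * f x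
          \<le> 4 * \<epsilon>' * K * exp (- 1 * x) + (if x \<in> {\<rho> - c - \<delta>..\<rho> - c + \<delta>} then K * C else 0)"
        unfolding z_def[symmetric] by (auto simp: D_def algebra_simps)
    qed
    also have "\<dots> \<le> \<epsilon>" using \<delta>(3) \<epsilon>'(2) by (simp add: mult_ac)
    finally have "(\<Sum>k\<le>d2. a2 k * L k) - (\<Sum>k\<le>d1. a1 k * L k) \<le> \<epsilon>" .
    moreover have "?P1 z \<le> \<psi> z \<and> \<psi> z \<le> ?P2 z" if "z \<in> {0..1}" for z
      using P1[OF that] P2[OF that] gp_ge[of z] gm_le[of z] by linarith
    ultimately show ?thesis by blast
  qed
  have \<psi>_bound: "\<bar>\<psi> z\<bar> \<le> C" for z using \<psi>0_bounds[of z] by (auto simp: \<psi>_def)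
  have poly_bound: "\<exists>B. \<forall>z\<in>{0..1}. \<bar>\<Sum>k\<le>d. a k * z ^ k\<bar> \<le> B" for d and a :: "nat \<Rightarrow> real"
  proof -
    have "compact ((\<lambda>z. \<Sum>k\<le>d. a k * z ^ k) ` {0..1::real})"
      by (intro compact_continuous_image continuous_intros compact_Icc)
    then have "bounded ((\<lambda>z. \<Sum>k\<le>d. a k * z ^ k) ` {0..1::real})" by (rule compact_imp_bounded)
    then show ?thesis by (auto simp: bounded_iff)
  qed
  have E_mono: "E N g \<le> E N h" if "\<And>z. z \<in> {0..1} \<Longrightarrow> g z \<le> h z"
    "\<And>z. z \<in> {0..1} \<Longrightarrow> \<bar>g z\<bar> \<le> Bg" "\<And>z. z \<in> {0..1} \<Longrightarrow> \<bar>h z\<bar> \<le> Bh" for N g h Bg Bh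
    unfolding E_def
    by (rule suminf_le[OF _ E_summable E_summable]) (use that w y in \<open>auto intro!: mult_left_mono\<close>)
  have J': "((\<lambda>x. exp (- (x + c)) * \<psi> (exp (- (x + c))) * f x) has_integral J) {0..}"
  proof -
    have "((\<lambda>x. if x \<in> {0..\<rho> - c} then exp (- \<mu> * (\<rho> - c - x)) * f x else 0) has_integral J) {0..}"
      using J c by (subst has_integral_restrict) auto
    then show ?thesis
      unfolding \<psi>_exp by (rule has_integral_eq[rotated]) (auto simp: algebra_simps)
  qed
  have "(\<lambda>N. E N \<psi>) \<longlonglongrightarrow> J"
  proof (rule LIMSEQ_I)
    fix e :: real assume e: "e > 0"
    obtain d1 a1 d2 a2 where P: "\<And>z. z \<in> {0..1} \<Longrightarrow> (\<Sum>k\<le>d1. a1 k * z ^ k) \<le> \<psi> z"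
      "\<And>z. z \<in> {0..1} \<Longrightarrow> \<psi> z \<le> (\<Sum>k\<le>d2. a2 k * z ^ k)"
      and diff: "(\<Sum>k\<le>d2. a2 k * L k) - (\<Sum>k\<le>d1. a1 k * L k) \<le> e / 2"
      using sandwich[OF half_gt_zero[OF e]] by blast
    let ?P1 = "\<lambda>z. \<Sum>k\<le>d1. a1 k * z ^ k" and ?P2 = "\<lambda>z. \<Sum>k\<le>d2. a2 k * z ^ k"
    have zin: "exp (- (x + c)) \<in> {0..1}" if "x \<in> {0..}" for x using that c by auto
    have I1: "(\<Sum>k\<le>d1. a1 k * L k) \<le> J"
      by (rule has_integral_le[OF poly(2) J']) (use P(1)[OF zin] f(1) in \<open>auto intro!: mult_right_mono mult_left_mono\<close>)
    have I2: "J \<le> (\<Sum>k\<le>d2. a2 k * L k)"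
      by (rule has_integral_le[OF J' poly(2)]) (use P(2)[OF zin] f(1) in \<open>auto intro!: mult_right_mono mult_left_mono\<close>)
    obtain B1 B2 where B: "\<And>z. z \<in> {0..1} \<Longrightarrow> \<bar>?P1 z\<bar> \<le> B1" "\<And>z. z \<in> {0..1} \<Longrightarrow> \<bar>?P2 z\<bar> \<le> B2"
      using poly_bound by meson
    have le: "E N ?P1 \<le> E N \<psi>" "E N \<psi> \<le> E N ?P2" for N
      using P B \<psi>_bound by (blast intro: E_mono)+
    obtain N1 where N1: "\<And>N. N \<ge> N1 \<Longrightarrow> \<bar>E N ?P1 - (\<Sum>k\<le>d1. a1 k * L k)\<bar> < e / 2"
      using LIMSEQ_D[OF poly(1)[where d = d1 and a = a1], of "e / 2"] e by auto
    obtain N2 where N2: "\<And>N. N \<ge> N2 \<Longrightarrow> \<bar>E N ?P2 - (\<Sum>k\<le>d2. a2 k * L k)\<bar> < e / 2"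
      using LIMSEQ_D[OF poly(1)[where d = d2 and a = a2], of "e / 2"] e by auto
    show "\<exists>no. \<forall>N\<ge>no. norm (E N \<psi> - J) < e"
    proof (intro exI[of _ "max N1 N2"] allI impI)
      fix N assume "N \<ge> max N1 N2"
      then show "norm (E N \<psi> - J) < e"
        using N1[of N] N2[of N] le[of N] I1 I2 diff by (simp only: real_norm_def abs_less_iff) linarith
    qed
  qed
  then show ?thesis unfolding E_def \<psi>_exp .
qed

subsection \<open>Generating functions of multisets\<close>

definition mset_weight :: "('q \<Rightarrow> real) \<Rightarrow> 'q multiset \<Rightarrow> real" where
  "mset_weight p M = prod_mset (image_mset p M)"

text \<open>The canonical partition function of \<open>i\<close> bosons in the modes
  \<open>Q\<close>, that is, the coefficient of \<open>z^i\<close> in the product of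
  \<open>1 / (1 - p q * z)\<close>.\<close>

definition level_sum :: "('q \<Rightarrow> real) \<Rightarrow> 'q set \<Rightarrow> nat \<Rightarrow> real" where
  "level_sum p Q i = infsum (mset_weight p) {M. size M = i \<and> set_mset M \<subseteq> Q}"

lemma mset_weight_replicate_plus: "mset_weight p (replicate_mset j x + M) = p x ^ j * mset_weight p M"
  by (induction j) (auto simp: mset_weight_def)

lemma mset_weight_scale: "mset_weight (\<lambda>q. p q * z) M = mset_weight p M * z ^ size M"
  by (induction M) (auto simp: mset_weight_def)

lemma mset_weight_nonneg: "(\<And>q. q \<in> set_mset M \<Longrightarrow> 0 \<le> p q) \<Longrightarrow> 0 \<le> mset_weight p M"
  by (induction M) (auto simp: mset_weight_def)

lemma bij_betw_split_element:
  assumes "x \<notin> F"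
  shows "bij_betw (\<lambda>(j, M). replicate_mset j x + M) (UNIV \<times> {M. set_mset M \<subseteq> F}) {M. set_mset M \<subseteq> insert x F}"
proof (rule bij_betw_byWitness[where f' = "\<lambda>M. (count M x, filter_mset (\<lambda>q. q \<noteq> x) M)"])
  show "\<forall>jM\<in>UNIV \<times> {M. set_mset M \<subseteq> F}. (\<lambda>M. (count M x, filter_mset (\<lambda>q. q \<noteq> x) M)) ((\<lambda>(j, M). replicate_mset j x + M) jM) = jM"
  proof clarsimp
    fix j :: nat and M assume M: "set_mset M \<subseteq> F"
    then have x: "x \<notin># M" using assms by auto
    then have "filter_mset (\<lambda>q. q \<noteq> x) M = M" by (auto simp: filter_mset_eq_conv)
    moreover have "filter_mset (\<lambda>q. q \<noteq> x) (replicate_mset j x) = {#}" by (induction j) auto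
    ultimately show "count M x = 0 \<and> filter_mset (\<lambda>q. q \<noteq> x) (replicate_mset j x) + filter_mset (\<lambda>q. q \<noteq> x) M = M"
      using x by (simp add: not_in_iff)
  qed
  show "\<forall>M\<in>{M. set_mset M \<subseteq> insert x F}. (\<lambda>(j, M). replicate_mset j x + M) (count M x, filter_mset (\<lambda>q. q \<noteq> x) M) = M"
    by (auto intro!: multiset_eqI)
qed (auto simp: subset_iff split: if_splits)

lemma mset_weight_has_sum_finite:
  assumes "finite Q" "\<And>q. q \<in> Q \<Longrightarrow> 0 \<le> p q" "\<And>q. q \<in> Q \<Longrightarrow> p q < 1"
  shows "(mset_weight p has_sum (\<Prod>q\<in>Q. 1 / (1 - p q))) {M. set_mset M \<subseteq> Q}"
  using assms
proof (induction Q rule: finite_induct)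
  case empty
  have "{M :: 'a multiset. set_mset M \<subseteq> {}} = {{#}}" by auto
  then show ?case by (simp add: mset_weight_def has_sum_finite_iff)
next
  case (insert x F)
  let ?G = "\<Prod>q\<in>F. 1 / (1 - p q)"
  have px: "0 \<le> p x" "p x < 1" using insert.prems by auto
  have IH: "(mset_weight p has_sum ?G) {M. set_mset M \<subseteq> F}"
    using insert by auto
  have G: "?G \<ge> 0" using insert.prems by (intro prod_nonneg) (auto simp: less_imp_le)
  have inner: "((\<lambda>M. p x ^ j * mset_weight p M) has_sum (p x ^ j * ?G)) {M. set_mset M \<subseteq> F}" for j
    by (rule has_sum_cmult_right[OF IH])
  have outer: "((\<lambda>j. p x ^ j * ?G) has_sum (1 / (1 - p x) * ?G)) UNIV"
    using px G by (intro sums_nonneg_imp_has_sum sums_mult2 geometric_sums) auto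
  have "((\<lambda>(j, M). p x ^ j * mset_weight p M) has_sum (1 / (1 - p x) * ?G)) (Sigma UNIV (\<lambda>_. {M. set_mset M \<subseteq> F}))"
  proof (rule has_sum_SigmaI[OF _ outer])
    show "(\<lambda>(j, M). p x ^ j * mset_weight p M) summable_on Sigma UNIV (\<lambda>_. {M. set_mset M \<subseteq> F})"
    proof (rule summable_on_SigmaI[where g = "\<lambda>j. p x ^ j * ?G"])
      show "(\<lambda>j. p x ^ j * ?G) summable_on UNIV" using outer by (rule has_sum_imp_summable)
    qed (use inner px insert.prems in \<open>auto intro!: mult_nonneg_nonneg mset_weight_nonneg\<close>)
  qed (use inner in auto)
  then have "((\<lambda>jM. mset_weight p ((\<lambda>(j, M). replicate_mset j x + M) jM)) has_sum (1 / (1 - p x) * ?G)) (UNIV \<times> {M. set_mset M \<subseteq> F})"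
    by (simp add: mset_weight_replicate_plus case_prod_unfold)
  then have "(mset_weight p has_sum (1 / (1 - p x) * ?G)) {M. set_mset M \<subseteq> insert x F}"
    using has_sum_reindex_bij_betw[OF bij_betw_split_element[OF insert.hyps(2)], of "mset_weight p"] by blast
  then show ?case using insert.hyps by simp
qed

text \<open>Sums of logarithms replace infinite products. A finite set of multisets involves
  finitely many modes, whose product bounds its weight by \<open>exp S\<close>; conversely, the
  finite products are themselves sums over multisets and tend to \<open>exp S\<close>.\<close>

lemma mset_weight_has_sum:
  assumes p: "\<And>q. q \<in> Q \<Longrightarrow> 0 \<le> p q" "\<And>q. q \<in> Q \<Longrightarrow> p q < 1"
    and S: "((\<lambda>q. - ln (1 - p q)) has_sum S) Q"
  shows "(mset_weight p has_sum exp S) {M. set_mset M \<subseteq> Q}"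
proof -
  have fin: "(mset_weight p has_sum exp (\<Sum>q\<in>F. - ln (1 - p q))) {M. set_mset M \<subseteq> F}" if "finite F" "F \<subseteq> Q" for F
  proof -
    have "(\<Prod>q\<in>F. 1 / (1 - p q)) = exp (\<Sum>q\<in>F. - ln (1 - p q))"
      unfolding exp_sum[OF that(1)] using p that(2)
      by (intro prod.cong refl) (auto simp: exp_minus inverse_eq_divide subset_iff)
    then show ?thesis using mset_weight_has_sum_finite[OF that(1), of p] p that(2) by auto
  qed
  have nonneg: "0 \<le> - ln (1 - p q)" if "q \<in> Q" for q using p[OF that] by simp
  have wn: "mset_weight p M \<ge> 0" if "set_mset M \<subseteq> Q" for M
    using that p(1) by (intro mset_weight_nonneg) auto
  have bound: "sum (mset_weight p) B \<le> exp S" if B: "finite B" "B \<subseteq> {M. set_mset M \<subseteq> Q}" for B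
  proof -
    define F where "F = (\<Union>M\<in>B. set_mset M)"
    have F: "finite F" "F \<subseteq> Q" using B by (auto simp: F_def)
    have "sum (mset_weight p) B \<le> exp (\<Sum>q\<in>F. - ln (1 - p q))"
      by (rule finite_sum_le_has_sum[OF fin[OF F] B(1)]) (use F wn in \<open>auto simp: F_def\<close>)
    also have "(\<Sum>q\<in>F. - ln (1 - p q)) \<le> S"
      by (rule finite_sum_le_has_sum[OF S F]) (use nonneg in auto)
    finally show ?thesis by simp
  qed
  have summ: "mset_weight p summable_on {M. set_mset M \<subseteq> Q}"
    by (rule nonneg_bdd_above_summable_on) (use wn bound in \<open>auto intro!: bdd_aboveI2\<close>)
  have "infsum (mset_weight p) {M. set_mset M \<subseteq> Q} \<le> exp S"
    by (rule infsum_le_finite_sums[OF summ]) (use bound in auto)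
  moreover have "exp S \<le> infsum (mset_weight p) {M. set_mset M \<subseteq> Q}"
  proof (rule tendsto_upperbound)
    show "((\<lambda>F. exp (\<Sum>q\<in>F. - ln (1 - p q))) \<longlongrightarrow> exp S) (finite_subsets_at_top Q)"
      using S unfolding has_sum_def by (intro tendsto_exp)
    show "\<forall>\<^sub>F F in finite_subsets_at_top Q. exp (\<Sum>q\<in>F. - ln (1 - p q)) \<le> infsum (mset_weight p) {M. set_mset M \<subseteq> Q}"
    proof (rule eventually_finite_subsets_at_top_weakI)
      fix F assume F: "finite F" "F \<subseteq> Q"
      have "infsum (mset_weight p) {M. set_mset M \<subseteq> F} \<le> infsum (mset_weight p) {M. set_mset M \<subseteq> Q}"
        by (rule infsum_mono2) (use fin[OF F] summ F wn in \<open>auto dest: has_sum_imp_summable\<close>)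
      then show "exp (\<Sum>q\<in>F. - ln (1 - p q)) \<le> infsum (mset_weight p) {M. set_mset M \<subseteq> Q}"
        using infsumI[OF fin[OF F]] by simp
    qed
  qed auto
  ultimately show ?thesis using summ by (simp add: has_sum_iff)
qed

lemma level_sum_nonneg: "(\<And>q. q \<in> Q \<Longrightarrow> 0 \<le> p q) \<Longrightarrow> level_sum p Q i \<ge> 0"
  unfolding level_sum_def by (rule infsum_nonneg) (auto intro!: mset_weight_nonneg)

lemma mset_weight_level_summable:
  assumes "\<And>q. q \<in> Q \<Longrightarrow> 0 \<le> p q" "\<And>q. q \<in> Q \<Longrightarrow> p q < 1" "((\<lambda>q. - ln (1 - p q)) has_sum S) Q"
  shows "mset_weight p summable_on {M. size M = i \<and> set_mset M \<subseteq> Q}"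
  by (rule summable_on_subset_banach[OF has_sum_imp_summable[OF mset_weight_has_sum[OF assms]]]) auto

lemma level_sum_sums:
  assumes p: "\<And>q. q \<in> Q \<Longrightarrow> 0 \<le> p q" "\<And>q. q \<in> Q \<Longrightarrow> p q < 1"
    and S: "((\<lambda>q. - ln (1 - p q)) has_sum S) Q"
  shows "level_sum p Q sums exp S"
proof -
  let ?A = "Sigma UNIV (\<lambda>i. {M. size M = i \<and> set_mset M \<subseteq> Q})"
  have bij: "bij_betw snd ?A {M. set_mset M \<subseteq> Q}"
    by (rule bij_betw_byWitness[where f' = "\<lambda>M. (size M, M)"]) auto
  have "((\<lambda>x. mset_weight p (snd x)) has_sum exp S) ?A"
    using mset_weight_has_sum[OF p S] has_sum_reindex_bij_betw[OF bij, of "mset_weight p"] by auto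
  then have "(level_sum p Q has_sum exp S) UNIV"
  proof (rule has_sum_SigmaD)
    fix i
    show "((\<lambda>M. mset_weight p (snd (i, M))) has_sum level_sum p Q i) {M. size M = i \<and> set_mset M \<subseteq> Q}"
      using mset_weight_level_summable[OF p S] by (simp add: level_sum_def)
  qed
  then show ?thesis by (rule has_sum_imp_sums)
qed

text \<open>With \<open>z = exp (- s / V)\<close> this makes the generating function a Laplace
  transform in \<open>i / V\<close>.\<close>

lemma level_sum_scale:
  "level_sum (\<lambda>q. p q * z) Q i = level_sum p Q i * z ^ i"
proof -
  have "level_sum (\<lambda>q. p q * z) Q i = infsum (\<lambda>M. mset_weight p M * z ^ i) {M. size M = i \<and> set_mset M \<subseteq> Q}"
    unfolding level_sum_def by (intro infsum_cong) (auto simp: mset_weight_scale)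
  then show ?thesis by (simp add: level_sum_def infsum_cmult_left')
qed

text \<open>Classifies the states by the occupation number \<open>j\<close> of the observed mode;
  the other modes then hold \<open>N - j\<close> particles.\<close>

lemma infsum_level_split:
  fixes g :: "nat \<Rightarrow> real"
  assumes p: "\<And>q. q \<in> Q \<Longrightarrow> 0 \<le> p q" "\<And>q. q \<in> Q \<Longrightarrow> p q < 1" "((\<lambda>q. - ln (1 - p q)) has_sum S) Q"
    and k: "k \<notin> Q"
  shows "infsum (\<lambda>M. g (count M k) * mset_weight p M) {M. size M = N \<and> set_mset M \<subseteq> insert k Q} =
    (\<Sum>j\<le>N. g j * p k ^ j * level_sum p Q (N - j))"
proof -
  let ?B = "\<lambda>j. (\<lambda>M. replicate_mset j k + M) ` {M. size M = N - j \<and> set_mset M \<subseteq> Q}"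
  let ?f = "\<lambda>M. g (count M k) * mset_weight p M"
  have union: "{M. size M = N \<and> set_mset M \<subseteq> insert k Q} = (\<Union>j\<in>{..N}. ?B j)"
  proof (intro equalityI subsetI)
    fix M assume M: "M \<in> {M. size M = N \<and> set_mset M \<subseteq> insert k Q}"
    define M' c where "M' = filter_mset (\<lambda>q. q \<noteq> k) M" and "c = count M k"
    have M_eq: "M = replicate_mset c k + M'" by (auto intro!: multiset_eqI simp: M'_def c_def)
    have "N = c + size M'"
      using M arg_cong[OF M_eq, of size] by (simp only: mem_Collect_eq size_union size_replicate_mset)
    moreover have "set_mset M' \<subseteq> Q" using M by (auto simp: M'_def)
    ultimately have "c \<in> {..N}" "M' \<in> {M. size M = N - c \<and> set_mset M \<subseteq> Q}" by auto
    then show "M \<in> (\<Union>j\<in>{..N}. ?B j)" unfolding M_eq by blast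
  qed (auto simp: subset_iff split: if_splits)
  have cnt: "count M k = 0" if "set_mset M \<subseteq> Q" for M using that k by (auto simp: count_eq_zero_iff)
  have each: "(?f has_sum (g j * p k ^ j * level_sum p Q (N - j))) (?B j)" for j
  proof -
    have inj: "inj_on (\<lambda>M. replicate_mset j k + M) {M. size M = N - j \<and> set_mset M \<subseteq> Q}"
      by (auto simp: inj_on_def)
    have "(mset_weight p has_sum level_sum p Q (N - j)) {M. size M = N - j \<and> set_mset M \<subseteq> Q}"
      using mset_weight_level_summable[OF p] by (simp add: level_sum_def)
    then have "((\<lambda>M. g j * p k ^ j * mset_weight p M) has_sum (g j * p k ^ j * level_sum p Q (N - j))) {M. size M = N - j \<and> set_mset M \<subseteq> Q}"
      by (rule has_sum_cmult_right)
    then have "(?f \<circ> (\<lambda>M. replicate_mset j k + M) has_sum (g j * p k ^ j * level_sum p Q (N - j))) {M. size M = N - j \<and> set_mset M \<subseteq> Q}"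
      by (rule has_sum_cong[THEN iffD1, rotated]) (auto simp: mset_weight_replicate_plus cnt)
    then show ?thesis using has_sum_reindex[OF inj] by blast
  qed
  have "(?f has_sum (\<Sum>j\<le>N. g j * p k ^ j * level_sum p Q (N - j))) (\<Union>j\<in>{..N}. ?B j)"
  proof (rule sum_has_sum[OF _ each])
    fix i j :: nat assume "i \<noteq> j"
    have "M \<notin> ?B j" if "M \<in> ?B i" for M
    proof
      assume "M \<in> ?B j"
      then have "count M k = j" using cnt by auto
      moreover have "count M k = i" using that cnt by auto
      ultimately show False using \<open>i \<noteq> j\<close> by simp
    qed
    then show "?B i \<inter> ?B j = {}" by blast
  qed auto
  then show ?thesis unfolding union by (rule infsumI)
qed

subsection \<open>Theta sums\<close>

definition theta1 :: "real \<Rightarrow> real" where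
  "theta1 x = (\<Sum>m. exp (- x * real (Suc m) ^ 2))"

text \<open>A one-dimensional partition function with energies measured from the ground state and
  the ground state left out, so it decays exponentially for large \<open>x\<close>.\<close>

definition theta_gap :: "real \<Rightarrow> real" where
  "theta_gap x = (\<Sum>m. exp (- x * (real (m + 2) ^ 2 - 1)))"

lemma gaussian_half_line:
  assumes "x > 0"
  shows "has_bochner_integral lborel (\<lambda>t. indicator {0..} t *\<^sub>R exp (- x * t\<^sup>2)) (sqrt pi / 2 / sqrt x)"
proof -
  have "has_bochner_integral lborel (\<lambda>t. indicator {0..} (0 + sqrt x * t) *\<^sub>R exp (- (0 + sqrt x * t)\<^sup>2)) ((sqrt pi / 2) /\<^sub>R \<bar>sqrt x\<bar>)"
    using gaussian_moment_0 assms by (subst lborel_has_bochner_integral_real_affine_iff[symmetric]) auto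
  moreover have "indicator {0..} (0 + sqrt x * t) *\<^sub>R exp (- (0 + sqrt x * t)\<^sup>2) = indicator {0..} t *\<^sub>R exp (- x * t\<^sup>2)" for t
    using assms by (auto simp: indicator_def power_mult_distrib zero_le_mult_iff)
  moreover have "(sqrt pi / 2) /\<^sub>R \<bar>sqrt x\<bar> = sqrt pi / 2 / sqrt x"
    using assms by (simp add: field_simps)
  ultimately show ?thesis by (simp only:)
qed

text \<open>Integral comparison for a decreasing function: the sum from \<open>m = 0\<close> exceeds
  the Gaussian integral by an amount between 0 and its first term 1, which \<open>theta1\<close>
  omits.\<close>

lemma theta1_bounds:
  assumes x: "x > 0"
  shows "summable (\<lambda>m. exp (- x * real (Suc m) ^ 2))"
    "theta1 x \<le> sqrt pi / 2 / sqrt x" "sqrt pi / 2 / sqrt x - 1 \<le> theta1 x"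
proof -
  let ?f = "\<lambda>t::real. exp (- x * t\<^sup>2)"
  interpret antimono_fun_sum_integral_diff ?f
  proof
    show "?f s \<ge> ?f t" if "0 \<le> s" "s \<le> t" for s t
      using that x by (auto intro!: mult_left_mono power_mono)
  qed (auto intro!: continuous_intros)
  have si: "set_integrable lborel {0..} ?f" and I: "set_lebesgue_integral lborel {0..} ?f = sqrt pi / 2 / sqrt x"
    using gaussian_half_line[OF x] unfolding set_integrable_def set_lebesgue_integral_def has_bochner_integral_iff by auto
  have sin: "set_integrable lborel {0..t} ?f" for t :: real
    by (rule set_integrable_subset[OF si]) auto
  have lim: "(\<lambda>n. integral {0..real n} ?f) \<longlonglongrightarrow> sqrt pi / 2 / sqrt x"
    using filterlim_compose[OF tendsto_set_lebesgue_integral_at_top[OF _ si] filterlim_real_sequentially]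
    unfolding I set_borel_integral_eq_integral(2)[OF sin] by auto
  have le: "integral {0..real n} ?f \<le> sqrt pi / 2 / sqrt x" for n
  proof -
    have "integral {0..real n} ?f \<le> integral {0..} ?f"
      using set_borel_integral_eq_integral(1)[OF si] set_borel_integral_eq_integral(1)[OF sin]
      by (intro integral_subset_le) auto
    then show ?thesis using I set_borel_integral_eq_integral(2)[OF si] by simp
  qed
  have sum_eq: "(\<Sum>m<n. ?f (real (Suc m))) = (\<Sum>k\<le>n. ?f (real k)) - 1" for n
    by (subst sum.atMost_shift) simp
  have up: "(\<Sum>m<n. ?f (real (Suc m))) \<le> integral {0..real n} ?f" for n
    using sum_integral_diff_series_antimono[of 0 n] unfolding sum_eq sum_integral_diff_series_def by simp
  have lo: "integral {0..real n} ?f - 1 \<le> (\<Sum>m<n. ?f (real (Suc m)))" for n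
    using sum_integral_diff_series_nonneg[of n] unfolding sum_eq sum_integral_diff_series_def by simp
  show summ: "summable (\<lambda>m. exp (- x * real (Suc m) ^ 2))"
    using up le by (intro summableI_nonneg_bounded[where x = "sqrt pi / 2 / sqrt x"]) (auto intro: order.trans)
  have slim: "(\<lambda>n. \<Sum>m<n. ?f (real (Suc m))) \<longlonglongrightarrow> theta1 x"
    unfolding theta1_def by (rule summable_LIMSEQ[OF summ])
  show "theta1 x \<le> sqrt pi / 2 / sqrt x"
    by (rule LIMSEQ_le[OF slim lim]) (use up in auto)
  show "sqrt pi / 2 / sqrt x - 1 \<le> theta1 x"
    by (rule LIMSEQ_le[OF tendsto_diff[OF lim tendsto_const[of 1]] slim]) (use lo in auto)
qed

lemma theta1_nonneg: "x > 0 \<Longrightarrow> theta1 x \<ge> 0"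
  unfolding theta1_def by (intro suminf_nonneg theta1_bounds(1)) auto

lemma theta1_asymp: "((\<lambda>x. sqrt x * theta1 x) \<longlongrightarrow> sqrt pi / 2) (at_right 0)"
proof (rule tendsto_sandwich)
  have "((\<lambda>x. sqrt pi / 2 - sqrt x) \<longlongrightarrow> sqrt pi / 2 - sqrt 0) (at_right 0)"
    by (intro tendsto_intros)
  then show "((\<lambda>x. sqrt pi / 2 - sqrt x) \<longlongrightarrow> sqrt pi / 2) (at_right 0)" by simp
  have ev: "eventually (\<lambda>x::real. x > 0) (at_right 0)" by (simp add: eventually_at_right_less)
  show "\<forall>\<^sub>F x in at_right 0. sqrt pi / 2 - sqrt x \<le> sqrt x * theta1 x"
    using ev
  proof eventually_elim
    case (elim x)
    have "sqrt x * (sqrt pi / 2 / sqrt x - 1) \<le> sqrt x * theta1 x"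
      using theta1_bounds(3)[OF elim] elim by (intro mult_left_mono) auto
    then show ?case using elim by (simp add: algebra_simps)
  qed
  show "\<forall>\<^sub>F x in at_right 0. sqrt x * theta1 x \<le> sqrt pi / 2"
    using ev
  proof eventually_elim
    case (elim x)
    have "sqrt x * theta1 x \<le> sqrt x * (sqrt pi / 2 / sqrt x)"
      using theta1_bounds(2)[OF elim] elim by (intro mult_left_mono) auto
    then show ?case using elim by simp
  qed
qed auto

lemma theta_gap_eq:
  assumes x: "x > 0"
  shows "summable (\<lambda>m. exp (- x * (real (m + 2) ^ 2 - 1)))" "theta_gap x = exp x * theta1 x - 1"
proof -
  note s = theta1_bounds(1)[OF x]
  have eq: "exp (- x * (real (m + 2) ^ 2 - 1)) = exp x * exp (- x * real (Suc (Suc m)) ^ 2)" for m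
    by (simp add: algebra_simps flip: exp_add)
  have s': "summable (\<lambda>m. exp (- x * real (Suc (Suc m)) ^ 2))"
    using s by (subst (asm) summable_Suc_iff[symmetric]) 
  show "summable (\<lambda>m. exp (- x * (real (m + 2) ^ 2 - 1)))"
    unfolding eq by (intro summable_mult s')
  have "theta1 x = exp (- x) + (\<Sum>m. exp (- x * real (Suc (Suc m)) ^ 2))"
    unfolding theta1_def using suminf_split_head[OF s] by simp
  moreover have "theta_gap x = exp x * (\<Sum>m. exp (- x * real (Suc (Suc m)) ^ 2))"
    unfolding theta_gap_def eq by (rule suminf_mult[OF s'])
  ultimately show "theta_gap x = exp x * theta1 x - 1"
    by (simp add: algebra_simps flip: exp_add)
qed

lemma theta_gap_nonneg: "x > 0 \<Longrightarrow> theta_gap x \<ge> 0"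
  unfolding theta_gap_def by (intro suminf_nonneg theta_gap_eq(1)) auto

lemma theta_gap_le:
  assumes x: "x > 0"
  shows "theta_gap x \<le> sqrt pi / 2 / sqrt x"
proof -
  have "theta_gap x \<le> theta1 x"
    unfolding theta_gap_def theta1_def
  proof (rule suminf_le[OF _ theta_gap_eq(1)[OF x] theta1_bounds(1)[OF x]])
    fix m
    have "real (Suc m) ^ 2 \<le> real (m + 2) ^ 2 - 1" by (simp add: power2_eq_square algebra_simps)
    then show "exp (- x * (real (m + 2) ^ 2 - 1)) \<le> exp (- x * real (Suc m) ^ 2)" using x by simp
  qed
  then show ?thesis using theta1_bounds(2)[OF x] by simp
qed

text \<open>Summing \<open>exp (- y) \<le> p powr p * y powr (- p)\<close> over the levels; the
  resulting series converges for \<open>2 * p > 1\<close>. The decay beyond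
  \<open>x powr (- 1/2)\<close> is what later makes the sum over \<open>k\<close> converge.\<close>

lemma theta_gap_le_powr:
  assumes p: "p > 1 / 2"
  obtains C where "C \<ge> 0" "\<And>x. x > 0 \<Longrightarrow> theta_gap x \<le> C * x powr (- p)"
proof -
  define b where "b m = (real (m + 2) ^ 2 - 1) powr (- p)" for m
  have "summable (\<lambda>m. real m powr (- (2 * p)))" using p by (simp add: summable_real_powr_iff)
  then have sm: "summable (\<lambda>m. norm (real m powr (- (2 * p))))" by simp
  have "b \<in> O(\<lambda>m. real m powr (- (2 * p)))" unfolding b_def[abs_def] using p by real_asymp
  then have sb: "summable b" by (rule summable_comparison_test_bigo[OF sm])
  define C where "C = p powr p * (\<Sum>m. b m)"
  have "C \<ge> 0" unfolding C_def b_def using sb by (intro mult_nonneg_nonneg suminf_nonneg) (auto simp: b_def[abs_def])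
  moreover have "theta_gap x \<le> C * x powr (- p)" if x: "x > 0" for x
  proof -
    have e: "exp (- y) \<le> p powr p * y powr (- p)" if "y > 0" for y :: real
    proof -
      have "y / p \<le> exp (y / p)" using exp_ge_add_one_self[of "y / p"] by linarith
      then have "(y / p) powr p \<le> exp (y / p) powr p" using p that by (intro powr_mono2) auto
      also have "\<dots> = exp y" using p by (simp add: powr_def)
      finally have "y powr p / p powr p \<le> exp y" using p that by (simp add: powr_divide)
      then have "inverse (exp y) \<le> inverse (y powr p / p powr p)" using p that by (intro le_imp_inverse_le) auto
      then show ?thesis by (simp add: exp_minus powr_minus field_simps)
    qed
    have "theta_gap x \<le> (\<Sum>m. (p powr p * x powr (- p)) * b m)"
      unfolding theta_gap_def
    proof (rule suminf_le[OF _ theta_gap_eq(1)[OF x] summable_mult[OF sb]])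
      fix m
      have pos: "real (m + 2) ^ 2 - 1 > 0" by (simp add: power2_eq_square algebra_simps add_pos_nonneg)
      then have "exp (- (x * (real (m + 2) ^ 2 - 1))) \<le> p powr p * (x * (real (m + 2) ^ 2 - 1)) powr (- p)"
        using x by (intro e) auto
      then show "exp (- x * (real (m + 2) ^ 2 - 1)) \<le> (p powr p * x powr (- p)) * b m"
        using x pos by (simp add: b_def powr_mult)
    qed
    also have "\<dots> = C * x powr (- p)" by (subst suminf_mult[OF sb]) (simp add: C_def mult_ac)
    finally show ?thesis .
  qed
  ultimately show thesis by (rule that)
qed

lemma theta_gap_asymp: "((\<lambda>x. sqrt x * theta_gap x) \<longlongrightarrow> sqrt pi / 2) (at_right 0)"
proof -
  have "((\<lambda>x. exp x * (sqrt x * theta1 x) - sqrt x) \<longlongrightarrow> exp 0 * (sqrt pi / 2) - sqrt 0) (at_right 0)"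
    by (intro tendsto_intros theta1_asymp)
  moreover have "eventually (\<lambda>x. exp x * (sqrt x * theta1 x) - sqrt x = sqrt x * theta_gap x) (at_right 0)"
  proof -
    have "eventually (\<lambda>x::real. x > 0) (at_right 0)" by (simp add: eventually_at_right_less)
    then show ?thesis by eventually_elim (simp add: theta_gap_eq(2) algebra_simps)
  qed
  ultimately show ?thesis by (auto intro: Lim_transform_eventually)
qed

lemma theta_scaled_limits:
  assumes c: "c > 0" and a: "a > 0"
  shows "((\<lambda>V. V powr (- a) * theta1 (c * V powr (- 2 * a))) \<longlongrightarrow> sqrt pi / 2 / sqrt c) at_top"
    "((\<lambda>V. V powr (- a) * theta_gap (c * V powr (- 2 * a))) \<longlongrightarrow> sqrt pi / 2 / sqrt c) at_top"
proof -
  have "filterlim (\<lambda>V. c * V powr (- 2 * a)) (at_right 0) at_top"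
    using c a by real_asymp
  note flim = this
  have sq: "sqrt (c * V powr (- 2 * a)) = sqrt c * V powr (- a)" if "V > 0" for V
    using that by (simp add: real_sqrt_mult powr_half_sqrt[symmetric] powr_powr)
  have "((\<lambda>V. sqrt (c * V powr (- 2 * a)) * theta1 (c * V powr (- 2 * a)) / sqrt c) \<longlongrightarrow> sqrt pi / 2 / sqrt c) at_top"
    using c by (intro tendsto_divide filterlim_compose[OF theta1_asymp flim]) auto
  moreover have "eventually (\<lambda>V. sqrt (c * V powr (- 2 * a)) * theta1 (c * V powr (- 2 * a)) / sqrt c
      = V powr (- a) * theta1 (c * V powr (- 2 * a))) at_top"
    using eventually_gt_at_top[of 0] by eventually_elim (use c in \<open>simp only: sq, simp\<close>)
  ultimately show "((\<lambda>V. V powr (- a) * theta1 (c * V powr (- 2 * a))) \<longlongrightarrow> sqrt pi / 2 / sqrt c) at_top"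
    by (rule Lim_transform_eventually)
  have "((\<lambda>V. sqrt (c * V powr (- 2 * a)) * theta_gap (c * V powr (- 2 * a)) / sqrt c) \<longlongrightarrow> sqrt pi / 2 / sqrt c) at_top"
    using c by (intro tendsto_divide filterlim_compose[OF theta_gap_asymp flim]) auto
  moreover have "eventually (\<lambda>V. sqrt (c * V powr (- 2 * a)) * theta_gap (c * V powr (- 2 * a)) / sqrt c
      = V powr (- a) * theta_gap (c * V powr (- 2 * a))) at_top"
    using eventually_gt_at_top[of 0] by eventually_elim (use c in \<open>simp only: sq, simp\<close>)
  ultimately show "((\<lambda>V. V powr (- a) * theta_gap (c * V powr (- 2 * a))) \<longlongrightarrow> sqrt pi / 2 / sqrt c) at_top"
    by (rule Lim_transform_eventually)
qed

subsection \<open>Excited transverse modes\<close>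

lemma has_sum_Times_nonneg:
  fixes f :: "'a \<Rightarrow> real" and g :: "'b \<Rightarrow> real"
  assumes f: "(f has_sum a) A" "\<And>x. x \<in> A \<Longrightarrow> f x \<ge> 0" and g: "(g has_sum b) B" "\<And>y. y \<in> B \<Longrightarrow> g y \<ge> 0"
  shows "((\<lambda>(x, y). f x * g y) has_sum (a * b)) (A \<times> B)"
proof (rule has_sum_SigmaI)
  show outer: "((\<lambda>x. f x * b) has_sum a * b) A" by (rule has_sum_cmult_left[OF f(1)])
  show inner: "((\<lambda>y. (\<lambda>(x, y). f x * g y) (x, y)) has_sum f x * b) B" for x
    using has_sum_cmult_right[OF g(1), of "f x"] by simp
  show "(\<lambda>(x, y). f x * g y) summable_on A \<times> B"
    by (rule summable_on_SigmaI[where g = "\<lambda>x. f x * b"])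
       (use inner outer f g in \<open>auto dest: has_sum_imp_summable\<close>)
qed

text \<open>\<open>\<beta>\<close> times the one-particle energy without the transverse ground state energy. The exponent
  \<open>-2 * (1/2)\<close> is kept in this shape so that all three directions have the same form.\<close>

definition gap_energy :: "real \<Rightarrow> real \<Rightarrow> real \<Rightarrow> real \<Rightarrow> nat \<times> nat \<times> nat \<Rightarrow> real" where
  "gap_energy \<kappa> a2 a3 V q = (case q of (n1, n2, n3) \<Rightarrow>
     \<kappa> * (real n1 ^ 2 * V powr (-2 * (1/2)) + (real n2 ^ 2 - 1) * V powr (-2 * a2) + (real n3 ^ 2 - 1) * V powr (-2 * a3)))"

definition excited :: "(nat \<times> nat \<times> nat) set" where
  "excited = {1..} \<times> ({1..} \<times> {1..} - {(1, 1)})"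

definition occ :: "real \<Rightarrow> real" where
  "occ x = 1 / (exp x - 1)"

text \<open>The sum of \<open>exp (- k * gap_energy)\<close> over the excited modes; expanding \<open>occ\<close> as a geometric series
  reduces the density of excited particles to these.\<close>

definition box_sum :: "real \<Rightarrow> real \<Rightarrow> real \<Rightarrow> real \<Rightarrow> real \<Rightarrow> real" where
  "box_sum \<kappa> a2 a3 V k = theta1 (k * \<kappa> * V powr (-2 * (1/2))) *
     ((1 + theta_gap (k * \<kappa> * V powr (-2 * a2))) * (1 + theta_gap (k * \<kappa> * V powr (-2 * a3))) - 1)"

lemma theta1_has_sum:
  assumes "x > 0"
  shows "((\<lambda>m. exp (- x * real m ^ 2)) has_sum theta1 x) {1..}"
proof -
  have "((\<lambda>m. exp (- x * real (Suc m) ^ 2)) has_sum theta1 x) UNIV"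
    unfolding theta1_def by (intro sums_nonneg_imp_has_sum summable_sums theta1_bounds(1) assms) auto
  moreover have "bij_betw Suc UNIV {1..}"
    by (rule bij_betw_byWitness[where f' = "\<lambda>m. m - 1"]) auto
  ultimately show ?thesis
    using has_sum_reindex_bij_betw[of Suc UNIV "{1..}" "\<lambda>m. exp (- x * real m ^ 2)"] by blast
qed

lemma theta_gap_has_sum:
  assumes "x > 0"
  shows "((\<lambda>m. exp (- x * (real m ^ 2 - 1))) has_sum (1 + theta_gap x)) {1..}"
proof -
  have "((\<lambda>m. exp x * exp (- x * real m ^ 2)) has_sum (exp x * theta1 x)) {1..}"
    by (intro has_sum_cmult_right theta1_has_sum assms)
  then show ?thesis
    by (simp add: theta_gap_eq(2)[OF assms] algebra_simps flip: exp_add)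
qed

lemma box_sum_has_sum:
  assumes "\<kappa> > 0" "k > 0" "V > 0"
  shows "((\<lambda>q. exp (- k * gap_energy \<kappa> a2 a3 V q)) has_sum box_sum \<kappa> a2 a3 V k) excited"
proof -
  let ?x1 = "k * \<kappa> * V powr (-2 * (1/2))" and ?x2 = "k * \<kappa> * V powr (-2 * a2)" and ?x3 = "k * \<kappa> * V powr (-2 * a3)"
  have pos: "?x1 > 0" "?x2 > 0" "?x3 > 0" using assms by auto
  let ?g = "\<lambda>(n2, n3). exp (- ?x2 * (real n2 ^ 2 - 1)) * exp (- ?x3 * (real n3 ^ 2 - 1))"
  have "(?g has_sum ((1 + theta_gap ?x2) * (1 + theta_gap ?x3))) ({1..} \<times> {1..})"
    using pos by (intro has_sum_Times_nonneg theta_gap_has_sum) auto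
  moreover have "(?g has_sum 1) {(1, 1)}" by (rule has_sum_finiteI) auto
  ultimately have g: "(?g has_sum ((1 + theta_gap ?x2) * (1 + theta_gap ?x3) - 1)) ({1..} \<times> {1..} - {(1, 1)})"
    by (rule has_sum_Diff) auto
  have "((\<lambda>(n1, r). exp (- ?x1 * real n1 ^ 2) * ?g r) has_sum box_sum \<kappa> a2 a3 V k) excited"
    unfolding box_sum_def excited_def
    by (rule has_sum_Times_nonneg[OF theta1_has_sum[OF pos(1)] _ g]) auto
  then show ?thesis
    by (rule has_sum_cong[THEN iffD1, rotated])
       (auto simp: gap_energy_def algebra_simps simp flip: exp_add)
qed

text \<open>The 3 is \<open>2^2 - 1\<close>, the lowest transverse excitation, and direction 2 has
  the smaller spacing since \<open>a3 \<le> a2\<close> and \<open>V \<ge> 1\<close>.\<close>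

lemma gap_energy_excited_ge:
  assumes "\<kappa> > 0" "V \<ge> 1" "a3 \<le> a2" "q \<in> excited"
  shows "3 * \<kappa> * V powr (- 2 * a2) \<le> gap_energy \<kappa> a2 a3 V q"
proof -
  obtain n1 n2 n3 where q: "q = (n1, n2, n3)" by (cases q)
  have n: "n1 \<ge> 1" "n2 \<ge> 1" "n3 \<ge> 1" "n2 \<ge> 2 \<or> n3 \<ge> 2" using assms(4) by (auto simp: q excited_def)
  have sq: "real m ^ 2 - 1 \<ge> 0" if "m \<ge> 1" for m using that by simp
  have sq3: "real m ^ 2 - 1 \<ge> 3" if "m \<ge> 2" for m
  proof -
    have "2 ^ 2 \<le> real m ^ 2" using that by (intro power_mono) auto
    then show ?thesis by simp
  qed
  have V: "V powr (- 2 * a2) \<le> V powr (- 2 * a3)" using assms by (intro powr_mono) auto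
  have "3 * V powr (- 2 * a2) \<le> (real n2 ^ 2 - 1) * V powr (- 2 * a2) + (real n3 ^ 2 - 1) * V powr (- 2 * a3)"
  proof (cases "n2 \<ge> 2")
    case True
    then have "3 * V powr (- 2 * a2) \<le> (real n2 ^ 2 - 1) * V powr (- 2 * a2)" by (intro mult_right_mono sq3) auto
    moreover have "0 \<le> (real n3 ^ 2 - 1) * V powr (- 2 * a3)" using sq[OF n(3)] by simp
    ultimately show ?thesis by linarith
  next
    case False
    then have "3 * V powr (- 2 * a2) \<le> (real n3 ^ 2 - 1) * V powr (- 2 * a3)" using n V sq3[of n3] by (intro mult_mono) auto
    moreover have "0 \<le> (real n2 ^ 2 - 1) * V powr (- 2 * a2)" using sq[OF n(2)] by simp
    ultimately show ?thesis by linarith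
  qed
  moreover have "0 \<le> real n1 ^ 2 * V powr (-2 * (1/2))" by simp
  ultimately have "3 * V powr (- 2 * a2) \<le> real n1 ^ 2 * V powr (-2 * (1/2)) + (real n2 ^ 2 - 1) * V powr (- 2 * a2) + (real n3 ^ 2 - 1) * V powr (- 2 * a3)"
    by linarith
  then have "\<kappa> * (3 * V powr (- 2 * a2)) \<le> gap_energy \<kappa> a2 a3 V q"
    unfolding gap_energy_def q prod.case using assms(1) by (intro mult_left_mono) auto
  then show ?thesis by (simp add: mult_ac)
qed

lemma occ_bounds:
  assumes "x > 0"
  shows "0 < occ x" "occ x \<le> 1 / x"
proof -
  have "x \<le> exp x - 1" using exp_ge_add_one_self[of x] by linarith
  then show "0 < occ x" "occ x \<le> 1 / x" using assms by (auto simp: occ_def intro!: divide_left_mono mult_pos_pos)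
qed

lemma occ_has_sum:
  assumes "x > 0"
  shows "((\<lambda>k. exp (- real (Suc k) * x)) has_sum occ x) UNIV"
proof -
  have "(\<lambda>k. exp (- x) * exp (- x) ^ k) sums (exp (- x) * (1 / (1 - exp (- x))))"
    using assms by (intro sums_mult geometric_sums) auto
  also have "exp (- x) * (1 / (1 - exp (- x))) = occ x"
    using assms by (simp add: occ_def exp_minus field_simps)
  also have "(\<lambda>k. exp (- x) * exp (- x) ^ k) = (\<lambda>k. exp (- real (Suc k) * x))"
    by (simp add: fun_eq_iff algebra_simps flip: exp_of_nat_mult exp_add)
  finally show ?thesis by (intro sums_nonneg_imp_has_sum) auto
qed

section \<open>The density of particles in excited modes and its concentration\<close>

locale slab_box =
  fixes \<kappa> a2 a3 :: real
  assumes \<kappa>: "\<kappa> > 0" and a: "a3 > 0" "a3 \<le> a2" "a2 + a3 = 1 / 2"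
begin

lemma a2_bounds: "a2 > 0" "a2 < 1 / 2" using a by auto
lemma a3_less: "a3 < 1 / 2" using a by auto

text \<open>The share of the excited density that stems from the term
  \<open>exp (- (k + 1) * x)\<close> of \<open>occ x\<close>.\<close>

definition box_term :: "nat \<Rightarrow> real \<Rightarrow> real" where
  "box_term k V = box_sum \<kappa> a2 a3 V (real (Suc k)) / V"

text \<open>Distributes \<open>1 / V\<close> over the three directions so that every theta sum gets
  the power of \<open>V\<close> under which it converges. The terms with a single excited transverse
  direction keep the vanishing factors \<open>V powr (a2 - 1/2)\<close> and
  \<open>V powr (a3 - 1/2)\<close>.\<close>

lemma box_term_eq:
  assumes "V > 0"
  shows "box_term k V =
    (V powr (- (1/2)) * theta1 (real (Suc k) * \<kappa> * V powr (-2 * (1/2)))) *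
    (V powr (a2 - 1/2) * (V powr (- a2) * theta_gap (real (Suc k) * \<kappa> * V powr (-2 * a2)))
     + V powr (a3 - 1/2) * (V powr (- a3) * theta_gap (real (Suc k) * \<kappa> * V powr (-2 * a3)))
     + (V powr (- a2) * theta_gap (real (Suc k) * \<kappa> * V powr (-2 * a2))) *
       (V powr (- a3) * theta_gap (real (Suc k) * \<kappa> * V powr (-2 * a3))))"
proof -
  have V: "1 / V = V powr (- (1/2)) * V powr (- (1/2))" using assms by (simp add: powr_minus_divide flip: powr_add)
  have 1: "V powr (a2 - 1/2) * V powr (- a2) = V powr (- (1/2))" "V powr (a3 - 1/2) * V powr (- a3) = V powr (- (1/2))"
    by (auto simp flip: powr_add)
  have "- a2 + - a3 = - (1/2)" using a by simp
  then have 2: "V powr (- a2) * V powr (- a3) = V powr (- (1/2))" by (simp only: flip: powr_add)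
  have e: "V powr (a2 - 1/2) * (V powr (- a2) * X) = V powr (- (1/2)) * X"
    "V powr (a3 - 1/2) * (V powr (- a3) * X) = V powr (- (1/2)) * X"
    "(V powr (- a2) * X) * (V powr (- a3) * Y) = V powr (- (1/2)) * X * Y" for X Y
  proof -
    show "V powr (a2 - 1/2) * (V powr (- a2) * X) = V powr (- (1/2)) * X" by (simp only: 1(1) flip: mult.assoc)
    show "V powr (a3 - 1/2) * (V powr (- a3) * X) = V powr (- (1/2)) * X" by (simp only: 1(2) flip: mult.assoc)
    show "(V powr (- a2) * X) * (V powr (- a3) * Y) = V powr (- (1/2)) * X * Y" by (simp only: 2[symmetric] mult_ac)
  qed
  have "box_term k V = (1 / V) * box_sum \<kappa> a2 a3 V (real (Suc k))" by (simp add: box_term_def)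
  also have "\<dots> = (V powr (- (1/2)) * theta1 (real (Suc k) * \<kappa> * V powr (-2 * (1/2)))) *
    (V powr (- (1/2)) * theta_gap (real (Suc k) * \<kappa> * V powr (-2 * a2))
     + V powr (- (1/2)) * theta_gap (real (Suc k) * \<kappa> * V powr (-2 * a3))
     + V powr (- (1/2)) * theta_gap (real (Suc k) * \<kappa> * V powr (-2 * a2)) * theta_gap (real (Suc k) * \<kappa> * V powr (-2 * a3)))"
    unfolding V box_sum_def by (simp only: algebra_simps)
  finally show ?thesis unfolding e .
qed

definition box_limit :: "nat \<Rightarrow> real" where
  "box_limit k = (sqrt pi / 2 / sqrt (real (Suc k) * \<kappa>)) ^ 3"

lemma box_term_tendsto: "((\<lambda>V. box_term k V) \<longlongrightarrow> box_limit k) at_top"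
proof -
  define c where "c = real (Suc k) * \<kappa>"
  have c: "c > 0" using \<kappa> by (simp add: c_def)
  let ?l = "sqrt pi / 2 / sqrt c"
  have z: "((\<lambda>V::real. V powr (a2 - 1/2)) \<longlongrightarrow> 0) at_top" "((\<lambda>V::real. V powr (a3 - 1/2)) \<longlongrightarrow> 0) at_top"
    using a2_bounds a3_less by real_asymp+
  have "((\<lambda>V. (V powr (- (1/2)) * theta1 (c * V powr (-2 * (1/2)))) *
    (V powr (a2 - 1/2) * (V powr (- a2) * theta_gap (c * V powr (-2 * a2)))
     + V powr (a3 - 1/2) * (V powr (- a3) * theta_gap (c * V powr (-2 * a3)))
     + (V powr (- a2) * theta_gap (c * V powr (-2 * a2))) * (V powr (- a3) * theta_gap (c * V powr (-2 * a3)))))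
    \<longlongrightarrow> ?l * (0 * ?l + 0 * ?l + ?l * ?l)) at_top"
    using c a a2_bounds by (intro tendsto_mult tendsto_add z theta_scaled_limits) auto
  also have "?l * (0 * ?l + 0 * ?l + ?l * ?l) = box_limit k" by (simp add: box_limit_def c_def power3_eq_cube mult_ac)
  finally show ?thesis
  proof (rule Lim_transform_eventually)
    show "\<forall>\<^sub>F V in at_top. (V powr (- (1/2)) * theta1 (c * V powr (-2 * (1/2)))) *
    (V powr (a2 - 1/2) * (V powr (- a2) * theta_gap (c * V powr (-2 * a2)))
     + V powr (a3 - 1/2) * (V powr (- a3) * theta_gap (c * V powr (-2 * a3)))
     + (V powr (- a2) * theta_gap (c * V powr (-2 * a2))) * (V powr (- a3) * theta_gap (c * V powr (-2 * a3)))) = box_term k V"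
      using eventually_gt_at_top[of 0] by eventually_elim (simp only: box_term_eq c_def)
  qed
qed

text \<open>Domination, uniform in \<open>V\<close>, of a term with one excited transverse
  direction. The decay in \<open>c\<close> must beat \<open>c powr (- 1/2)\<close>: the first
  direction supplies only another \<open>c powr (- 1/2)\<close>, and \<open>c\<close> runs through
  the multiples of \<kappa>.\<close>

lemma theta_gap_scaled_bound:
  assumes a: "0 < b" "b < 1 / 2"
  obtains C p where "C \<ge> 0" "p > 1 / 2"
    "\<And>c V. c > 0 \<Longrightarrow> V \<ge> 1 \<Longrightarrow> V powr (b - 1/2) * (V powr (- b) * theta_gap (c * V powr (-2 * b))) \<le> C * c powr (- p)"
proof -
  \<comment> \<open>the exponent for which the powers of \<open>V\<close> cancel\<close>
  define p where "p = 1 / (4 * b)"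
  have p: "p > 1 / 2" using a by (simp add: p_def field_simps)
  obtain C where C: "C \<ge> 0" "\<And>x. x > 0 \<Longrightarrow> theta_gap x \<le> C * x powr (- p)" using theta_gap_le_powr[OF p] by blast
  have "V powr (b - 1/2) * (V powr (- b) * theta_gap (c * V powr (-2 * b))) \<le> C * c powr (- p)"
    if cV: "c > 0" "V \<ge> 1" for c V
  proof -
    have "V powr (b - 1/2) * (V powr (- b) * theta_gap (c * V powr (-2 * b))) = V powr (- 1/2) * theta_gap (c * V powr (-2 * b))"
      by (simp flip: powr_add mult.assoc)
    also have "\<dots> \<le> V powr (- 1/2) * (C * (c * V powr (-2 * b)) powr (- p))"
      using cV by (intro mult_left_mono C) auto
    also have "(c * V powr (-2 * b)) powr (- p) = c powr (- p) * V powr (1/2)"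
      using cV a by (simp add: powr_mult powr_powr p_def)
    also have "V powr (- 1/2) * (C * (c powr (- p) * V powr (1/2))) = C * c powr (- p) * (V powr (- 1/2) * V powr (1/2))"
      by (simp only: mult_ac)
    also have "V powr (- 1/2) * V powr (1/2) = 1" using cV by (simp flip: powr_add)
    finally show ?thesis by simp
  qed
  with C(1) p show thesis by (rule that)
qed

lemma theta_gap_scaled_half:
  assumes "c > 0" "V > 0"
  shows "V powr (- b) * theta_gap (c * V powr (-2 * b)) \<le> sqrt pi / 2 / sqrt c"
    "V powr (- b) * theta1 (c * V powr (-2 * b)) \<le> sqrt pi / 2 / sqrt c"
proof -
  have x: "c * V powr (-2 * b) > 0" using assms by simp
  have sq: "sqrt (c * V powr (- 2 * b)) = sqrt c * V powr (- b)"
    using assms by (simp add: real_sqrt_mult powr_half_sqrt[symmetric] powr_powr)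
  have eq: "V powr (- b) * (sqrt pi / 2 / sqrt (c * V powr (-2 * b))) = sqrt pi / 2 / sqrt c"
    unfolding sq using assms by simp
  show "V powr (- b) * theta_gap (c * V powr (-2 * b)) \<le> sqrt pi / 2 / sqrt c"
    unfolding eq[symmetric] by (intro mult_left_mono theta_gap_le x) auto
  show "V powr (- b) * theta1 (c * V powr (-2 * b)) \<le> sqrt pi / 2 / sqrt c"
    unfolding eq[symmetric] by (intro mult_left_mono theta1_bounds(2) x) auto
qed

text \<open>The three parts of the majorant decay in \<open>k\<close> with the exponents
  \<open>- p2 - 1/2\<close>, \<open>- p3 - 1/2\<close> and \<open>- 3/2\<close>, all below
  -1.\<close>

lemma box_term_bound:
  obtains B where "summable B" "\<And>k V. V \<ge> 1 \<Longrightarrow> 0 \<le> box_term k V \<and> box_term k V \<le> B k"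
proof -
  obtain C2 p2 where 2: "C2 \<ge> 0" "p2 > 1 / 2"
    "\<And>c V. c > 0 \<Longrightarrow> V \<ge> 1 \<Longrightarrow> V powr (a2 - 1/2) * (V powr (- a2) * theta_gap (c * V powr (-2 * a2))) \<le> C2 * c powr (- p2)"
    using theta_gap_scaled_bound[OF a2_bounds] by blast
  obtain C3 p3 where 3: "C3 \<ge> 0" "p3 > 1 / 2"
    "\<And>c V. c > 0 \<Longrightarrow> V \<ge> 1 \<Longrightarrow> V powr (a3 - 1/2) * (V powr (- a3) * theta_gap (c * V powr (-2 * a3))) \<le> C3 * c powr (- p3)"
    using theta_gap_scaled_bound[OF a(1) a3_less] by blast
  define g where "g x = sqrt pi / 2 / sqrt x" for x
  define B where "B k = g (real (Suc k) * \<kappa>) * (C2 * (real (Suc k) * \<kappa>) powr (- p2) + C3 * (real (Suc k) * \<kappa>) powr (- p3)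
      + g (real (Suc k) * \<kappa>) * g (real (Suc k) * \<kappa>))" for k
  have sp: "summable (\<lambda>k. g (real (Suc k) * \<kappa>) * (C * (real (Suc k) * \<kappa>) powr (- p)))" if "p > 1/2" for C p
  proof -
    have "summable (\<lambda>k. real k powr (- (p + 1/2)))" using that by (simp add: summable_real_powr_iff)
    then have "summable (\<lambda>k. real (Suc k) powr (- (p + 1/2)))" by (subst summable_Suc_iff)
    then have "summable (\<lambda>k. (sqrt pi / 2 * \<kappa> powr (- (p + 1/2)) * C) * real (Suc k) powr (- (p + 1/2)))" by (rule summable_mult)
    moreover have "(sqrt pi / 2 * \<kappa> powr (- (p + 1/2)) * C) * real (Suc k) powr (- (p + 1/2)) =
       g (real (Suc k) * \<kappa>) * (C * (real (Suc k) * \<kappa>) powr (- p))" for k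
    proof -
      define c where "c = real (Suc k) * \<kappa>"
      have c: "c > 0" using \<kappa> by (simp add: c_def)
      have "g c * (C * c powr (- p)) = sqrt pi / 2 * C * (c powr (- (1/2)) * c powr (- p))"
        using c by (simp add: g_def powr_minus_divide powr_half_sqrt)
      also have "c powr (- (1/2)) * c powr (- p) = c powr (- (p + 1/2))" by (simp flip: powr_add add: algebra_simps)
      also have "\<dots> = real (Suc k) powr (- (p + 1/2)) * \<kappa> powr (- (p + 1/2))"
        unfolding c_def using \<kappa> by (simp add: powr_mult)
      finally show ?thesis by (simp only: c_def mult_ac)
    qed
    ultimately show ?thesis by (simp only:)
  qed
  have gg: "g c * g c = (pi / 4) * c powr (- 1)" if "c > 0" for c
    using that by (simp add: g_def powr_minus_divide field_simps)
  have "summable (\<lambda>k. g (real (Suc k) * \<kappa>) * (C2 * (real (Suc k) * \<kappa>) powr (- p2)) + g (real (Suc k) * \<kappa>) * (C3 * (real (Suc k) * \<kappa>) powr (- p3))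
     + g (real (Suc k) * \<kappa>) * ((pi / 4) * (real (Suc k) * \<kappa>) powr (- 1)))"
    using 2 3 by (intro summable_add sp) auto
  moreover have "B = (\<lambda>k. g (real (Suc k) * \<kappa>) * (C2 * (real (Suc k) * \<kappa>) powr (- p2)) + g (real (Suc k) * \<kappa>) * (C3 * (real (Suc k) * \<kappa>) powr (- p3))
     + g (real (Suc k) * \<kappa>) * ((pi / 4) * (real (Suc k) * \<kappa>) powr (- 1)))"
    unfolding B_def[abs_def] using \<kappa> by (simp only: gg[symmetric] mult_pos_pos of_nat_0_less_iff zero_less_Suc distrib_left mult.assoc)
  ultimately have "summable B" by simp
  moreover have "0 \<le> box_term k V \<and> box_term k V \<le> B k" if V: "V \<ge> 1" for k V
  proof -
    define c where "c = real (Suc k) * \<kappa>"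
    have c: "c > 0" using \<kappa> by (simp add: c_def)
    have V0: "V > 0" using V by simp
    have nn: "theta1 (c * V powr (-2 * (1/2))) \<ge> 0" "theta_gap (c * V powr (-2 * a2)) \<ge> 0" "theta_gap (c * V powr (-2 * a3)) \<ge> 0"
      using c V0 by (auto intro!: theta1_nonneg theta_gap_nonneg)
    have "0 \<le> box_term k V" unfolding box_term_eq[OF V0] c_def[symmetric] using nn by simp
    moreover have "box_term k V \<le> B k"
    proof -
      have g0: "g c \<ge> 0" using c by (simp add: g_def)
      have h: "V powr (- b) * theta_gap (c * V powr (-2 * b)) \<le> g c" "V powr (- b) * theta1 (c * V powr (-2 * b)) \<le> g c" for b
        unfolding g_def by (rule theta_gap_scaled_half[OF c V0])+
      have X: "0 \<le> V powr (- a2) * theta_gap (c * V powr (-2 * a2))" "0 \<le> V powr (- a3) * theta_gap (c * V powr (-2 * a3))"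
        by (rule mult_nonneg_nonneg[OF powr_ge_zero nn(2)], rule mult_nonneg_nonneg[OF powr_ge_zero nn(3)])
      show ?thesis
        unfolding box_term_eq[OF V0] B_def c_def[symmetric]
        by (rule mult_mono[OF h(2) add_mono[OF add_mono[OF 2(3)[OF c V] 3(3)[OF c V]] mult_mono[OF h(1) h(1) g0 X(2)]] g0])
           (intro add_nonneg_nonneg mult_nonneg_nonneg[OF powr_ge_zero] mult_nonneg_nonneg[OF X(1) X(2)] X)
    qed
    ultimately show ?thesis ..
  qed
  ultimately show thesis by (rule that)
qed

lemma gap_energy_excited_pos: "V \<ge> 1 \<Longrightarrow> q \<in> excited \<Longrightarrow> gap_energy \<kappa> a2 a3 V q > 0"
  using gap_energy_excited_ge[OF \<kappa>, of V a3 a2 q] a \<kappa> by (auto intro: less_le_trans[rotated])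

lemma occ_excited_has_sum:
  assumes V: "V \<ge> 1"
  shows "((\<lambda>q. occ (gap_energy \<kappa> a2 a3 V q)) has_sum (V * (\<Sum>k. box_term k V))) excited"
proof -
  obtain B where B: "summable B" "\<And>k V. V \<ge> 1 \<Longrightarrow> 0 \<le> box_term k V \<and> box_term k V \<le> B k"
    using box_term_bound by blast
  have V0: "V > 0" using V by simp
  have bt: "summable (\<lambda>k. box_term k V)"
    by (rule summable_comparison_test[OF _ B(1)]) (use B(2)[OF V] in auto)
  have "(\<lambda>k. V * box_term k V) sums (V * (\<Sum>k. box_term k V))"
    by (intro sums_mult summable_sums bt)
  then have outer: "((\<lambda>k. V * box_term k V) has_sum (V * (\<Sum>k. box_term k V))) UNIV"
    using B(2)[OF V] V0 by (intro sums_nonneg_imp_has_sum) auto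
  let ?f = "\<lambda>(k, q). exp (- real (Suc k) * gap_energy \<kappa> a2 a3 V q)"
  have inner: "((\<lambda>q. ?f (k, q)) has_sum (V * box_term k V)) excited" for k
    using box_sum_has_sum[OF \<kappa>, of "real (Suc k)" V a2 a3] V0 by (simp add: box_term_def)
  have "(?f has_sum (V * (\<Sum>k. box_term k V))) (UNIV \<times> excited)"
  proof (rule has_sum_SigmaI[OF inner outer])
    show "?f summable_on UNIV \<times> excited"
      by (rule summable_on_SigmaI[OF inner]) (use outer in \<open>auto dest: has_sum_imp_summable\<close>)
  qed
  then have "((\<lambda>(q, k). ?f (k, q)) has_sum (V * (\<Sum>k. box_term k V))) (excited \<times> UNIV)"
    by (rule has_sum_swap[THEN iffD1])
  then show ?thesis
  proof (rule has_sum_SigmaD)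
    fix q assume "q \<in> excited"
    from occ_has_sum[OF gap_energy_excited_pos[OF V this]]
    show "((\<lambda>k. (\<lambda>(q, k). ?f (k, q)) (q, k)) has_sum occ (gap_energy \<kappa> a2 a3 V q)) UNIV" by simp
  qed
qed

lemma excited_density_tendsto: "((\<lambda>V. \<Sum>k. box_term k V) \<longlongrightarrow> (\<Sum>k. box_limit k)) at_top"
proof -
  obtain B where B: "summable B" "\<And>k V. V \<ge> 1 \<Longrightarrow> 0 \<le> box_term k V \<and> box_term k V \<le> B k"
    using box_term_bound by blast
  show ?thesis
  proof (rule tendsto_suminf_dominated[OF box_term_tendsto _ B(1)])
    show "\<forall>\<^sub>F V in at_top. \<forall>k. \<bar>box_term k V\<bar> \<le> B k"
      using eventually_ge_at_top[of 1] by eventually_elim (use B(2) in auto)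
  qed auto
qed

text \<open>A law of large numbers: since \<open>y - y^2 \<le> ln (1 + y) \<le> y\<close> and the
  arguments are uniformly small, the logarithm of the transform is asymptotically linear, as for a
  constant.\<close>

lemma excited_log_tendsto:
  assumes s: "s > 0"
  shows "((\<lambda>V. infsum (\<lambda>q. ln (1 + occ (gap_energy \<kappa> a2 a3 V q) * (1 - exp (- s / V)))) excited) \<longlongrightarrow> s * (\<Sum>k. box_limit k)) at_top"
proof -
  let ?u = "\<lambda>V q. occ (gap_energy \<kappa> a2 a3 V q)" and ?s = "\<lambda>V. 1 - exp (- s / V)"
  \<comment> \<open>Bounds the argument for every excited mode, by \<open>occ x \<le> 1 / x\<close>
    and the lower bound on the gap. It has order \<open>V powr (2 * a2 - 1)\<close> and vanishes
    because \<open>a2 < 1 / 2\<close>.\<close>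
  define m where "m V = ?s V * (V powr (2 * a2) / (3 * \<kappa>))" for V
  have bounds: "(1 - m V) * (V * ?s V) * (\<Sum>k. box_term k V) \<le> infsum (\<lambda>q. ln (1 + ?u V q * ?s V)) excited \<and>
     infsum (\<lambda>q. ln (1 + ?u V q * ?s V)) excited \<le> (V * ?s V) * (\<Sum>k. box_term k V)" if V: "V \<ge> 1" for V
  proof -
    have s0: "?s V \<ge> 0" using s V by simp
    note hs = has_sum_cmult_left[OF occ_excited_has_sum[OF V], of "?s V"]
    have u0: "?u V q \<ge> 0" if "q \<in> excited" for q using occ_bounds(1)[OF gap_energy_excited_pos[OF V that]] by simp
    have up: "ln (1 + ?u V q * ?s V) \<le> ?u V q * ?s V" "0 \<le> ln (1 + ?u V q * ?s V)" if "q \<in> excited" for q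
      using u0[OF that] s0 ln_add_one_self_le_self[of "?u V q * ?s V"] by (auto intro!: mult_nonneg_nonneg)
    have lo: "(1 - m V) * (?u V q * ?s V) \<le> ln (1 + ?u V q * ?s V)" if q: "q \<in> excited" for q
    proof -
      define y where "y = ?u V q * ?s V"
      have y0: "y \<ge> 0" using u0[OF q] s0 by (simp add: y_def)
      have "?u V q \<le> 1 / gap_energy \<kappa> a2 a3 V q" by (rule occ_bounds(2)[OF gap_energy_excited_pos[OF V q]])
      also have "\<dots> \<le> 1 / (3 * \<kappa> * V powr (- 2 * a2))"
        using gap_energy_excited_ge[OF \<kappa> V a(2) q] \<kappa> V by (intro divide_left_mono) (auto intro!: mult_pos_pos gap_energy_excited_pos q)
      also have "\<dots> = V powr (2 * a2) / (3 * \<kappa>)" using V by (simp add: powr_minus_divide)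
      finally have ym: "y \<le> m V" using s0 unfolding y_def m_def by (subst mult.commute) (intro mult_left_mono)
      have "y - y\<^sup>2 \<le> ln (1 + y)"
      proof (cases "y \<le> 1")
        case True
        then show ?thesis using ln_one_plus_pos_lower_bound[OF y0] by simp
      next
        case False
        then have "y * 1 \<le> y * y" by (intro mult_left_mono) auto
        moreover have "0 \<le> ln (1 + y)" using y0 by simp
        ultimately show ?thesis by (simp add: power2_eq_square)
      qed
      moreover have "(1 - m V) * y \<le> (1 - y) * y" using ym y0 by (intro mult_right_mono) auto
      ultimately have "(1 - m V) * y \<le> ln (1 + y)" by (simp add: power2_eq_square algebra_simps)
      then show ?thesis by (simp only: y_def)
    qed
    have summ: "(\<lambda>q. ln (1 + ?u V q * ?s V)) summable_on excited"
      by (rule summable_on_comparison_test[OF has_sum_imp_summable[OF hs]]) (use up in auto)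
    have "infsum (\<lambda>q. ln (1 + ?u V q * ?s V)) excited \<le> V * (\<Sum>k. box_term k V) * ?s V"
      by (rule has_sum_mono[OF has_sum_infsum[OF summ] hs]) (use up in auto)
    moreover have "(1 - m V) * (V * (\<Sum>k. box_term k V) * ?s V) \<le> infsum (\<lambda>q. ln (1 + ?u V q * ?s V)) excited"
      by (rule has_sum_mono[OF has_sum_cmult_right[OF hs] has_sum_infsum[OF summ]]) (use lo in auto)
    ultimately show ?thesis by (simp add: mult_ac)
  qed
  have Vs: "((\<lambda>V. V * ?s V) \<longlongrightarrow> s) at_top" using s by real_asymp
  have m: "(m \<longlongrightarrow> 0) at_top" unfolding m_def[abs_def] using s \<kappa> a2_bounds by real_asymp
  show ?thesis
  proof (rule tendsto_sandwich)
    show "((\<lambda>V. (1 - m V) * (V * ?s V) * (\<Sum>k. box_term k V)) \<longlongrightarrow> s * (\<Sum>k. box_limit k)) at_top"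
      using tendsto_mult[OF tendsto_mult[OF tendsto_diff[OF tendsto_const[of 1] m] Vs] excited_density_tendsto] by simp
    show "((\<lambda>V. (V * ?s V) * (\<Sum>k. box_term k V)) \<longlongrightarrow> s * (\<Sum>k. box_limit k)) at_top"
      by (intro tendsto_mult Vs excited_density_tendsto)
    show "\<forall>\<^sub>F V in at_top. (1 - m V) * (V * ?s V) * (\<Sum>k. box_term k V) \<le> infsum (\<lambda>q. ln (1 + ?u V q * ?s V)) excited"
      using eventually_ge_at_top[of 1] by eventually_elim (use bounds in auto)
    show "\<forall>\<^sub>F V in at_top. infsum (\<lambda>q. ln (1 + ?u V q * ?s V)) excited \<le> (V * ?s V) * (\<Sum>k. box_term k V)"
      using eventually_ge_at_top[of 1] by eventually_elim (use bounds in auto)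
  qed
qed

end

subsection \<open>The critical density\<close>

definition dos :: "real \<Rightarrow> real" where
  "dos x = sqrt 2 / (2 * pi\<^sup>2) * (max 0 x) powr (1/2)"

lemma dos_nonneg: "dos x \<ge> 0"
  by (simp add: dos_def)

lemma dos_measurable [measurable]: "dos \<in> borel_measurable borel"
  unfolding dos_def[abs_def] by measurable

lemma Fdos_deriv: "(Fdos has_real_derivative dos x) (at x)"
proof -
  let ?c = "sqrt 2 / (3 * pi\<^sup>2)"
  consider "x > 0" | "x < 0" | "x = 0" by linarith
  then show ?thesis
  proof cases
    case 1
    have "((\<lambda>x. ?c * x powr (3/2)) has_real_derivative ?c * (3/2 * x powr (3/2 - 1))) (at x)"
      by (intro DERIV_cmult has_real_derivative_powr 1)
    also have "?c * (3/2 * x powr (3/2 - 1)) = dos x" using 1 by (simp add: dos_def)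
    finally show ?thesis
    proof (rule has_field_derivative_transform_within_open[where S = "{0<..}"])
      show "\<And>y. y \<in> {0<..} \<Longrightarrow> ?c * y powr (3/2) = Fdos y" by (simp add: Fdos_def)
    qed (use 1 in auto)
  next
    case 2
    have "((\<lambda>x. 0) has_real_derivative 0) (at x)" by simp
    then have "(Fdos has_real_derivative 0) (at x)"
      by (rule has_field_derivative_transform_within_open[where S = "{..<0}"]) (use 2 in \<open>auto simp: Fdos_def\<close>)
    then show ?thesis using 2 by (simp add: dos_def)
  next
    case 3
    have "((\<lambda>h. Fdos h / h) \<longlongrightarrow> 0) (at 0)"
    proof (rule Lim_null_comparison)
      show "\<forall>\<^sub>F h in at 0. norm (Fdos h / h) \<le> ?c * sqrt \<bar>h\<bar>"
      proof (rule eventually_at_topological[THEN iffD2], intro exI[of _ UNIV] conjI ballI impI)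
        fix h :: real assume "h \<noteq> 0"
        show "norm (Fdos h / h) \<le> ?c * sqrt \<bar>h\<bar>"
        proof (cases "h > 0")
          case True
          then have "h powr (3/2) = h * h powr (1/2)" using powr_add[of h 1 "1/2"] by simp
          then show ?thesis using True by (simp add: Fdos_def powr_half_sqrt)
        next
          case False
          then show ?thesis by (simp add: Fdos_def)
        qed
      qed auto
      have "((\<lambda>h::real. ?c * sqrt \<bar>h\<bar>) \<longlongrightarrow> ?c * sqrt \<bar>0\<bar>) (at 0)" by (intro tendsto_intros)
      then show "((\<lambda>h::real. ?c * sqrt \<bar>h\<bar>) \<longlongrightarrow> 0) (at 0)" by simp
    qed
    then show ?thesis using 3 by (simp add: DERIV_def Fdos_def dos_def)
  qed
qed

text \<open>Turns the Stieltjes integral in \<open>rho_c\<close> into a Lebesgue integral.\<close>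

lemma interval_measure_Fdos: "interval_measure Fdos = density lborel (\<lambda>x. ennreal (dos x))"
proof (rule measure_eqI_generator_eq[where E = "range (\<lambda>(i, j). {i<..j::real})" and \<Omega> = UNIV and A = "\<lambda>i. {- real i<..real i}"])
  have mono: "Fdos x \<le> Fdos y" if "x \<le> y" for x y
    unfolding Fdos_def using that by (intro mult_left_mono powr_mono2) auto
  have cont: "continuous (at_right x) Fdos" for x
    using DERIV_isCont[OF Fdos_deriv[of x]] continuous_within_subset[of x UNIV Fdos "{x<..}"] by auto
  have Ioc: "emeasure (interval_measure Fdos) {x<..y} = ennreal (Fdos y - Fdos x)" if "x \<le> y" for x y
    by (rule emeasure_interval_measure_Ioc[OF that]) (use mono cont in auto)
  have dens: "emeasure (density lborel (\<lambda>x. ennreal (dos x))) {x<..y} = ennreal (Fdos y - Fdos x)" if "x \<le> y" for x y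
  proof -
    have "emeasure (density lborel (\<lambda>x. ennreal (dos x))) {x<..y} = (\<integral>\<^sup>+t. ennreal (dos t) * indicator {x<..y} t \<partial>lborel)"
      by (subst emeasure_density) auto
    also have "\<dots> = (\<integral>\<^sup>+t. ennreal (dos t) * indicator {x..y} t \<partial>lborel)"
    proof (rule nn_integral_cong_AE)
      show "AE t in lborel. ennreal (dos t) * indicator {x<..y} t = ennreal (dos t) * indicator {x..y} t"
        using AE_lborel_singleton[of x] by eventually_elim (auto split: split_indicator)
    qed
    also have "\<dots> = ennreal (Fdos y - Fdos x)"
      by (rule nn_integral_FTC_Icc) (use that dos_nonneg Fdos_deriv in \<open>auto intro: has_field_derivative_at_within\<close>)
    finally show ?thesis .
  qed
  show "Int_stable (range (\<lambda>(i, j). {i<..j::real}))"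
  proof (rule Int_stableI)
    fix A B :: "real set" assume "A \<in> range (\<lambda>(i, j). {i<..j})" "B \<in> range (\<lambda>(i, j). {i<..j})"
    then obtain i j i' j' where "A = {i<..j}" "B = {i'<..j'}" by auto
    then have "A \<inter> B = {max i i'<..min j j'}" by auto
    then show "A \<inter> B \<in> range (\<lambda>(i, j). {i<..j})" by auto
  qed
  show "emeasure (interval_measure Fdos) X = emeasure (density lborel (\<lambda>x. ennreal (dos x))) X"
    if X: "X \<in> range (\<lambda>(i, j). {i<..j::real})" for X
  proof -
    from X obtain i j where ij: "X = {i<..j}" by auto
    show ?thesis
    proof (cases "i \<le> j")
      case True
      then show ?thesis by (simp add: ij Ioc dens)
    next
      case False
      then show ?thesis by (simp add: ij)
    qed
  qed
  show "sets (interval_measure Fdos) = sigma_sets UNIV (range (\<lambda>(i, j). {i<..j::real}))"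
    "sets (density lborel (\<lambda>x. ennreal (dos x))) = sigma_sets UNIV (range (\<lambda>(i, j). {i<..j::real}))"
    by (simp_all add: borel_sigma_sets_Ioc)
  have "x \<in> (\<Union>i. {- real i<..real i})" for x :: real
  proof -
    obtain n :: nat where "\<bar>x\<bar> < real n" using reals_Archimedean2 by blast
    then show ?thesis by (intro UN_I[of n]) auto
  qed
  then show "(\<Union>i. {- real i<..real i}) = (UNIV :: real set)" by blast
  show "emeasure (interval_measure Fdos) {- real i<..real i} \<noteq> \<infinity>" for i by (subst Ioc) auto
qed auto

text \<open>The substitution \<open>t = a * x\<close> leads to
  \<open>Gamma (3/2) = sqrt pi / 2\<close>. The nonnegative integral can later be interchanged with
  the sum over \<open>k\<close> without integrability conditions.\<close>

lemma nn_integral_dos_exp: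
  assumes a: "a > 0"
  shows "(\<integral>\<^sup>+x. ennreal (indicator {0<..} x * dos x * exp (- a * x)) \<partial>lborel) =
    ennreal (sqrt 2 / (2 * pi\<^sup>2) * (sqrt pi / 2) / (a * sqrt a))"
proof -
  let ?c = "sqrt 2 / (2 * pi\<^sup>2) / (a * sqrt a)"
  have Gm: "Gamma (3/2 :: real) = sqrt pi / 2"
  proof -
    have "(1/2 :: real) \<notin> \<int>\<^sub>\<le>\<^sub>0"
    proof
      assume "(1/2 :: real) \<in> \<int>\<^sub>\<le>\<^sub>0"
      then obtain n :: int where n: "1/2 = real_of_int n" "n \<le> 0" by (auto elim: nonpos_Ints_cases)
      have "real_of_int n \<le> 0" using n(2) by simp
      then show False using n(1) by linarith
    qed
    from Gamma_plus1[OF this] show ?thesis by (simp add: Gamma_one_half_real)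
  qed
  have "ennreal (Gamma (3/2)) = (\<integral>\<^sup>+t. ennreal (indicator {0..} t * t powr (1/2) / exp t) \<partial>lborel)"
    using Gamma_conv_nn_integral_real[of "3/2"] by simp
  then have "ennreal (sqrt pi / 2) = (\<integral>\<^sup>+t. ennreal (indicator {0..} t * t powr (1/2) / exp t) \<partial>lborel)"
    unfolding Gm .
  also have "\<dots> = ennreal \<bar>a\<bar> * (\<integral>\<^sup>+x. ennreal (indicator {0..} (0 + a * x) * (0 + a * x) powr (1/2) / exp (0 + a * x)) \<partial>lborel)"
    using a by (intro nn_integral_real_affine) auto
  also have "\<dots> = (\<integral>\<^sup>+x. ennreal a * ennreal (indicator {0..} (0 + a * x) * (0 + a * x) powr (1/2) / exp (0 + a * x)) \<partial>lborel)"
    using a by (subst nn_integral_cmult) auto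
  finally have G': "ennreal (sqrt pi / 2) = (\<integral>\<^sup>+x. ennreal a * ennreal (indicator {0..} (0 + a * x) * (0 + a * x) powr (1/2) / exp (0 + a * x)) \<partial>lborel)" .
  have "ennreal ?c * ennreal (sqrt pi / 2) = (\<integral>\<^sup>+x. ennreal ?c * (ennreal a * ennreal (indicator {0..} (0 + a * x) * (0 + a * x) powr (1/2) / exp (0 + a * x))) \<partial>lborel)"
    unfolding G' by (subst nn_integral_cmult) auto
  also have "\<dots> = (\<integral>\<^sup>+x. ennreal (indicator {0<..} x * dos x * exp (- a * x)) \<partial>lborel)"
  proof (intro nn_integral_cong)
    fix x :: real
    have c0: "?c \<ge> 0" using a by simp
    have "?c * (a * (indicator {0..} (0 + a * x) * (0 + a * x) powr (1/2) / exp (0 + a * x))) = indicator {0<..} x * dos x * exp (- a * x)"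
    proof (cases "x > 0")
      case True
      then show ?thesis using a by (simp add: dos_def powr_half_sqrt real_sqrt_mult exp_minus field_simps)
    next
      case False
      then show ?thesis using a by (cases "x = 0") (auto simp: indicator_def zero_le_mult_iff)
    qed
    then show "ennreal ?c * (ennreal a * ennreal (indicator {0..} (0 + a * x) * (0 + a * x) powr (1/2) / exp (0 + a * x)))
        = ennreal (indicator {0<..} x * dos x * exp (- a * x))"
      using c0 a by (metis ennreal_mult' less_imp_le)
  qed
  finally have "(\<integral>\<^sup>+x. ennreal (indicator {0<..} x * dos x * exp (- a * x)) \<partial>lborel) = ennreal ?c * ennreal (sqrt pi / 2)" ..
  also have "\<dots> = ennreal (?c * (sqrt pi / 2))" using a by (intro ennreal_mult[symmetric]) auto
  also have "?c * (sqrt pi / 2) = sqrt 2 / (2 * pi\<^sup>2) * (sqrt pi / 2) / (a * sqrt a)" by simp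
  finally show ?thesis .
qed

context slab_box
begin

lemma box_limit_nonneg: "box_limit k \<ge> 0"
  using \<kappa> by (simp add: box_limit_def)

lemma summable_box_limit: "summable box_limit"
proof -
  obtain B where B: "summable B" "\<And>k V. V \<ge> 1 \<Longrightarrow> 0 \<le> box_term k V \<and> box_term k V \<le> B k"
    using box_term_bound by blast
  have "box_limit k \<le> B k" for k
    by (rule tendsto_upperbound[OF box_term_tendsto eventually_mono[OF eventually_ge_at_top[of 1]]]) (use B(2) in auto)
  then show ?thesis
    by (intro summable_comparison_test[OF _ B(1)]) (use box_limit_nonneg in auto)
qed

text \<open>The geometric expansion of the Bose factor turns the integral into Gamma integrals. The
  \<open>k\<close>-th equals the cube of a half-line Gaussian integral, which is also the limit of
  the lattice sum \<open>box_term k\<close>.\<close>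

lemma rho_c_eq:
  assumes \<beta>: "\<beta> > 0" "\<kappa> = \<beta> * pi\<^sup>2 / 2"
  shows "rho_c \<beta> = (\<Sum>k. box_limit k)"
proof -
  have term_eq: "sqrt 2 / (2 * pi\<^sup>2) * (sqrt pi / 2) / (a * sqrt a) = box_limit k"
    if "a = real (Suc k) * \<beta>" for a k
  proof -
    have a: "a > 0" using that \<beta> by simp
    have cube: "(p * t / (2 * (q * c))) ^ 3 = (p * (p * p) * (t * (t * t))) / (8 * (q * (q * q) * c ^ 3))" for p t q c :: real
      by (simp add: power_divide power_mult_distrib power3_eq_cube mult_ac)
    have "real (Suc k) * \<kappa> = a * pi\<^sup>2 / 2" using that \<beta> by simp
    then have "sqrt (real (Suc k) * \<kappa>) = sqrt (a * pi\<^sup>2 / 2)" by (simp only:)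
    also have "\<dots> = sqrt a * pi / sqrt 2" by (simp add: real_sqrt_mult real_sqrt_divide)
    finally have "box_limit k = (sqrt pi * sqrt 2 / (2 * (sqrt a * pi))) ^ 3" by (simp add: box_limit_def)
    also have "\<dots> = (sqrt pi * (sqrt pi * sqrt pi) * (sqrt 2 * (sqrt 2 * sqrt 2))) / (8 * (sqrt a * (sqrt a * sqrt a) * pi ^ 3))"
      by (rule cube)
    also have "\<dots> = (sqrt pi * pi * (sqrt 2 * 2)) / (8 * (sqrt a * a * pi ^ 3))" using a by simp
    also have "\<dots> = sqrt 2 / (2 * pi\<^sup>2) * (sqrt pi / 2) / (a * sqrt a)"
      using a by (simp add: field_simps power2_eq_square power3_eq_cube)
    finally show ?thesis ..
  qed
  let ?g = "\<lambda>x. indicator {0<..} x * dos x * (1 / (exp (\<beta> * x) - 1))"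
  have "rho_c \<beta> = (\<integral>x. indicator {0<..} x *\<^sub>R inverse (exp (\<beta> * x) - 1) \<partial>density lborel (\<lambda>x. ennreal (dos x)))"
    by (simp add: rho_c_def set_lebesgue_integral_def interval_measure_Fdos)
  also have "\<dots> = (\<integral>x. dos x *\<^sub>R (indicator {0<..} x *\<^sub>R inverse (exp (\<beta> * x) - 1)) \<partial>lborel)"
    by (rule integral_density) (use dos_nonneg in auto)
  also have "\<dots> = (\<integral>x. ?g x \<partial>lborel)"
    by (intro Bochner_Integration.integral_cong) (auto simp: inverse_eq_divide)
  also have "\<dots> = enn2real (\<integral>\<^sup>+x. ennreal (?g x) \<partial>lborel)"
    by (rule integral_eq_nn_integral) (use dos_nonneg \<beta> in \<open>auto simp: indicator_def\<close>)
  also have "(\<integral>\<^sup>+x. ennreal (?g x) \<partial>lborel) = (\<integral>\<^sup>+x. (\<Sum>k. ennreal (indicator {0<..} x * dos x * exp (- (real (Suc k) * \<beta>) * x))) \<partial>lborel)"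
  proof (intro nn_integral_cong)
    fix x :: real
    show "ennreal (?g x) = (\<Sum>k. ennreal (indicator {0<..} x * dos x * exp (- (real (Suc k) * \<beta>) * x)))"
    proof (cases "x > 0")
      case True
      then have "((\<lambda>k. exp (- real (Suc k) * (\<beta> * x))) has_sum occ (\<beta> * x)) UNIV"
        using \<beta> by (intro occ_has_sum) auto
      then have "(\<lambda>k. dos x * exp (- real (Suc k) * (\<beta> * x))) sums (dos x * occ (\<beta> * x))"
        by (intro sums_mult has_sum_imp_sums)
      then have "(\<lambda>k. ennreal (dos x * exp (- real (Suc k) * (\<beta> * x)))) sums ennreal (dos x * occ (\<beta> * x))"
        using dos_nonneg occ_bounds(1)[of "\<beta> * x"] \<beta> True by (subst sums_ennreal) auto
      moreover have "- real (Suc k) * (\<beta> * x) = - (real (Suc k) * \<beta>) * x" for k by (simp add: algebra_simps)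
      ultimately have "(\<lambda>k. ennreal (dos x * exp (- (real (Suc k) * \<beta>) * x))) sums ennreal (dos x * occ (\<beta> * x))"
        by (simp only:)
      then show ?thesis using True by (simp add: sums_iff occ_def)
    qed auto
  qed
  also have "\<dots> = (\<Sum>k. \<integral>\<^sup>+x. ennreal (indicator {0<..} x * dos x * exp (- (real (Suc k) * \<beta>) * x)) \<partial>lborel)"
    by (rule nn_integral_suminf) auto
  also have "\<dots> = (\<Sum>k. ennreal (box_limit k))"
  proof (rule suminf_cong)
    fix k
    show "(\<integral>\<^sup>+x. ennreal (indicator {0<..} x * dos x * exp (- (real (Suc k) * \<beta>) * x)) \<partial>lborel) = ennreal (box_limit k)"
      unfolding term_eq[OF refl, symmetric] by (rule nn_integral_dos_exp) (use \<beta> in simp)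
  qed
  also have "\<dots> = ennreal (\<Sum>k. box_limit k)"
    by (intro suminf_ennreal2 box_limit_nonneg summable_box_limit)
  finally show ?thesis by (simp add: suminf_nonneg summable_box_limit box_limit_nonneg)
qed

end

subsection \<open>The canonical expectation\<close>

context slab_box
begin

definition fugacity :: "real \<Rightarrow> nat \<times> nat \<times> nat \<Rightarrow> real" where
  "fugacity V q = exp (- gap_energy \<kappa> a2 a3 V q)"

definition rest :: "nat \<Rightarrow> (nat \<times> nat \<times> nat) set" where
  "rest n = modes - {(n, 1, 1)}"

text \<open>Minus the logarithm of the Laplace transform at \<open>s / V\<close> of a geometric
  variable with parameter \<open>exp (- x)\<close> and mean \<open>occ x\<close>, where
  \<open>x\<close> is the gap energy.\<close>

definition log_occ :: "real \<Rightarrow> real \<Rightarrow> nat \<times> nat \<times> nat \<Rightarrow> real" where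
  "log_occ V s q = ln (1 + occ (gap_energy \<kappa> a2 a3 V q) * (1 - exp (- s / V)))"

lemma rest_eq: "rest n = (\<lambda>m. (m, 1, 1)) ` ({1..} - {n}) \<union> excited"
  by (auto simp: rest_def modes_def excited_def)

lemma gap_energy_soft: "V > 0 \<Longrightarrow> gap_energy \<kappa> a2 a3 V (m, Suc 0, Suc 0) = \<kappa> * real m ^ 2 / V"
  by (simp add: gap_energy_def powr_minus_divide)

lemma gap_energy_rest_pos:
  assumes "V \<ge> 1" "q \<in> rest n"
  shows "gap_energy \<kappa> a2 a3 V q > 0"
proof (cases "q \<in> excited")
  case True
  then show ?thesis by (rule gap_energy_excited_pos[OF assms(1)])
next
  case False
  then obtain m where "q = (m, Suc 0, Suc 0)" "m \<ge> 1" using assms(2) by (auto simp: rest_eq)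
  then show ?thesis using assms(1) \<kappa> by (simp add: gap_energy_soft)
qed

lemma ln_occ_eq:
  assumes "x > 0" "0 \<le> z" "z \<le> 1"
  shows "ln (1 + occ x * (1 - z)) = - ln (1 - exp (- x)) - (- ln (1 - exp (- x) * z))"
proof -
  have p: "exp (- x) < 1" "exp x > 1" using assms by auto
  have pz: "exp (- x) * z < 1" using p assms by (smt (verit) mult_left_le exp_ge_zero)
  have "1 + occ x * (1 - z) = (exp x - z) / (exp x - 1)" using p by (simp add: occ_def field_simps)
  also have "\<dots> = (exp x * (1 - exp (- x) * z)) / (exp x * (1 - exp (- x)))"
    by (simp add: algebra_simps flip: exp_add mult.assoc)
  also have "\<dots> = (1 - exp (- x) * z) / (1 - exp (- x))" by simp
  finally show ?thesis using p pz by (simp add: ln_div)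
qed

text \<open>The factor \<open>V\<close> in \<open>occ x \<le> 1 / x\<close> cancels against
  \<open>s / V\<close>, which leaves a summable bound uniform in \<open>V\<close>.\<close>

lemma soft_term_bounds:
  assumes V: "V > 0" and s: "s \<ge> 0" and m: "m \<ge> 1"
  shows "0 \<le> log_occ V s (m, 1, 1)" "log_occ V s (m, 1, 1) \<le> s / \<kappa> * (1 / real m ^ 2)"
proof -
  let ?x = "\<kappa> * real m ^ 2 / V"
  have x: "?x > 0" using V m \<kappa> by simp
  have s': "0 \<le> 1 - exp (- s / V)" "1 - exp (- s / V) \<le> s / V"
    using exp_ge_add_one_self[of "- s / V"] s V by auto
  have "occ ?x * (1 - exp (- s / V)) \<le> (1 / ?x) * (s / V)"
    using occ_bounds[OF x] s' x by (intro mult_mono) auto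
  also have "\<dots> = s / \<kappa> * (1 / real m ^ 2)" using V \<kappa> by simp
  finally have le: "occ ?x * (1 - exp (- s / V)) \<le> s / \<kappa> * (1 / real m ^ 2)" .
  have nn: "0 \<le> occ ?x * (1 - exp (- s / V))" using occ_bounds(1)[OF x] s' by simp
  show "0 \<le> log_occ V s (m, 1, 1)" "log_occ V s (m, 1, 1) \<le> s / \<kappa> * (1 / real m ^ 2)"
    using nn le ln_add_one_self_le_self[OF nn] V by (auto simp: log_occ_def gap_energy_soft)
qed

lemma occ_summable_on_rest:
  assumes V: "V \<ge> 1"
  shows "(\<lambda>q. occ (gap_energy \<kappa> a2 a3 V q)) summable_on rest n"
  unfolding rest_eq
proof (rule summable_on_Un_disjoint)
  let ?u = "\<lambda>q. occ (gap_energy \<kappa> a2 a3 V q)"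
  have V0: "V > 0" using V by simp
  have "summable (\<lambda>m. V / \<kappa> * (1 / real m ^ 2))" by (rule summable_mult[OF summable_inverse_squares_real])
  then have "(\<lambda>m. V / \<kappa> * (1 / real m ^ 2)) summable_on UNIV"
    using V0 \<kappa> by (intro summable_nonneg_imp_summable_on) auto
  then have "(\<lambda>m. V / \<kappa> * (1 / real m ^ 2)) summable_on {1..} - {n}" by (rule summable_on_subset_banach) auto
  then have "(\<lambda>m. ?u (m, 1, 1)) summable_on {1..} - {n}"
  proof (rule summable_on_comparison_test)
    fix m assume m: "m \<in> {1..} - {n}"
    then have x: "\<kappa> * real m ^ 2 / V > 0" using V0 \<kappa> by simp
    show "?u (m, 1, 1) \<le> V / \<kappa> * (1 / real m ^ 2)" "0 \<le> ?u (m, 1, 1)"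
      using occ_bounds[OF x] V0 by (simp_all add: gap_energy_soft)
  qed
  then show "?u summable_on (\<lambda>m. (m, 1, 1)) ` ({1..} - {n})"
    by (subst summable_on_reindex) (auto simp: inj_on_def o_def)
  show "?u summable_on excited" using occ_excited_has_sum[OF V] by (rule has_sum_imp_summable)
qed (auto simp: excited_def)

lemma log_occ_bounds:
  assumes "V \<ge> 1" "s \<ge> 0" "q \<in> rest n"
  shows "0 \<le> log_occ V s q" "log_occ V s q \<le> occ (gap_energy \<kappa> a2 a3 V q)"
proof -
  note x = gap_energy_rest_pos[OF assms(1,3)]
  let ?y = "occ (gap_energy \<kappa> a2 a3 V q) * (1 - exp (- s / V))"
  have s': "0 \<le> 1 - exp (- s / V)" "1 - exp (- s / V) \<le> 1" using assms by auto
  have y: "0 \<le> ?y" "?y \<le> occ (gap_energy \<kappa> a2 a3 V q)"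
    using occ_bounds(1)[OF x] s' by (auto simp: mult_left_le)
  then show "0 \<le> log_occ V s q" "log_occ V s q \<le> occ (gap_energy \<kappa> a2 a3 V q)"
    using ln_add_one_self_le_self[OF y(1)] by (auto simp: log_occ_def)
qed

lemma log_occ_summable_on_rest:
  assumes "V \<ge> 1" "s \<ge> 0"
  shows "log_occ V s summable_on rest n"
  by (rule summable_on_comparison_test[OF occ_summable_on_rest[OF assms(1)]]) (use log_occ_bounds assms in auto)

lemma fugacity_bounds:
  assumes "V \<ge> 1" "q \<in> rest n"
  shows "0 \<le> fugacity V q" "fugacity V q < 1"
  using gap_energy_rest_pos[OF assms] by (auto simp: fugacity_def)

lemma ln_fugacity_has_sum:
  fixes n :: nat
  assumes V: "V \<ge> 1" and s: "s \<ge> 0"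
  defines "S0 \<equiv> infsum (\<lambda>q. - ln (1 - fugacity V q)) (rest n)"
  shows "((\<lambda>q. - ln (1 - fugacity V q)) has_sum S0) (rest n)"
    "((\<lambda>q. - ln (1 - fugacity V q * exp (- s / V))) has_sum (S0 - infsum (log_occ V s) (rest n))) (rest n)"
proof -
  have "(\<lambda>q. - ln (1 - fugacity V q)) summable_on rest n"
  proof (rule summable_on_comparison_test[OF occ_summable_on_rest[OF V]])
    fix q assume q: "q \<in> rest n"
    note x = gap_energy_rest_pos[OF V q]
    have "- ln (1 - fugacity V q) = ln (1 + occ (gap_energy \<kappa> a2 a3 V q))"
      using ln_occ_eq[OF x, of 0] by (simp add: fugacity_def)
    then show "- ln (1 - fugacity V q) \<le> occ (gap_energy \<kappa> a2 a3 V q)" "0 \<le> - ln (1 - fugacity V q)"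
      using ln_add_one_self_le_self[of "occ (gap_energy \<kappa> a2 a3 V q)"] occ_bounds(1)[OF x] by auto
  qed
  then show 0: "((\<lambda>q. - ln (1 - fugacity V q)) has_sum S0) (rest n)" by (simp add: S0_def)
  have "((\<lambda>q. - ln (1 - fugacity V q) + (- 1) * log_occ V s q) has_sum (S0 + (- 1) * infsum (log_occ V s) (rest n))) (rest n)"
    by (intro has_sum_add 0 has_sum_cmult_right has_sum_infsum log_occ_summable_on_rest V s)
  then have "((\<lambda>q. - ln (1 - fugacity V q) - log_occ V s q) has_sum (S0 - infsum (log_occ V s) (rest n))) (rest n)"
    by simp
  then show "((\<lambda>q. - ln (1 - fugacity V q * exp (- s / V))) has_sum (S0 - infsum (log_occ V s) (rest n))) (rest n)"
  proof (rule has_sum_cong[THEN iffD1, rotated])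
    fix q assume q: "q \<in> rest n"
    have "0 \<le> exp (- s / V)" "exp (- s / V) \<le> 1" using V s by auto
    from ln_occ_eq[OF gap_energy_rest_pos[OF V q] this]
    show "- ln (1 - fugacity V q) - log_occ V s q = - ln (1 - fugacity V q * exp (- s / V))"
      by (simp add: log_occ_def fugacity_def)
  qed
qed

text \<open>A soft mode of energy \<open>c / V\<close> becomes, after division by \<open>V\<close>,
  an exponential variable of rate \<open>c\<close>; \<open>soft_term_bounds\<close> allows the limit
  inside the sum. The excited modes add a constant, hence a term linear in \<open>s\<close>.\<close>

lemma infsum_log_occ_tendsto:
  assumes s: "s > 0"
  shows "((\<lambda>V. infsum (log_occ V s) (rest n)) \<longlongrightarrow> (\<Sum>m. log_gap \<kappa> n s m) + s * (\<Sum>k. box_limit k)) at_top"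
proof -
  let ?t = "\<lambda>m V. if m = 0 \<or> m = n then 0 else log_occ V s (m, 1, 1)"
  have "((\<lambda>V. \<Sum>m. ?t m V) \<longlongrightarrow> (\<Sum>m. log_gap \<kappa> n s m)) at_top"
  proof (rule tendsto_suminf_dominated)
    show "\<forall>\<^sub>F V in at_top. \<forall>m. \<bar>?t m V\<bar> \<le> s / \<kappa> * (1 / real m ^ 2)"
      using eventually_gt_at_top[of 0]
    proof eventually_elim
      case (elim V)
      show ?case
      proof
        fix m
        show "\<bar>?t m V\<bar> \<le> s / \<kappa> * (1 / real m ^ 2)"
          using soft_term_bounds[OF elim, of s m] s \<kappa> by auto
      qed
    qed
    show "summable (\<lambda>m. s / \<kappa> * (1 / real m ^ 2))" by (rule summable_mult[OF summable_inverse_squares_real])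
    fix m
    show "((\<lambda>V. ?t m V) \<longlongrightarrow> log_gap \<kappa> n s m) at_top"
    proof (cases "m = 0 \<or> m = n")
      case True
      then show ?thesis by (auto simp: log_gap_def)
    next
      case False
      define c where "c = \<kappa> * real m ^ 2"
      have c: "c > 0" using False \<kappa> by (simp add: c_def)
      have "((\<lambda>V. occ (c / V) * (1 - exp (- s / V))) \<longlongrightarrow> inverse c * s) at_top"
        unfolding occ_def using c s by real_asymp
      also have "inverse c * s = s / c" by (simp add: field_simps)
      finally have "((\<lambda>V. occ (c / V) * (1 - exp (- s / V))) \<longlongrightarrow> s / c) at_top" .
      then have "((\<lambda>V. ln (1 + occ (c / V) * (1 - exp (- s / V)))) \<longlongrightarrow> ln (1 + s / c)) at_top"
        using c s by (intro tendsto_ln tendsto_add tendsto_const) (auto simp: add_pos_pos intro!: less_imp_neq[THEN not_sym])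
      moreover have "eventually (\<lambda>V. ln (1 + occ (c / V) * (1 - exp (- s / V))) = ?t m V) at_top"
        using eventually_gt_at_top[of 0] by eventually_elim (use False in \<open>simp add: log_occ_def gap_energy_soft c_def\<close>)
      ultimately have "((\<lambda>V. ?t m V) \<longlongrightarrow> ln (1 + s / c)) at_top" by (rule Lim_transform_eventually)
      then show ?thesis using False by (simp add: log_gap_def c_def)
    qed
  qed auto
  from tendsto_add[OF this excited_log_tendsto[OF s]]
  show ?thesis
  proof (rule Lim_transform_eventually)
    show "\<forall>\<^sub>F V in at_top. (\<Sum>m. ?t m V) + infsum (\<lambda>q. ln (1 + occ (gap_energy \<kappa> a2 a3 V q) * (1 - exp (- s / V)))) excited
        = infsum (log_occ V s) (rest n)"
      using eventually_ge_at_top[of 1]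
    proof eventually_elim
      case (elim V)
      have V0: "V > 0" using elim by simp
      note summ = log_occ_summable_on_rest[OF elim less_imp_le[OF s], of n]
      have sub: "log_occ V s summable_on (\<lambda>m. (m, 1, 1)) ` ({1..} - {n})" "log_occ V s summable_on excited"
        by (rule summable_on_subset_banach[OF summ]; auto simp: rest_eq)+
      have "infsum (log_occ V s) (rest n) = infsum (log_occ V s) ((\<lambda>m. (m, 1, 1)) ` ({1..} - {n})) + infsum (log_occ V s) excited"
        unfolding rest_eq by (rule infsum_Un_disjoint[OF sub]) (auto simp: excited_def)
      also have "infsum (log_occ V s) ((\<lambda>m. (m, 1, 1)) ` ({1..} - {n})) = infsum (\<lambda>m. log_occ V s (m, 1, 1)) ({1..} - {n})"
        by (subst infsum_reindex) (auto simp: inj_on_def o_def)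
      also have "\<dots> = infsum (\<lambda>m. ?t m V) UNIV"
        by (rule infsum_cong_neutral) auto
      also have "\<dots> = (\<Sum>m. ?t m V)"
      proof -
        have sm: "summable (\<lambda>m. ?t m V)"
        proof (rule summable_comparison_test[OF _ summable_mult[OF summable_inverse_squares_real, of "s / \<kappa>"]], intro exI[of _ 0] allI impI)
          fix m
          show "norm (?t m V) \<le> s / \<kappa> * (1 / real m ^ 2)"
            using soft_term_bounds[OF V0, of s m] s \<kappa> by auto
        qed
        have "((\<lambda>m. ?t m V) has_sum (\<Sum>m. ?t m V)) UNIV"
          using soft_term_bounds(1)[OF V0, of s] s by (intro sums_nonneg_imp_has_sum summable_sums sm) auto
        then show ?thesis by (rule infsumI)
      qed
      finally show ?case by (simp add: log_occ_def[abs_def])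
    qed
  qed
qed

section \<open>Reduction of canonical sums to the law of the other modes\<close>

lemma gibbs_eq:
  assumes "\<kappa> = \<beta> * pi\<^sup>2 / 2"
  shows "gibbs \<beta> (1/2) a2 a3 V M = exp (- \<kappa> * (V powr (-2 * a2) + V powr (-2 * a3))) ^ size M * mset_weight (fugacity V) M"
proof (induction M)
  case empty
  then show ?case by (simp add: gibbs_def energy_def mset_weight_def)
next
  case (add q M)
  let ?d = "V powr (-2 * a2) + V powr (-2 * a3)"
  have "\<beta> * eps_box (1/2) a2 a3 V q = \<kappa> * ?d + gap_energy \<kappa> a2 a3 V q"
    by (cases q) (simp add: assms eps_box_def gap_energy_def algebra_simps)
  then have "exp (- \<beta> * eps_box (1/2) a2 a3 V q) = exp (- \<kappa> * ?d) * fugacity V q"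
    by (simp add: fugacity_def flip: exp_add)
  moreover have "gibbs \<beta> (1/2) a2 a3 V (add_mset q M) = exp (- \<beta> * eps_box (1/2) a2 a3 V q) * gibbs \<beta> (1/2) a2 a3 V M"
    by (simp add: gibbs_def energy_def algebra_simps flip: exp_add)
  ultimately show ?case using add by (simp add: mset_weight_def mult_ac)
qed

text \<open>Indexed by the number \<open>i\<close> of particles outside the observed mode. With
  \<open>y = i / V\<close> and \<open>\<rho> = N / V\<close> the exponential is
  \<open>exp (- (\<kappa> * n^2) * (\<rho> - y))\<close>.\<close>

lemma canon_sum_eq:
  assumes \<beta>: "\<kappa> = \<beta> * pi\<^sup>2 / 2" and V: "V \<ge> 1" and n: "n \<ge> 1"
  shows "infsum (\<lambda>M. g (count M (n, 1, 1)) * gibbs \<beta> (1/2) a2 a3 V M) (nstates N) =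
    exp (- \<kappa> * (V powr (-2 * a2) + V powr (-2 * a3))) ^ N *
      (\<Sum>i\<le>N. g (N - i) * exp (- (\<kappa> * real n ^ 2) * real (N - i) / V) * level_sum (fugacity V) (rest n) i)"
proof -
  let ?c = "exp (- \<kappa> * (V powr (-2 * a2) + V powr (-2 * a3))) ^ N"
  have V0: "V > 0" using V by simp
  have st: "nstates N = {M. size M = N \<and> set_mset M \<subseteq> insert (n, 1, 1) (rest n)}"
    using n by (auto simp: nstates_def rest_def modes_def)
  have "infsum (\<lambda>M. g (count M (n, 1, 1)) * gibbs \<beta> (1/2) a2 a3 V M) (nstates N)
      = infsum (\<lambda>M. ?c * (g (count M (n, 1, 1)) * mset_weight (fugacity V) M)) (nstates N)"
    by (intro infsum_cong) (auto simp: gibbs_eq[OF \<beta>] nstates_def)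
  also have "\<dots> = ?c * infsum (\<lambda>M. g (count M (n, 1, 1)) * mset_weight (fugacity V) M) (nstates N)"
    by (rule infsum_cmult_right')
  also have "infsum (\<lambda>M. g (count M (n, 1, 1)) * mset_weight (fugacity V) M) (nstates N)
      = (\<Sum>j\<le>N. g j * fugacity V (n, 1, 1) ^ j * level_sum (fugacity V) (rest n) (N - j))"
    unfolding st by (rule infsum_level_split[OF fugacity_bounds[OF V] ln_fugacity_has_sum(1)[OF V order_refl]])
      (auto simp: rest_def)
  also have "\<dots> = (\<Sum>i\<le>N. g (N - i) * fugacity V (n, 1, 1) ^ (N - i) * level_sum (fugacity V) (rest n) i)"
    by (rule sum.reindex_bij_witness[of _ "\<lambda>i. N - i" "\<lambda>i. N - i"]) auto
  also have "\<dots> = (\<Sum>i\<le>N. g (N - i) * exp (- (\<kappa> * real n ^ 2) * real (N - i) / V) * level_sum (fugacity V) (rest n) i)"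
  proof -
    have "fugacity V (n, 1, 1) ^ k = exp (- (\<kappa> * real n ^ 2) * real k / V)" for k
      by (simp add: fugacity_def gap_energy_soft[OF V0] mult_ac flip: exp_of_nat_mult)
    then show ?thesis by (simp only:)
  qed
  finally show ?thesis .
qed

text \<open>\<open>w N i\<close> is the probability that independent geometric occupation numbers of
  \<open>rest n\<close> add up to \<open>i\<close>. Its normalization \<open>exp (- S0 N)\<close>
  and the transverse ground state factor are common to numerator and denominator and cancel.\<close>

lemma canonical_tendsto:
  assumes \<beta>: "\<beta> > 0" "\<kappa> = \<beta> * pi\<^sup>2 / 2" and \<rho>: "\<rho> > rho_c \<beta>" and n: "n \<ge> 1" and lam: "lam > 0"
    and J1: "((\<lambda>y. exp (- (lam + \<kappa> * real n ^ 2) * (\<rho> - rho_c \<beta> - y)) * gap_density \<kappa> n y) has_integral J1) {0..\<rho> - rho_c \<beta>}"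
    and J0: "((\<lambda>y. exp (- (\<kappa> * real n ^ 2) * (\<rho> - rho_c \<beta> - y)) * gap_density \<kappa> n y) has_integral J0) {0..\<rho> - rho_c \<beta>}"
  shows "(\<lambda>N. canon_at_density \<beta> (1/2) a2 a3 \<rho> N (\<lambda>M. exp (- lam * real (count M (n, 1, 1)) / (real N / \<rho>)))) \<longlonglongrightarrow> J1 / J0"
proof -
  have rc: "rho_c \<beta> = (\<Sum>k. box_limit k)" by (rule rho_c_eq[OF \<beta>])
  have rc0: "rho_c \<beta> \<ge> 0" unfolding rc by (intro suminf_nonneg summable_box_limit box_limit_nonneg)
  then have \<rho>0: "\<rho> > 0" using \<rho> by simp
  \<comment> \<open>Shifting the particle number by \<open>N0\<close> gives
    \<open>V N \<ge> 1\<close> for all \<open>N\<close>, as the bounds on gap energies require; the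
    shift is undone at the end.\<close>
  define N0 where "N0 = Suc (nat \<lceil>\<rho>\<rceil>)"
  have N0: "real N0 \<ge> \<rho>" "N0 > 0" by (auto simp: N0_def) linarith
  define V where "V N = real (N + N0) / \<rho>" for N
  have V1: "V N \<ge> 1" for N using N0 \<rho>0 by (simp add: V_def)
  have V0: "V N > 0" for N using V1[of N] by simp
  have Vlim: "filterlim V at_top sequentially" unfolding V_def[abs_def] using \<rho>0 by real_asymp
  define S0 where "S0 N = infsum (\<lambda>q. - ln (1 - fugacity (V N) q)) (rest n)" for N
  define w where "w N i = level_sum (fugacity (V N)) (rest n) i * exp (- S0 N)" for N i
  define y where "y N i = real i / V N" for N i
  have w_sums: "(\<lambda>i. w N i * exp (- s * y N i)) sums exp (- infsum (log_occ (V N) s) (rest n))" if s: "s \<ge> 0" for N s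
  proof -
    let ?z = "exp (- s / V N)"
    have z: "0 \<le> ?z" "?z \<le> 1" using s V0[of N] by auto
    have b: "0 \<le> fugacity (V N) q * ?z" "fugacity (V N) q * ?z < 1" if "q \<in> rest n" for q
    proof -
      note f = fugacity_bounds[OF V1 that, of N]
      show "0 \<le> fugacity (V N) q * ?z" using f z by simp
      show "fugacity (V N) q * ?z < 1" using f z mult_left_le[of ?z "fugacity (V N) q"] by linarith
    qed
    have "level_sum (\<lambda>q. fugacity (V N) q * ?z) (rest n) sums exp (S0 N - infsum (log_occ (V N) s) (rest n))"
      unfolding S0_def by (rule level_sum_sums[OF b ln_fugacity_has_sum(2)[OF V1 s]])
    then have "(\<lambda>i. level_sum (\<lambda>q. fugacity (V N) q * ?z) (rest n) i * exp (- S0 N)) sums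
        (exp (S0 N - infsum (log_occ (V N) s) (rest n)) * exp (- S0 N))" by (rule sums_mult2)
    moreover have "level_sum (\<lambda>q. fugacity (V N) q * ?z) (rest n) i * exp (- S0 N) = w N i * exp (- s * y N i)" for i
      unfolding level_sum_scale w_def y_def by (simp add: mult_ac flip: exp_of_nat_mult)
    ultimately show ?thesis by (simp flip: exp_add)
  qed
  have main: "(\<lambda>N. \<Sum>i. w N i * (if y N i \<le> \<rho> then exp (- \<mu> * (\<rho> - y N i)) else 0)) \<longlonglongrightarrow> J"
    if \<mu>: "\<mu> \<ge> 0" and J: "((\<lambda>x. exp (- \<mu> * (\<rho> - rho_c \<beta> - x)) * gap_density \<kappa> n x) has_integral J) {0..\<rho> - rho_c \<beta>}" for \<mu> J
  proof (rule laplace_convergence_exp_cutoff[OF _ _ _ gap_density_bounds[OF \<kappa> n] rc0 \<rho> \<mu> _ _ J])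
    show "w N i \<ge> 0" for N i
      unfolding w_def by (intro mult_nonneg_nonneg level_sum_nonneg fugacity_bounds(1)[OF V1]) auto
    show "y N i \<ge> 0" for N i using V0[of N] by (simp add: y_def)
    show "summable (\<lambda>i. w N i * exp (- y N i))" for N
      using w_sums[of 1 N] by (simp add: sums_iff)
    fix k :: nat
    \<comment> \<open>The transform of the soft part translated by \<open>rho_c \<beta>\<close>, at
      \<open>s = k + 1\<close>.\<close>
    let ?L = "exp (- ((\<Sum>m. log_gap \<kappa> n (real (Suc k)) m) + real (Suc k) * rho_c \<beta>))"
    have "(\<lambda>N. exp (- infsum (log_occ (V N) (real (Suc k))) (rest n))) \<longlonglongrightarrow> ?L"
      unfolding rc by (intro tendsto_exp tendsto_minus filterlim_compose[OF infsum_log_occ_tendsto Vlim]) auto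
    then show "(\<lambda>N. \<Sum>i. w N i * exp (- real (Suc k) * y N i)) \<longlonglongrightarrow> ?L"
      using w_sums[of "real (Suc k)"] by (simp add: sums_iff)
    have "((\<lambda>x. exp (- real (Suc k) * rho_c \<beta>) * (exp (- real (Suc k) * x) * gap_density \<kappa> n x)) has_integral
        exp (- real (Suc k) * rho_c \<beta>) * exp (- (\<Sum>m. log_gap \<kappa> n (real (Suc k)) m))) {0..}"
      by (intro has_integral_mult_right gap_density_laplace \<kappa> n) auto
    also have "exp (- real (Suc k) * rho_c \<beta>) * exp (- (\<Sum>m. log_gap \<kappa> n (real (Suc k)) m)) = ?L"
      by (simp add: algebra_simps flip: exp_add)
    also have "(\<lambda>x. exp (- real (Suc k) * rho_c \<beta>) * (exp (- real (Suc k) * x) * gap_density \<kappa> n x))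
        = (\<lambda>x. exp (- real (Suc k) * (x + rho_c \<beta>)) * gap_density \<kappa> n x)"
      by (simp add: fun_eq_iff algebra_simps flip: exp_add mult.assoc)
    finally show "((\<lambda>x. exp (- real (Suc k) * (x + rho_c \<beta>)) * gap_density \<kappa> n x) has_integral ?L) {0..}" .
  qed
  have fin: "(\<Sum>i. w N i * (if y N i \<le> \<rho> then exp (- \<mu> * (\<rho> - y N i)) else 0)) =
      exp (- S0 N) * (\<Sum>i\<le>N + N0. exp (- \<mu> * real (N + N0 - i) / V N) * level_sum (fugacity (V N)) (rest n) i)" for N \<mu>
  proof -
    \<comment> \<open>As \<open>V N = (N + N0) / \<rho>\<close>, the cutoff at density \<rho> is the
      constraint on the particle number.\<close>
    have y_le: "y N i \<le> \<rho> \<longleftrightarrow> i \<le> N + N0" for i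
      using \<rho>0 N0 by (simp add: y_def V_def field_simps flip: of_nat_add)
    have "(\<Sum>i. w N i * (if y N i \<le> \<rho> then exp (- \<mu> * (\<rho> - y N i)) else 0))
        = (\<Sum>i\<in>{..N + N0}. w N i * (if y N i \<le> \<rho> then exp (- \<mu> * (\<rho> - y N i)) else 0))"
      by (rule suminf_finite) (auto simp: y_le)
    also have "\<dots> = (\<Sum>i\<le>N + N0. exp (- S0 N) * (exp (- \<mu> * real (N + N0 - i) / V N) * level_sum (fugacity (V N)) (rest n) i))"
    proof (intro sum.cong refl)
      fix i assume i: "i \<in> {..N + N0}"
      have "\<rho> - y N i = real (N + N0 - i) / V N"
        using i \<rho>0 N0 by (simp add: y_def V_def of_nat_diff field_simps)
      then show "w N i * (if y N i \<le> \<rho> then exp (- \<mu> * (\<rho> - y N i)) else 0)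
        = exp (- S0 N) * (exp (- \<mu> * real (N + N0 - i) / V N) * level_sum (fugacity (V N)) (rest n) i)"
        using i by (simp add: y_le w_def)
    qed
    finally show ?thesis by (simp add: sum_distrib_left)
  qed
  have \<mu>: "\<kappa> * real n ^ 2 \<ge> 0" "lam + \<kappa> * real n ^ 2 \<ge> 0" using \<kappa> lam by auto
  have J0pos: "J0 > 0"
    using gap_density_integral_pos[OF \<kappa> n _ \<mu>(1) J0] \<rho> by simp
  have "(\<lambda>N. (\<Sum>i. w N i * (if y N i \<le> \<rho> then exp (- (lam + \<kappa> * real n ^ 2) * (\<rho> - y N i)) else 0)) /
      (\<Sum>i. w N i * (if y N i \<le> \<rho> then exp (- (\<kappa> * real n ^ 2) * (\<rho> - y N i)) else 0))) \<longlonglongrightarrow> J1 / J0"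
    using J0pos by (intro tendsto_divide main \<mu> J1 J0) auto
  moreover have "(\<Sum>i. w N i * (if y N i \<le> \<rho> then exp (- (lam + \<kappa> * real n ^ 2) * (\<rho> - y N i)) else 0)) /
      (\<Sum>i. w N i * (if y N i \<le> \<rho> then exp (- (\<kappa> * real n ^ 2) * (\<rho> - y N i)) else 0)) =
     canon_at_density \<beta> (1/2) a2 a3 \<rho> (N + N0) (\<lambda>M. exp (- lam * real (count M (n, 1, 1)) / (real (N + N0) / \<rho>)))" for N
  proof -
    note cs = canon_sum_eq[OF \<beta>(2) V1 n, of _ N "N + N0"]
    have num: "infsum (\<lambda>M. exp (- lam * real (count M (n, 1, 1)) / V N) * gibbs \<beta> (1/2) a2 a3 (V N) M) (nstates (N + N0)) =
      exp (- \<kappa> * (V N powr (-2 * a2) + V N powr (-2 * a3))) ^ (N + N0) *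
      (\<Sum>i\<le>N + N0. exp (- (lam + \<kappa> * real n ^ 2) * real (N + N0 - i) / V N) * level_sum (fugacity (V N)) (rest n) i)"
    proof -
      have "exp (- lam * k / V N) * exp (- (\<kappa> * real n ^ 2) * k / V N) = exp (- (lam + \<kappa> * real n ^ 2) * k / V N)" for k
        by (simp add: algebra_simps add_divide_distrib diff_divide_distrib flip: exp_add)
      then show ?thesis using cs[of "\<lambda>j. exp (- lam * real j / V N)"] by (simp only:)
    qed
    have den: "canon_Z \<beta> (1/2) a2 a3 (V N) (N + N0) =
      exp (- \<kappa> * (V N powr (-2 * a2) + V N powr (-2 * a3))) ^ (N + N0) *
      (\<Sum>i\<le>N + N0. exp (- (\<kappa> * real n ^ 2) * real (N + N0 - i) / V N) * level_sum (fugacity (V N)) (rest n) i)"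
      unfolding canon_Z_def using cs[of "\<lambda>_. 1"] by simp
    show ?thesis
      unfolding canon_at_density_def canon_state_def V_def[symmetric] num den fin by simp
  qed
  ultimately have "(\<lambda>N. canon_at_density \<beta> (1/2) a2 a3 \<rho> (N + N0) (\<lambda>M. exp (- lam * real (count M (n, 1, 1)) / (real (N + N0) / \<rho>))))
      \<longlonglongrightarrow> J1 / J0"
    by (simp only:)
  then show ?thesis by (rule LIMSEQ_offset)
qed

end

section \<open>The quotient of Abel sums\<close>

theorem theorem3p10:
  fixes \<alpha>2 \<alpha>3 \<beta> \<rho> lam :: real and n :: nat
  assumes "\<alpha>2 \<le> 1/2" and "\<alpha>3 \<le> \<alpha>2" and "0 < \<alpha>3" and "1/2 + \<alpha>2 + \<alpha>3 = 1"
    and "0 < \<beta>" and "\<rho> > rho_c \<beta>" and "1 \<le> n" and "0 < lam"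
    and "\<forall>m. 1 \<le> m \<and> m \<noteq> n \<longrightarrow> eta \<beta> m n \<noteq> lam"
  shows "\<exists>Num Den.
    abel_sums (\<lambda>m. if m = 0 \<or> m = n then 0 else
        bcoef \<beta> m n * (eta \<beta> m n)^2 / (eta \<beta> m n - lam) *
        (exp (- lam * (\<rho> - rho_c \<beta>)) - exp (- eta \<beta> m n * (\<rho> - rho_c \<beta>)))) Num \<and>
    abel_sums (\<lambda>m. if m = 0 \<or> m = n then 0 else
        bcoef \<beta> m n * eta \<beta> m n * (1 - exp (- eta \<beta> m n * (\<rho> - rho_c \<beta>)))) Den \<and>
    ((\<lambda>N. canon_at_density \<beta> (1/2) \<alpha>2 \<alpha>3 \<rho> N
            (\<lambda>M. exp (- lam * real (count M (n, 1, 1)) / (real N / \<rho>))))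
       \<longlonglongrightarrow> Num / Den)"
proof -
  define \<kappa> where "\<kappa> = \<beta> * pi\<^sup>2 / 2"
  interpret slab_box \<kappa> \<alpha>2 \<alpha>3
    by unfold_locales (use assms in \<open>auto simp: \<kappa>_def\<close>)
  define r where "r = \<rho> - rho_c \<beta>"
  have r: "r > 0" using assms by (simp add: r_def)
  have n: "n \<ge> 1" by fact
  have eta: "eta \<beta> m n = \<kappa> * (real m ^ 2 - real n ^ 2)" for m
    by (simp add: eta_def eps1_def \<kappa>_def field_simps)
  have eta_ne: "eta \<beta> m n \<noteq> 0" if "m \<noteq> n" for m
    using \<kappa> that by (auto simp: eta power2_eq_iff_nonneg)
  obtain S1 where S1: "abel_sums (\<lambda>m. (-1) ^ m * (real m ^ 2 * eta \<beta> m n * ((exp (- lam * r) - exp (- eta \<beta> m n * r)) / (eta \<beta> m n - lam)))) S1"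
    "((\<lambda>y. exp (- (lam + \<kappa> * real n ^ 2) * (r - y)) * gap_density \<kappa> n y) has_integral (2 * exp (- \<kappa> * real n ^ 2 * r) / real n ^ 2 * S1)) {0..r}"
    using gap_density_abel[OF \<kappa> n r, of lam] assms(8,9) unfolding eta by auto
  \<comment> \<open>The denominator is the case \<open>lam = 0\<close>, where the quotient by
    \<open>eta \<beta> m n - 0\<close> cancels the factor \<open>eta \<beta> m n\<close>.\<close>
  obtain S0 where S0: "abel_sums (\<lambda>m. (-1) ^ m * (real m ^ 2 * eta \<beta> m n * ((exp (- 0 * r) - exp (- eta \<beta> m n * r)) / (eta \<beta> m n - 0)))) S0"
    "((\<lambda>y. exp (- (0 + \<kappa> * real n ^ 2) * (r - y)) * gap_density \<kappa> n y) has_integral (2 * exp (- \<kappa> * real n ^ 2 * r) / real n ^ 2 * S0)) {0..r}"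
    using gap_density_abel[OF \<kappa> n r, of 0] eta_ne unfolding eta by auto
  \<comment> \<open>The factor between the terms of the theorem and those of
    \<open>gap_density_abel\<close>, independent of \<open>m\<close> and common to both
    series.\<close>
  define c where "c = (-1) ^ (n + 1) / real n ^ 2"
  have n0: "real n ^ 2 \<noteq> 0" using n by simp
  have c0: "c \<noteq> 0" using n0 by (simp add: c_def)
  have b: "bcoef \<beta> m n * eta \<beta> m n = c * ((-1) ^ m * real m ^ 2)" if "m \<noteq> 0" "m \<noteq> n" for m
    using bcoef_times_eta[OF assms(5), of m n] that n by (simp add: c_def power_add)
  have "(\<lambda>m. if m = 0 \<or> m = n then 0 else bcoef \<beta> m n * (eta \<beta> m n)^2 / (eta \<beta> m n - lam) * (exp (- lam * r) - exp (- eta \<beta> m n * r)))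
     = (\<lambda>m. c * ((-1) ^ m * (real m ^ 2 * eta \<beta> m n * ((exp (- lam * r) - exp (- eta \<beta> m n * r)) / (eta \<beta> m n - lam)))))"
  proof
    fix m
    show "(if m = 0 \<or> m = n then 0 else bcoef \<beta> m n * (eta \<beta> m n)^2 / (eta \<beta> m n - lam) * (exp (- lam * r) - exp (- eta \<beta> m n * r)))
     = c * ((-1) ^ m * (real m ^ 2 * eta \<beta> m n * ((exp (- lam * r) - exp (- eta \<beta> m n * r)) / (eta \<beta> m n - lam))))"
    proof (cases "m = 0 \<or> m = n")
      case True
      then show ?thesis by (auto simp: eta)
    next
      case False
      have "bcoef \<beta> m n * (eta \<beta> m n)^2 / (eta \<beta> m n - lam) * (exp (- lam * r) - exp (- eta \<beta> m n * r))
        = (bcoef \<beta> m n * eta \<beta> m n) * (eta \<beta> m n * ((exp (- lam * r) - exp (- eta \<beta> m n * r)) / (eta \<beta> m n - lam)))"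
        by (simp add: power2_eq_square)
      also have "\<dots> = c * ((-1) ^ m * (real m ^ 2 * eta \<beta> m n * ((exp (- lam * r) - exp (- eta \<beta> m n * r)) / (eta \<beta> m n - lam))))"
        using b[of m] False by (simp only: mult.assoc de_Morgan_disj simp_thms)
      finally show ?thesis using False by (simp only: if_False)
    qed
  qed
  then have A1: "abel_sums (\<lambda>m. if m = 0 \<or> m = n then 0 else bcoef \<beta> m n * (eta \<beta> m n)^2 / (eta \<beta> m n - lam) *
      (exp (- lam * r) - exp (- eta \<beta> m n * r))) (c * S1)"
    using abel_sums_cmult[OF S1(1), of c] by (simp only:)
  have "(\<lambda>m. if m = 0 \<or> m = n then 0 else bcoef \<beta> m n * eta \<beta> m n * (1 - exp (- eta \<beta> m n * r)))
     = (\<lambda>m. c * ((-1) ^ m * (real m ^ 2 * eta \<beta> m n * ((exp (- 0 * r) - exp (- eta \<beta> m n * r)) / (eta \<beta> m n - 0)))))"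
    using b eta_ne by (auto simp: fun_eq_iff eta)
  then have A0: "abel_sums (\<lambda>m. if m = 0 \<or> m = n then 0 else bcoef \<beta> m n * eta \<beta> m n * (1 - exp (- eta \<beta> m n * r))) (c * S0)"
    using abel_sums_cmult[OF S0(1), of c] by (simp only:)
  have lim: "(\<lambda>N. canon_at_density \<beta> (1/2) \<alpha>2 \<alpha>3 \<rho> N (\<lambda>M. exp (- lam * real (count M (n, 1, 1)) / (real N / \<rho>)))) \<longlonglongrightarrow>
     (2 * exp (- \<kappa> * real n ^ 2 * r) / real n ^ 2 * S1) / (2 * exp (- \<kappa> * real n ^ 2 * r) / real n ^ 2 * S0)"
    using S1(2) S0(2) by (intro canonical_tendsto assms \<kappa>_def n) (simp_all add: r_def)
  have "(2 * exp (- \<kappa> * real n ^ 2 * r) / real n ^ 2 * S1) / (2 * exp (- \<kappa> * real n ^ 2 * r) / real n ^ 2 * S0) = (c * S1) / (c * S0)"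
    using c0 n0 by simp
  with lim have "(\<lambda>N. canon_at_density \<beta> (1/2) \<alpha>2 \<alpha>3 \<rho> N (\<lambda>M. exp (- lam * real (count M (n, 1, 1)) / (real N / \<rho>))))
      \<longlonglongrightarrow> (c * S1) / (c * S0)" by (simp only:)
  with A1 A0 show ?thesis unfolding r_def by blast
qed

end
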